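(* Let $f$ be an exact symplectic $C^1$ twist map of $\mathbb{A}$ and let $\mu$ be an irrational Mather measure of $f$. The two following assertions are equivalent: (i) for $\mu$-almost every $x$, $\operatorname{supp}\mu$ is $C^1$-regular at $x$; (ii) the Lyapunov exponents of $\mu$ (for $f$) are zero.
   Context: $\mathbb{T}=\mathbb{R}/\mathbb{Z}$, $\mathbb{A}=\mathbb{T}\times\mathbb{R}$ with coordinates $(\theta,r)$, symplectic form $d\theta\wedge dr$ and its usual Riemannian metric. $\pi:\mathbb{A}\to\mathbb{T}$ is the first projection, $\tilde\pi:\mathbb{R}^2\to\mathbb{R}$ its lift, $p:\mathbb{R}^2\to\mathbb{A}$ the universal covering. A $C^1$ diffeomorphism $f:\mathbb{A}\to\mathbb{A}$ isotopic to the identity is a positive twist map if, for any lift $\tilde f:\mathbb{R}^2\to\mathbb{R}^2$ and every $\tilde\theta\in\mathbb{R}$, the maps $r\mapsto\tilde\pi\circ\tilde f(\tilde\theta,r)$ and $r\mapsto\tilde\pi\circ\tilde f^{-1}(\tilde\theta,r)$ are both diffeomorphisms (of $\mathbb{R}$), the first increasing and the second decreasing. If $f$ is a positive twist map, $f^{-1}$ is a negative twist map. A twist map may be positive or negative. $f$ is exact symplectic if the 1-form $f^*(r\,d\theta)-r\,d\theta$ is exact. A non-empty set $M\subset\mathbb{A}$ is $f$-ordered if it is compact, $f$-invariant, and for all $z,z'\in p^{-1}(M)$: $\tilde\pi(z)<\tilde\pi(z')\Leftrightarrow\tilde\pi(\tilde f(z))<\tilde\pi(\tilde f(z'))$. An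 Aubry-Mather set of $f$ is a minimal (for inclusion) $f$-ordered set. For an Aubry-Mather set $M$ there is a bi-Lipschitz orientation preserving homeomorphism $h$ of $\mathbb{T}$ with $\pi\circ f(\theta,r)=h(\theta)$ for all $(\theta,r)\in M$; the rotation number $\rho(M,\tilde f)$ is that of a lift $\tilde h$ of $h$ with $\tilde h(\tilde\theta)=\tilde\pi\circ\tilde f(\tilde\theta,r)$ on $p^{-1}(M)$. $M$ is irrational if $\rho(M,\tilde f)$ is irrational. Each Aubry-Mather set $M$ carries a unique $f$-invariant Borel probability measure $\mu(M,f)$; it is ergodic with support $M$. Such a measure is called a Mather measure, irrational if $M$ is irrational. The Lyapunov exponents of an (ergodic) Mather measure $\mu$ are those of the cocycle $Df$ over $(f,\mu)$. For $M\subset\mathbb{A}$ and $x\in M$, the paratingent cone $P_M(x)\subset T_x\mathbb{A}$ is the set of limits $v=\lim_{n\to\infty}\frac{x_n-y_n}{t_n}$ where $(x_n),(y_n)$ are sequences in $M$ converging to $x$, $(t_n)$ is a sequence of positive reals converging to $0$, and $x_n-y_n$ denotes the lift in $[-\frac12,\frac12[^2\subset\mathbb{R}^2$. $M$ is $C^1$-regular at $x$ if there is a line $D$ of $T_x\mathbb{A}$ with $P_M(x)\subset D$. *)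

theory Defs
  imports "HOL-Analysis.Analysis"
begin

section \<open>The annulus and its universal covering\<close>

definition int_translate :: "real \<Rightarrow> real \<Rightarrow> bool" where
  "int_translate x y \<longleftrightarrow> x - y \<in> \<int>"

quotient_type circle = real / int_translate
proof (rule equivpI)
  show "reflp int_translate"
    by (auto simp: reflp_def int_translate_def)
  show "symp int_translate"
    unfolding symp_def int_translate_def by (metis Ints_minus minus_diff_eq)
  show "transp int_translate"
    unfolding transp_def int_translate_def by (metis Ints_add diff_add_cancel add_diff_eq)
qed

instantiation circle :: topological_space
begin

definition open_circle :: "circle set \<Rightarrow> bool" where
  "open_circle U \<longleftrightarrow> open (abs_circle -` U)"

instance
  by standard (auto simp: open_circle_def vimage_Union intro: open_Int open_UN)

end

type_synonym annulus = "circle \<times> real"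

definition proj :: "real \<times> real \<Rightarrow> annulus" where
  "proj x = (abs_circle (fst x), snd x)"

definition is_lift :: "(annulus \<Rightarrow> annulus) \<Rightarrow> (real \<times> real \<Rightarrow> real \<times> real) \<Rightarrow> bool" where
  "is_lift f F \<longleftrightarrow> continuous_on UNIV F \<and> (\<forall>x. proj (F x) = f (proj x))"

section \<open>Differential calculus on the annulus\<close>

text \<open>
  The differentiable structure is the one that makes \<^const>\<open>proj\<close> a local diffeomorphism. Every
  tangent space is identified with the plane by the derivative of \<^const>\<open>proj\<close>; this does not
  depend on the chosen preimage, since the deck transformations are translations.
\<close>

definition C1_plane :: "(real \<times> real \<Rightarrow> real \<times> real) \<Rightarrow> bool" where
  "C1_plane F \<longleftrightarrow> (\<exists>F' :: real \<times> real \<Rightarrow> (real \<times> real) \<Rightarrow>\<^sub>L (real \<times> real).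
     (\<forall>x. (F has_derivative blinfun_apply (F' x)) (at x)) \<and> continuous_on UNIV F')"

definition C1_annulus :: "(annulus \<Rightarrow> annulus) \<Rightarrow> bool" where
  "C1_annulus f \<longleftrightarrow> (\<exists>F. is_lift f F \<and> C1_plane F)"

definition C1_diffeo :: "(annulus \<Rightarrow> annulus) \<Rightarrow> bool" where
  "C1_diffeo f \<longleftrightarrow> bij f \<and> C1_annulus f \<and> C1_annulus (inv f)"

definition isotopic_to_id :: "(annulus \<Rightarrow> annulus) \<Rightarrow> bool" where
  "isotopic_to_id f \<longleftrightarrow> homotopic_with C1_diffeo euclidean euclidean id f"

definition annulus_deriv :: "(annulus \<Rightarrow> annulus) \<Rightarrow> annulus \<Rightarrow> real \<times> real \<Rightarrow> real \<times> real" where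
  "annulus_deriv f z =
     (THE L. \<exists>F x. is_lift f F \<and> proj x = z \<and> (F has_derivative L) (at x))"

type_synonym one_form = "annulus \<Rightarrow> real \<times> real \<Rightarrow> real"

definition liouville_form :: one_form where
  "liouville_form z v = snd z * fst v"

definition pullback :: "(annulus \<Rightarrow> annulus) \<Rightarrow> one_form \<Rightarrow> one_form" where
  "pullback f \<omega> z v = \<omega> (f z) (annulus_deriv f z v)"

definition exact_form :: "one_form \<Rightarrow> bool" where
  "exact_form \<omega> \<longleftrightarrow> (\<exists>S :: annulus \<Rightarrow> real.
     \<forall>x. ((\<lambda>y. S (proj y)) has_derivative \<omega> (proj x)) (at x))"

definition exact_symplectic :: "(annulus \<Rightarrow> annulus) \<Rightarrow> bool" where
  "exact_symplectic f \<longleftrightarrow>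
     exact_form (\<lambda>z v. pullback f liouville_form z v - liouville_form z v)"

section \<open>Twist maps\<close>

definition C1_diffeo_real :: "(real \<Rightarrow> real) \<Rightarrow> bool" where
  "C1_diffeo_real g \<longleftrightarrow>
     bij g \<and> g C1_differentiable_on UNIV \<and> inv g C1_differentiable_on UNIV"

definition positive_twist_map :: "(annulus \<Rightarrow> annulus) \<Rightarrow> bool" where
  "positive_twist_map f \<longleftrightarrow> C1_diffeo f \<and> isotopic_to_id f \<and>
     (\<forall>F. is_lift f F \<longrightarrow> (\<forall>\<theta>.
        C1_diffeo_real (\<lambda>r. fst (F (\<theta>, r))) \<and> strict_mono (\<lambda>r. fst (F (\<theta>, r))) \<and>
        C1_diffeo_real (\<lambda>r. fst (inv F (\<theta>, r))) \<and>
        strict_antimono_on UNIV (\<lambda>r. fst (inv F (\<theta>, r)))))"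

definition negative_twist_map :: "(annulus \<Rightarrow> annulus) \<Rightarrow> bool" where
  "negative_twist_map f \<longleftrightarrow> (\<exists>g. positive_twist_map g \<and> f = inv g)"

definition twist_map :: "(annulus \<Rightarrow> annulus) \<Rightarrow> bool" where
  "twist_map f \<longleftrightarrow> positive_twist_map f \<or> negative_twist_map f"

section \<open>Aubry-Mather sets and Mather measures\<close>

definition ordered_set :: "(annulus \<Rightarrow> annulus) \<Rightarrow> annulus set \<Rightarrow> bool" where
  "ordered_set f M \<longleftrightarrow> M \<noteq> {} \<and> compact M \<and> f ` M = M \<and>
     (\<forall>F. is_lift f F \<longrightarrow> (\<forall>z\<in>proj -` M. \<forall>z'\<in>proj -` M.
        fst z < fst z' \<longleftrightarrow> fst (F z) < fst (F z')))"

definition Aubry_Mather_set :: "(annulus \<Rightarrow> annulus) \<Rightarrow> annulus set \<Rightarrow> bool" where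
  "Aubry_Mather_set f M \<longleftrightarrow>
     ordered_set f M \<and> (\<forall>N. N \<subseteq> M \<and> ordered_set f N \<longrightarrow> N = M)"

text \<open>Lifts to the line of bi-Lipschitz orientation preserving homeomorphisms of the circle.\<close>

definition bilipschitz_circle_lift :: "(real \<Rightarrow> real) \<Rightarrow> bool" where
  "bilipschitz_circle_lift h \<longleftrightarrow> bij h \<and> strict_mono h \<and> (\<forall>x. h (x + 1) = h x + 1) \<and>
     (\<exists>C. C-lipschitz_on UNIV h) \<and> (\<exists>C. C-lipschitz_on UNIV (inv h))"

text \<open>
  The rotation number of \<open>M\<close> with respect to the lift \<open>F\<close>. Another choice of the interpolating
  map \<open>h\<close> gives the same number; another choice of \<open>F\<close> changes it by an integer.
\<close>

definition has_rotation_number ::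
    "annulus set \<Rightarrow> (real \<times> real \<Rightarrow> real \<times> real) \<Rightarrow> real \<Rightarrow> bool" where
  "has_rotation_number M F \<rho> \<longleftrightarrow> (\<exists>h. bilipschitz_circle_lift h \<and>
     (\<forall>z\<in>proj -` M. h (fst z) = fst (F z)) \<and>
     (\<forall>t. (\<lambda>n. ((h ^^ n) t - t) / real n) \<longlonglongrightarrow> \<rho>))"

definition irrational_Aubry_Mather_set :: "(annulus \<Rightarrow> annulus) \<Rightarrow> annulus set \<Rightarrow> bool" where
  "irrational_Aubry_Mather_set f M \<longleftrightarrow> Aubry_Mather_set f M \<and>
     (\<exists>F \<rho>. is_lift f F \<and> has_rotation_number M F \<rho> \<and> \<rho> \<notin> \<rat>)"

definition invariant_prob_on ::
    "(annulus \<Rightarrow> annulus) \<Rightarrow> annulus set \<Rightarrow> annulus measure \<Rightarrow> bool" where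
  "invariant_prob_on f M \<mu> \<longleftrightarrow> sets \<mu> = sets borel \<and> emeasure \<mu> (space \<mu>) = 1 \<and>
     distr \<mu> borel f = \<mu> \<and> (AE x in \<mu>. x \<in> M)"

definition irrational_Mather_measure :: "(annulus \<Rightarrow> annulus) \<Rightarrow> annulus measure \<Rightarrow> bool" where
  "irrational_Mather_measure f \<mu> \<longleftrightarrow>
     (\<exists>M. irrational_Aubry_Mather_set f M \<and> invariant_prob_on f M \<mu>)"

definition supp :: "'a::topological_space measure \<Rightarrow> 'a set" where
  "supp \<mu> = {x. \<forall>U. open U \<and> x \<in> U \<longrightarrow> emeasure \<mu> U > 0}"

section \<open>Regularity\<close>

text \<open>
  The representative in the plane of the difference of two points of the annulus. Only the first
  coordinate needs to be normalised: the second one is a real number, and it tends to \<open>0\<close> for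
  sequences with a common limit.
\<close>

definition annulus_diff :: "annulus \<Rightarrow> annulus \<Rightarrow> real \<times> real" where
  "annulus_diff x y =
     (THE v. fst v \<in> {-1/2..<1/2} \<and> (\<exists>z. proj z = y \<and> proj (z + v) = x))"

definition paratingent_cone :: "annulus set \<Rightarrow> annulus \<Rightarrow> (real \<times> real) set" where
  "paratingent_cone M x = {v. \<exists>X Y t.
     (\<forall>n::nat. X n \<in> M) \<and> (\<forall>n. Y n \<in> M) \<and> X \<longlonglongrightarrow> x \<and> Y \<longlonglongrightarrow> x \<and>
     (\<forall>n. t n > (0::real)) \<and> t \<longlonglongrightarrow> 0 \<and>
     (\<lambda>n. annulus_diff (X n) (Y n) /\<^sub>R t n) \<longlonglongrightarrow> v}"

definition C1_regular_at :: "annulus set \<Rightarrow> annulus \<Rightarrow> bool" where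
  "C1_regular_at M x \<longleftrightarrow> (\<exists>D. subspace D \<and> dim D = 1 \<and> paratingent_cone M x \<subseteq> D)"

section \<open>Lyapunov exponents\<close>

primrec cocycle :: "('a \<Rightarrow> 'b \<Rightarrow> 'b) \<Rightarrow> ('a \<Rightarrow> 'a) \<Rightarrow> nat \<Rightarrow> 'a \<Rightarrow> 'b \<Rightarrow> 'b" where
  "cocycle A f 0 x v = v"
| "cocycle A f (Suc n) x v = A ((f ^^ n) x) (cocycle A f n x v)"

text \<open>
  The Lyapunov exponents of a linear cocycle over an ergodic measure: the exponential growth rates
  that are realised by a non-zero vector at almost every point.
\<close>

definition lyapunov_exponents ::
    "('a \<Rightarrow> 'b::real_normed_vector \<Rightarrow> 'b) \<Rightarrow> ('a \<Rightarrow> 'a) \<Rightarrow> 'a measure \<Rightarrow> real set" where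
  "lyapunov_exponents A f \<mu> = {c. AE x in \<mu>. \<exists>v. v \<noteq> 0 \<and>
     (\<lambda>n. ln (norm (cocycle A f n x v)) / real n) \<longlonglongrightarrow> c}"

end

theory Submission
  imports Defs
begin

text \<open>
  Let \<open>M\<close> be the support of \<open>\<mu>\<close>. Its lift to the plane is the graph of a Lipschitz function \<open>g\<close>
  over a closed periodic set \<open>K\<close> of reals, and the lifted dynamics is a homeomorphism \<open>h\<close> of the
  line acting on \<open>K\<close>. Along pairs of distinct points of \<open>K\<close> that converge to \<open>t\<close>, let \<open>S\<^sup>+ t\<close> and
  \<open>S\<^sup>- t\<close> be the upper and lower limits of the difference quotients of \<open>g\<close>, and \<open>D\<^sup>+ t\<close> and
  \<open>D\<^sup>- t\<close> those of \<open>h\<close>. They are written \<open>S \<sigma>\<close> and \<open>D \<sigma>\<close> with \<open>\<sigma> = 1\<close> and \<open>\<sigma> = - 1\<close> below. The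
  extreme directions of the paratingent cone over \<open>t\<close> have the slopes \<open>S\<^sup>+ t\<close> and \<open>S\<^sup>- t\<close>, so \<open>M\<close> is
  \<open>C\<^sup>1\<close>-regular there iff \<open>S\<^sup>+ t = S\<^sup>- t\<close>.

  Let \<open>a, b\<close> and \<open>c, d\<close> be the rows of the derivative of the map along the graph. Exactness gives
  \<open>a d - b c = 1\<close> (\<open>exact_imp_det_1\<close>), and after a reflection of the vertical coordinate the twist
  condition gives \<open>b > 0\<close>. The derivative acts on slopes by a Moebius map that is increasing, hence
  it sends \<open>(1, S\<^sup>\<plusminus> t)\<close> to \<open>D\<^sup>\<plusminus> t\<close> times \<open>(1, S\<^sup>\<plusminus> (h t))\<close>, with \<open>D\<^sup>\<plusminus> = a + b S\<^sup>\<plusminus> > 0\<close>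
  (\<open>S_equivariant\<close>, \<open>D_eq\<close>): the two extreme slopes are invariant line fields, and the growth along
  them is the product of the \<open>D\<^sup>\<plusminus>\<close> along the orbit.

  Zero exponents force regularity (\<open>zero_exponents_imp_regular\<close>). Put \<open>\<Delta> = S\<^sup>+ - S\<^sup>-\<close>, and let
  \<open>P\<^sup>\<plusminus>\<close> be the product of the \<open>D\<^sup>\<plusminus>\<close> over the first \<open>n\<close> points of the orbit of \<open>t\<close>. Preservation of
  area gives \<open>P\<^sup>+ P\<^sup>- = \<Delta> t / \<Delta> (h\<^sup>n t)\<close>. On the set \<open>\<Delta> \<ge> \<delta>\<close> the ratio \<open>D\<^sup>+ / D\<^sup>-\<close> is at least some
  \<open>q > 1\<close>, and it is at least \<open>1\<close> everywhere. At a time \<open>n\<close> at which the orbit is in this set after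
  \<open>N\<close> earlier visits, \<open>P\<^sup>-\<close> is therefore at most a constant times \<open>q\<^sup>-\<^sup>N\<^sup>/\<^sup>2\<close>; vectors on the lower slope are
  contracted and all others expanded at this rate. A vector with exponent \<open>0\<close> can exist only if the
  visits to \<open>\<Delta> \<ge> \<delta>\<close> have frequency \<open>0\<close>. But the frequency of visits has the measure of the set as
  its mean, so the set is a null set.

  Regularity forces zero exponents (\<open>regular_imp_zero_exponents\<close>). The distribution function \<open>H\<close> of
  the measure semiconjugates \<open>h\<close> to the translation by \<open>\<rho>\<close>. If \<open>p / Q\<close> is a reduced fraction with
  \<open>\<bar>Q \<rho> - p\<bar> < 1 / Q\<close>, then the first \<open>Q\<close> points of every orbit are distributed over the \<open>Q\<close>
  cells of length \<open>1 / Q\<close> in the same way, up to an error of one cell. The sums over \<open>Q\<close> steps of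
  \<open>ln D\<^sup>+\<close> along one orbit and of \<open>ln D\<^sup>-\<close> along another thus differ at most by the sum of the
  oscillations over the cells, which is \<open>o(Q)\<close> because \<open>D\<^sup>+\<close> and \<open>D\<^sup>-\<close> agree almost everywhere and
  are continuous where they agree (\<open>small_block\<close>). On the other hand no iterate of \<open>h\<close>
  contracts or expands the infinite set \<open>K\<close> uniformly (\<open>no_uniform_contraction\<close>), so some of the upper sums are almost nonnegative and some of
  the lower ones almost nonpositive. All these sums are therefore \<open>o(Q)\<close>, at every point. In the
  basis \<open>(1, S), (0, 1)\<close> the derivative is triangular with diagonal \<open>D, 1 / D\<close>, so at a regular point
  every nonzero vector has the exponent \<open>0\<close>.
\<close>

section \<open>The circle and lifts to the plane\<close>

lemma abs_circle_eq_iff: "abs_circle x = abs_circle y \<longleftrightarrow> x - y \<in> \<int>"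
  by (simp add: circle.abs_eq_iff int_translate_def)

lemma abs_circle_eq_iff_ex: "abs_circle x = abs_circle y \<longleftrightarrow> (\<exists>k::int. x = y + of_int k)"
proof
  assume "abs_circle x = abs_circle y"
  then obtain k :: int where "x - y = of_int k" unfolding abs_circle_eq_iff by (elim Ints_cases)
  then show "\<exists>k::int. x = y + of_int k" by (intro exI[of _ k]) simp
qed (auto simp: abs_circle_eq_iff)

lemma abs_circle_surj: "\<exists>t. abs_circle t = x"
  using Quotient3_abs_rep[OF Quotient3_circle] by blast

lemma continuous_abs_circle: "continuous_on UNIV abs_circle"
  unfolding continuous_on_open_vimage[OF open_UNIV] using open_circle_def by auto

lemma open_abs_circle_image: "open A \<Longrightarrow> open (abs_circle ` A)"
proof -
  assume A: "open A"
  have "abs_circle -` (abs_circle ` A) = (\<Union>k::int. (\<lambda>x. x + of_int k) -` A)"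
  proof (intro equalityI subsetI)
    fix x assume "x \<in> abs_circle -` (abs_circle ` A)"
    then obtain y where y: "y \<in> A" "abs_circle y = abs_circle x" by auto
    then obtain k :: int where "y = x + of_int k" unfolding abs_circle_eq_iff_ex by blast
    then show "x \<in> (\<Union>k::int. (\<lambda>x. x + of_int k) -` A)" using y by auto
  next
    fix x assume "x \<in> (\<Union>k::int. (\<lambda>x. x + of_int k) -` A)"
    then obtain k :: int where k: "x + of_int k \<in> A" by auto
    have "abs_circle x = abs_circle (x + of_int k)" by (simp add: abs_circle_eq_iff)
    then show "x \<in> abs_circle -` (abs_circle ` A)" using k by blast
  qed
  also have "open \<dots>"
  proof (intro open_UN ballI)
    fix k :: int
    show "open ((\<lambda>x. x + of_int k) -` A)" by (rule open_vimage[OF A]) (intro continuous_intros)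
  qed
  finally show ?thesis by (simp add: open_circle_def)
qed

instance circle :: t2_space
proof
  fix x y :: circle assume "x \<noteq> y"
  obtain s where s: "abs_circle s = x" using abs_circle_surj by blast
  obtain t where t: "abs_circle t = y" using abs_circle_surj by blast
  note st = s[symmetric] t[symmetric]
  then have "s - t \<notin> \<int>" using \<open>x \<noteq> y\<close> abs_circle_eq_iff by blast
  then have fr: "frac (s - t) > 0" by simp
  define e where "e = min (frac (s - t)) (1 - frac (s - t)) / 2"
  have e: "e > 0" using fr frac_lt_1[of "s - t"] by (simp add: e_def)
  have "abs_circle ` ball s e \<inter> abs_circle ` ball t e = {}"
  proof (rule ccontr)
    assume "abs_circle ` ball s e \<inter> abs_circle ` ball t e \<noteq> {}"
    then obtain s' t' where "s' \<in> ball s e" "t' \<in> ball t e" and eq: "abs_circle s' = abs_circle t'"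
      by blast
    then have s': "\<bar>s - s'\<bar> < e" "\<bar>t - t'\<bar> < e" "abs_circle s' = abs_circle t'"
      by (simp_all add: dist_real_def)
    then obtain k :: int where "s' = t' + of_int k" unfolding abs_circle_eq_iff_ex by blast
    then have k: "\<bar>(s - t) - of_int k\<bar> < 2 * e" using s' by linarith
    have "real_of_int k \<le> of_int \<lfloor>s - t\<rfloor> \<or> of_int (\<lfloor>s - t\<rfloor> + 1) \<le> real_of_int k"
      unfolding of_int_le_iff by (cases "k \<le> \<lfloor>s - t\<rfloor>") auto
    moreover have "2 * e \<le> frac (s - t)" "2 * e \<le> 1 - frac (s - t)" by (simp_all add: e_def)
    moreover have "s - t = of_int \<lfloor>s - t\<rfloor> + frac (s - t)" by (simp add: frac_def)
    ultimately show False using k by linarith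
  qed
  moreover have "x \<in> abs_circle ` ball s e" "y \<in> abs_circle ` ball t e" using st e by auto
  ultimately show "\<exists>U V. open U \<and> open V \<and> x \<in> U \<and> y \<in> V \<and> U \<inter> V = {}"
    using open_abs_circle_image[OF open_ball, of s e] open_abs_circle_image[OF open_ball, of t e]
    by (intro exI[of _ "abs_circle ` ball s e"] exI[of _ "abs_circle ` ball t e"] conjI)
qed

lemma proj_eq_iff: "proj x = proj y \<longleftrightarrow> (\<exists>k::int. x = y + (of_int k, 0))"
  by (cases x; cases y) (auto simp: proj_def abs_circle_eq_iff_ex)

lemma proj_shift [simp]: "proj (x + (of_int k, 0)) = proj x"
  using proj_eq_iff by blast

lemma proj_surj: "\<exists>x. proj x = z"
proof -
  obtain t where "abs_circle t = fst z" using abs_circle_surj by blast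
  then have "proj (t, snd z) = z" by (simp add: proj_def prod_eq_iff)
  then show ?thesis by blast
qed

lemma snd_proj [simp]: "snd (proj x) = snd x" and fst_proj [simp]: "fst (proj x) = abs_circle (fst x)"
  by (simp_all add: proj_def)

lemma continuous_proj: "continuous_on UNIV proj"
  unfolding proj_def[abs_def]
  by (intro continuous_on_Pair continuous_on_compose2[OF continuous_abs_circle] continuous_intros) auto

lemma open_proj_image: "open A \<Longrightarrow> open (proj ` A)"
proof (subst open_subopen, intro ballI)
  assume A: "open A"
  fix z assume "z \<in> proj ` A"
  then obtain x where x: "x \<in> A" "z = proj x" by blast
  then obtain U V where UV: "open U" "open V" "x \<in> U \<times> V" "U \<times> V \<subseteq> A" using A by (metis open_prod_elim)
  have "abs_circle ` U \<times> V \<subseteq> proj ` A"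
  proof
    fix w assume "w \<in> abs_circle ` U \<times> V"
    then obtain u where "u \<in> U" "w = proj (u, snd w)" "snd w \<in> V" by (auto simp: proj_def)
    then show "w \<in> proj ` A" using UV(4) by blast
  qed
  moreover have "open (abs_circle ` U \<times> V)" using UV by (intro open_Times open_abs_circle_image)
  moreover have "z \<in> abs_circle ` U \<times> V" using x UV by (auto simp: proj_def)
  ultimately show "\<exists>T. open T \<and> z \<in> T \<and> T \<subseteq> proj ` A" by blast
qed

lemma integer_valued_constant:
  fixes q :: "real \<times> real \<Rightarrow> real"
  assumes "continuous_on UNIV q" "\<And>x. q x \<in> \<int>"
  shows "\<exists>k::int. \<forall>x. q x = of_int k"
proof -
  have "q constant_on UNIV"
  proof (rule continuous_discrete_range_constant[OF _ assms(1)])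
    show "connected (UNIV :: (real \<times> real) set)" by (rule connected_UNIV)
    fix x :: "real \<times> real"
    show "\<exists>e>0. \<forall>y. y \<in> UNIV \<and> q y \<noteq> q x \<longrightarrow> e \<le> norm (q y - q x)"
    proof (intro exI[of _ 1] conjI allI impI)
      fix y assume "y \<in> UNIV \<and> q y \<noteq> q x"
      moreover obtain m n :: int where "q x = of_int m" "q y = of_int n"
        using assms(2) by (metis Ints_cases)
      ultimately show "1 \<le> norm (q y - q x)" by (simp flip: of_int_diff of_int_abs)
    qed simp
  qed
  moreover obtain k :: int where "q 0 = of_int k" using assms(2) by (metis Ints_cases)
  ultimately show ?thesis unfolding constant_on_def by (metis UNIV_I)
qed

lemma lift_proj: "is_lift f F \<Longrightarrow> f (proj x) = proj (F x)"
  unfolding is_lift_def by (metis prod.collapse)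

text \<open>
  The difference of two lifts is continuous and takes values in the integers, and the plane is connected.
\<close>

lemma lift_unique:
  assumes "is_lift f F" "is_lift f G"
  shows "\<exists>k::int. \<forall>x. G x = F x + (of_int k, 0)"
proof -
  have eq: "proj (G x) = proj (F x)" for x using lift_proj assms by metis
  have "\<exists>k::int. \<forall>x. fst (G x) - fst (F x) = of_int k"
  proof (rule integer_valued_constant)
    show "continuous_on UNIV (\<lambda>x. fst (G x) - fst (F x))"
      using assms by (auto simp: is_lift_def intro!: continuous_intros)
    show "fst (G x) - fst (F x) \<in> \<int>" for x
      using eq[of x] by (simp add: proj_def abs_circle_eq_iff)
  qed
  then obtain k :: int where k: "\<And>x. fst (G x) - fst (F x) = of_int k" by blast
  have "G x = F x + (of_int k, 0)" for x
    using k[of x] eq[of x] by (simp add: proj_def prod_eq_iff algebra_simps)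
  then show ?thesis by blast
qed

lemma lift_translate: "is_lift f F \<Longrightarrow> is_lift f (\<lambda>x. F (x + (of_int m, 0)))"
proof -
  assume F: "is_lift f F"
  have "continuous_on UNIV (\<lambda>x. F (x + (of_int m, 0)))"
    by (rule continuous_on_compose2[of UNIV F]) (use F in \<open>auto simp: is_lift_def intro!: continuous_intros\<close>)
  moreover have "proj (F (x + (of_int m, 0))) = f (proj x)" for x
    using lift_proj[OF F, of "x + (of_int m, 0)"] by (simp only: proj_shift)
  ultimately show ?thesis by (simp add: is_lift_def del: split_paired_All)
qed

text \<open>
  The covering projection is an open surjection, so continuity descends from the lift.
\<close>

lemma lift_continuous: "is_lift f F \<Longrightarrow> continuous_on UNIV f"
proof -
  assume F: "is_lift f F"
  have "open (f -` U)" if U: "open U" for U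
  proof -
    have "f -` U = proj ` ((\<lambda>x. proj (F x)) -` U)"
    proof (intro equalityI subsetI)
      fix z assume z: "z \<in> f -` U"
      obtain x where "proj x = z" using proj_surj by blast
      then show "z \<in> proj ` ((\<lambda>x. proj (F x)) -` U)"
        using z lift_proj[OF F, of x] by (intro image_eqI[of _ _ x]) auto
    qed (use lift_proj[OF F] in auto)
    also have "open \<dots>"
    proof (intro open_proj_image open_vimage U)
      show "continuous_on UNIV (\<lambda>x. proj (F x))"
        by (rule continuous_on_compose2[OF continuous_proj]) (use F in \<open>auto simp: is_lift_def\<close>)
    qed
    finally show ?thesis .
  qed
  then show ?thesis unfolding continuous_on_open_vimage[OF open_UNIV] by simp
qed

lemma C1_plane_lift: "C1_annulus f \<Longrightarrow> is_lift f F \<Longrightarrow> C1_plane F"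
proof -
  assume "C1_annulus f" and F: "is_lift f F"
  then obtain G where G: "is_lift f G" "C1_plane G" unfolding C1_annulus_def by blast
  obtain k :: int where k: "\<And>x. F x = G x + (of_int k, 0)" using lift_unique[OF G(1) F] by blast
  have "F = (\<lambda>x. G x + (of_int k, 0))" using k by blast
  moreover obtain G' where "\<And>x. (G has_derivative blinfun_apply (G' x)) (at x)" "continuous_on UNIV G'"
    using G(2) unfolding C1_plane_def by blast
  ultimately show ?thesis unfolding C1_plane_def by (intro exI[of _ G']) (auto intro!: derivative_eq_intros)
qed

text \<open>
  The definite description in \<^const>\<open>annulus_deriv\<close> denotes the derivative of any lift at any
  preimage: lifts and preimages change only by translations.
\<close>

lemma annulus_deriv_proj:
  assumes F: "is_lift f F" and L: "(F has_derivative L) (at x)"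
  shows "annulus_deriv f (proj x) = L"
  unfolding annulus_deriv_def
proof (rule the_equality)
  show "\<exists>F x'. is_lift f F \<and> proj x' = proj x \<and> (F has_derivative L) (at x')" using assms by blast
  fix L' assume "\<exists>F x'. is_lift f F \<and> proj x' = proj x \<and> (F has_derivative L') (at x')"
  then obtain G x' where G: "is_lift f G" "proj x' = proj x" "(G has_derivative L') (at x')" by blast
  obtain m :: int where m: "x = x' + (of_int m, 0)" using G(2) proj_eq_iff by metis
  obtain k :: int where k: "\<And>y. F (y + (of_int m, 0)) = G y + (of_int k, 0)"
    using lift_unique[OF G(1) lift_translate[OF F, of m]] by blast
  have "((\<lambda>y. F (y + (of_int m, 0))) has_derivative L) (at x')"
  proof -
    have sh: "((\<lambda>y. y + (of_int m, 0)) has_derivative (\<lambda>v. v)) (at x')"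
      by (auto intro!: derivative_eq_intros)
    have "(F has_derivative L) (at (x' + (of_int m, 0)))" using L m by simp
    from has_derivative_compose[OF sh this] show ?thesis .
  qed
  then have "((\<lambda>y. G y + (of_int k, 0)) has_derivative L) (at x')" using k by simp
  moreover have "((\<lambda>y. G y + (of_int k, 0)) has_derivative L') (at x')"
    using G(3) by (auto intro!: derivative_eq_intros)
  ultimately show "L' = L" by (rule has_derivative_unique[symmetric])
qed

section \<open>Area preservation\<close>

text \<open>
  The increments of \<open>\<Phi>\<close> along opposite sides of a square of side \<open>s\<close> at the origin differ by
  \<open>\<kappa> s\<^sup>2\<close> up to \<open>o(s\<^sup>2)\<close> for one pair of sides, and by \<open>o(s\<^sup>2)\<close> for the other pair. Both differences
  are the same combination of the four values of \<open>\<Phi>\<close> at the corners. The mean value theorem does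
  the work of Stokes' formula, which would ask for one more derivative.
\<close>

lemma exact_area_defect_zero:
  fixes \<Phi> :: "real \<times> real \<Rightarrow> real"
  assumes der: "\<And>u. (\<Phi> has_derivative (\<lambda>v. \<kappa> * snd u * fst v + \<eta> u v)) (at u)"
    and small: "\<And>e. e > 0 \<Longrightarrow> \<exists>\<delta>>0. \<forall>u v. norm u < \<delta> \<longrightarrow> \<bar>\<eta> u v\<bar> \<le> e * norm u * norm v"
  shows "\<kappa> = 0"
proof -
  have "\<bar>\<kappa>\<bar> \<le> e" if e: "e > 0" for e
  proof -
    obtain \<delta> where \<delta>: "\<delta> > 0" "\<And>u v. norm u < \<delta> \<Longrightarrow> \<bar>\<eta> u v\<bar> \<le> e / 8 * norm u * norm v"
      using small[of "e / 8"] e by auto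
    define s where "s = \<delta> / 3"
    have s: "s > 0" "2 * s < \<delta>" using \<delta>(1) by (auto simp: s_def)
    have bnd: "\<bar>\<eta> (x, y) v\<bar> \<le> e / 4 * s * s" if xy: "0 \<le> x" "x \<le> s" "0 \<le> y" "y \<le> s" and v: "norm v \<le> s" for x y v
    proof -
      have n: "norm (x, y) \<le> 2 * s" using norm_Pair_le[of x y] xy by simp
      then have "\<bar>\<eta> (x, y) v\<bar> \<le> e / 8 * norm (x, y) * norm v" using \<delta>(2) s by auto
      also have "\<dots> \<le> e / 8 * (2 * s) * s" using n v e s by (intro mult_mono) auto
      finally show ?thesis by (simp add: algebra_simps)
    qed
    have d1: "((\<lambda>t. \<Phi> (t, y)) has_derivative (\<lambda>h. \<kappa> * y * h + \<eta> (t, y) (h, 0))) (at t within X)" for t y X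
    proof -
      have "((\<lambda>t. (t, y)) has_derivative (\<lambda>h. (h, 0))) (at t within X)"
        by (intro has_derivative_Pair has_derivative_ident has_derivative_const)
      from has_derivative_compose[OF this der] show ?thesis by simp
    qed
    have d2: "((\<lambda>t. \<Phi> (x, t)) has_derivative (\<lambda>h. \<eta> (x, t) (0, h))) (at t within X)" for t x X
    proof -
      have "((\<lambda>t. (x, t)) has_derivative (\<lambda>h. (0, h))) (at t within X)"
        by (intro has_derivative_Pair has_derivative_ident has_derivative_const)
      from has_derivative_compose[OF this der] show ?thesis by simp
    qed
    have "\<exists>x\<in>{0<..<s}. (\<Phi> (s, s) - \<Phi> (s, 0)) - (\<Phi> (0, s) - \<Phi> (0, 0)) =
        (\<kappa> * s * (s - 0) + \<eta> (x, s) (s - 0, 0)) - (\<kappa> * 0 * (s - 0) + \<eta> (x, 0) (s - 0, 0))"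
      by (rule mvt_simple[OF s(1), of "\<lambda>t. \<Phi> (t, s) - \<Phi> (t, 0)"]) (intro has_derivative_diff d1)
    then obtain x where x: "0 < x" "x < s" "\<Phi> (s, s) - \<Phi> (s, 0) - (\<Phi> (0, s) - \<Phi> (0, 0)) = \<kappa> * s * s + \<eta> (x, s) (s, 0) - \<eta> (x, 0) (s, 0)"
      by auto
    have "\<exists>y\<in>{0<..<s}. (\<Phi> (s, s) - \<Phi> (0, s)) - (\<Phi> (s, 0) - \<Phi> (0, 0)) = \<eta> (s, y) (0, s - 0) - \<eta> (0, y) (0, s - 0)"
      by (rule mvt_simple[OF s(1), of "\<lambda>t. \<Phi> (s, t) - \<Phi> (0, t)"]) (intro has_derivative_diff d2)
    then obtain y where y: "0 < y" "y < s" "\<Phi> (s, s) - \<Phi> (0, s) - (\<Phi> (s, 0) - \<Phi> (0, 0)) = \<eta> (s, y) (0, s) - \<eta> (0, y) (0, s)"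
      by auto
    have "\<bar>\<eta> (x, s) (s, 0)\<bar> \<le> e / 4 * s * s" "\<bar>\<eta> (x, 0) (s, 0)\<bar> \<le> e / 4 * s * s"
      "\<bar>\<eta> (s, y) (0, s)\<bar> \<le> e / 4 * s * s" "\<bar>\<eta> (0, y) (0, s)\<bar> \<le> e / 4 * s * s"
      using bnd[of x s "(s, 0)"] bnd[of x 0 "(s, 0)"] bnd[of s y "(0, s)"] bnd[of 0 y "(0, s)"] x(1,2) y(1,2) s
      by simp_all
    then have "\<bar>\<kappa> * s * s\<bar> \<le> e * s * s" using x(3) y(3) by linarith
    then have "\<bar>\<kappa>\<bar> * (s * s) \<le> e * (s * s)" by (simp add: abs_mult mult.assoc)
    then show ?thesis using s by simp
  qed
  then have "\<bar>\<kappa>\<bar> \<le> 0" by (rule field_le_epsilon) auto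
  then show ?thesis by simp
qed

lemma pair_linear: "linear l \<Longrightarrow> l v = fst v *\<^sub>R l (1, 0) + snd v *\<^sub>R l (0, 1)" for v :: "real \<times> real"
proof -
  assume l: "linear l"
  have "v = fst v *\<^sub>R (1, 0) + snd v *\<^sub>R (0, 1)" by (simp add: prod_eq_iff)
  then have "l v = l (fst v *\<^sub>R (1, 0) + snd v *\<^sub>R (0, 1))" by simp
  then show ?thesis using l by (simp only: linear_add linear_cmul)
qed

lemma abs_component_le_norm: "\<bar>fst w\<bar> \<le> norm w" "\<bar>snd w\<bar> \<le> norm w" for w :: "real \<times> real"
  using norm_fst_le[of "fst w" "snd w"] norm_snd_le[of "snd w" "fst w"] by simp_all

text \<open>
  Near \<open>x\<close> replace \<open>F\<close> by its first order expansion. Up to differentials of explicit functions and an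
  error \<open>o(\<bar>u\<bar>)\<close>, the form \<open>F\<^sub>2 dF\<^sub>1 - r d\<theta>\<close> becomes \<open>(det - 1) u\<^sub>2 du\<^sub>1\<close>, where \<open>u\<close> is the displacement
  from \<open>x\<close>.
\<close>

lemma exact_imp_det_1:
  fixes F :: "real \<times> real \<Rightarrow> real \<times> real" and F' :: "real \<times> real \<Rightarrow> (real \<times> real) \<Rightarrow>\<^sub>L (real \<times> real)"
  assumes F': "\<And>x. (F has_derivative blinfun_apply (F' x)) (at x)" and cont: "continuous_on UNIV F'"
    and T: "\<And>x. (T has_derivative (\<lambda>v. snd (F x) * fst (F' x v) - snd x * fst v)) (at x)"
  shows "fst (F' x (1, 0)) * snd (F' x (0, 1)) - fst (F' x (0, 1)) * snd (F' x (1, 0)) = 1"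
proof -
  define l where "l = F' x"
  define a b c d where "a = fst (l (1, 0))" and "b = fst (l (0, 1))" and "c = snd (l (1, 0))" and "d = snd (l (0, 1))"
  have lv: "fst (l v) = a * fst v + b * snd v" "snd (l v) = c * fst v + d * snd v" for v
    using pair_linear[OF bounded_linear.linear[OF blinfun.bounded_linear_right[of l]], of v]
    by (simp_all add: a_def b_def c_def d_def mult.commute)
  define \<kappa> where "\<kappa> = a * d - b * c - 1"
  define \<Phi> where "\<Phi> u = T (x + u) - snd (F x) * fst (F (x + u)) + snd x * fst (x + u)
     - (a * c / 2 * (fst u)\<^sup>2 + b * d / 2 * (snd u)\<^sup>2 + b * c * fst u * snd u)" for u
  define E where "E u = snd (F (x + u)) - snd (F x) - snd (l u)" for u
  define \<eta> where "\<eta> u v = E u * fst (F' (x + u) v) + snd (l u) * fst ((F' (x + u) - l) v)" for u v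
  have shift: "((\<lambda>u. G (x + u)) has_derivative G') (at u)" if "(G has_derivative G') (at (x + u))"
    for G :: "real \<times> real \<Rightarrow> 'c::real_normed_vector" and G' u
  proof -
    have "((\<lambda>u. x + u) has_derivative (\<lambda>v. v)) (at u)" by (auto intro!: derivative_eq_intros)
    from has_derivative_compose[OF this that] show ?thesis .
  qed
  have "\<kappa> = 0"
  proof (rule exact_area_defect_zero[where \<Phi> = \<Phi> and \<eta> = \<eta>])
    fix u
    have "(\<Phi> has_derivative (\<lambda>v. (snd (F (x + u)) * fst (F' (x + u) v) - snd (x + u) * fst v)
        - snd (F x) * fst (F' (x + u) v) + snd x * fst v
        - (a * c * fst u * fst v + b * d * snd u * snd v + b * c * (fst v * snd u + fst u * snd v)))) (at u)"
    proof -
      note h1 = shift[OF T, of u]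
      note h2 = has_derivative_mult_right[OF has_derivative_fst[OF shift[OF F', of u]], of "snd (F x)"]
      have h3: "((\<lambda>u. snd x * fst (x + u)) has_derivative (\<lambda>v. snd x * fst v)) (at u)"
        by (auto intro!: derivative_eq_intros)
      have h4: "((\<lambda>u. a * c / 2 * (fst u)\<^sup>2 + b * d / 2 * (snd u)\<^sup>2 + b * c * fst u * snd u) has_derivative
         (\<lambda>v. a * c * fst u * fst v + b * d * snd u * snd v + b * c * (fst v * snd u + fst u * snd v))) (at u)"
        by (auto intro!: derivative_eq_intros simp: algebra_simps)
      show ?thesis
        unfolding \<Phi>_def[abs_def]
        by (rule has_derivative_diff[OF has_derivative_add[OF has_derivative_diff[OF h1 h2] h3] h4])
    qed
    moreover have "(snd (F (x + u)) * fst (F' (x + u) v) - snd (x + u) * fst v)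
        - snd (F x) * fst (F' (x + u) v) + snd x * fst v
        - (a * c * fst u * fst v + b * d * snd u * snd v + b * c * (fst v * snd u + fst u * snd v))
        = \<kappa> * snd u * fst v + \<eta> u v" for v
      by (simp add: \<eta>_def E_def \<kappa>_def lv blinfun.diff_left algebra_simps)
    ultimately show "(\<Phi> has_derivative (\<lambda>v. \<kappa> * snd u * fst v + \<eta> u v)) (at u)" by simp
  next
    fix e :: real assume e: "e > 0"
    define N where "N = 2 * norm l + 1"
    have N: "N > 0" by (simp add: N_def add_nonneg_pos)
    define e' where "e' = min 1 (e / N)"
    have e': "e' > 0" "e' \<le> 1" "e' * N \<le> e" using e N by (auto simp: e'_def min_def field_simps)
    obtain \<delta>1 where \<delta>1: "\<delta>1 > 0" "\<And>y. norm (y - x) < \<delta>1 \<Longrightarrow> norm (F y - F x - l (y - x)) \<le> e' * norm (y - x)"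
      using F'[of x] e'(1) unfolding l_def has_derivative_at_alt by blast
    obtain \<delta>2 where \<delta>2: "\<delta>2 > 0" "\<And>y. dist y x < \<delta>2 \<Longrightarrow> dist (F' y) (F' x) < e'"
      using cont e'(1) unfolding continuous_on_iff by (metis UNIV_I)
    show "\<exists>\<delta>>0. \<forall>u v. norm u < \<delta> \<longrightarrow> \<bar>\<eta> u v\<bar> \<le> e * norm u * norm v"
    proof (intro exI[of _ "min \<delta>1 \<delta>2"] conjI allI impI)
      fix u v :: "real \<times> real" assume u: "norm u < min \<delta>1 \<delta>2"
      have E: "\<bar>E u\<bar> \<le> e' * norm u"
      proof -
        have "E u = snd (F (x + u) - F x - l u)" by (simp add: E_def)
        then have "\<bar>E u\<bar> \<le> norm (F (x + u) - F x - l u)" by (simp only: abs_component_le_norm)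
        also have "\<dots> \<le> e' * norm u" using \<delta>1(2)[of "x + u"] u by simp
        finally show ?thesis .
      qed
      have near: "norm (F' (x + u) - l) \<le> e'"
        using \<delta>2(2)[of "x + u"] u by (simp add: dist_norm l_def)
      note fl = abs_component_le_norm
      have A: "\<bar>fst (F' (x + u) v)\<bar> \<le> (norm l + 1) * norm v"
      proof -
        have "\<bar>fst (F' (x + u) v)\<bar> \<le> norm (F' (x + u) v)" by (rule fl)
        also have "\<dots> \<le> norm (F' (x + u)) * norm v" by (rule norm_blinfun)
        also have "norm (F' (x + u)) \<le> norm l + 1"
          using near e'(2) norm_triangle_sub[of "F' (x + u)" l] by linarith
        finally show ?thesis by (simp add: mult_right_mono)
      qed
      have Bd: "\<bar>snd (l u)\<bar> \<le> norm l * norm u" using fl(2)[of "l u"] norm_blinfun[of l u] by linarith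
      have Cd: "\<bar>fst ((F' (x + u) - l) v)\<bar> \<le> e' * norm v"
        using fl(1)[of "(F' (x + u) - l) v"] norm_blinfun[of "F' (x + u) - l" v] mult_right_mono[OF near, of "norm v"] by simp
      have "\<bar>\<eta> u v\<bar> \<le> \<bar>E u\<bar> * \<bar>fst (F' (x + u) v)\<bar> + \<bar>snd (l u)\<bar> * \<bar>fst ((F' (x + u) - l) v)\<bar>"
        unfolding \<eta>_def abs_mult[symmetric] by (rule abs_triangle_ineq)
      also have "\<dots> \<le> (e' * norm u) * ((norm l + 1) * norm v) + (norm l * norm u) * (e' * norm v)"
        using E A Bd Cd e' by (intro add_mono mult_mono) auto
      also have "\<dots> = (e' * N) * (norm u * norm v)" by (simp add: N_def algebra_simps)
      also have "\<dots> \<le> e * (norm u * norm v)" using e'(3) by (intro mult_right_mono) auto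
      finally show "\<bar>\<eta> u v\<bar> \<le> e * norm u * norm v" by (simp add: mult.assoc)
    qed (use \<delta>1 \<delta>2 in auto)
  qed
  then show ?thesis by (simp add: \<kappa>_def a_def b_def c_def d_def l_def)
qed

lemma iterate_int_shift:
  fixes h :: "real \<Rightarrow> real"
  assumes shift: "\<And>t. h (t + 1) = h t + 1"
  shows "(h ^^ n) (t + of_int k) = (h ^^ n) t + of_int k"
proof -
  have "h (t + of_int k) = h t + of_int k" for t
  proof (induction k arbitrary: t rule: int_induct[where k = 0])
    case (step1 i)
    have "h (t + of_int (i + 1)) = h (t + of_int i + 1)" by (simp add: add.assoc)
    then show ?case using step1 by (simp add: shift)
  next
    case (step2 i)
    have "h (t + of_int (i - 1)) + 1 = h (t + of_int i)"
      using shift[of "t + of_int (i - 1)"] by simp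
    then show ?case using step2 by simp
  qed simp
  then show ?thesis by (induction n) auto
qed

section \<open>Paratingent slopes of an invariant Lipschitz graph\<close>

text \<open>
  The lift of an Aubry-Mather set as a dynamical system on the line. The last two assumptions say
  that the map \<open>(u, g u) \<mapsto> (h u, g (h u))\<close> is strictly differentiable along the graph, with the rows
  \<open>a, b\<close> and \<open>c, d\<close> of the derivative: pairs of points have to be compared, not only points with the
  base point, because the paratingent cone is made of limits of secants.
\<close>

locale invariant_graph =
  fixes K :: "real set" and h g a b c d :: "real \<Rightarrow> real" and L C b0 B :: real
  assumes closed_K: "closed K"
    and K_nonempty: "K \<noteq> {}"
    and K_shift: "t + 1 \<in> K \<longleftrightarrow> t \<in> K"
    and K_islimpt: "t \<in> K \<Longrightarrow> t islimpt K"
    and h_mono: "strict_mono h"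
    and h_bij: "bij h"
    and h_shift: "h (t + 1) = h t + 1"
    and h_K: "h t \<in> K \<longleftrightarrow> t \<in> K"
    and h_upper: "u \<le> v \<Longrightarrow> h v - h u \<le> L * (v - u)"
    and h_lower: "u \<le> v \<Longrightarrow> v - u \<le> L * (h v - h u)"
    and g_shift: "t \<in> K \<Longrightarrow> g (t + 1) = g t"
    and g_lipschitz: "u \<in> K \<Longrightarrow> v \<in> K \<Longrightarrow> \<bar>g u - g v\<bar> \<le> C * \<bar>u - v\<bar>"
    and det: "t \<in> K \<Longrightarrow> a t * d t - b t * c t = 1"
    and b_bounds: "t \<in> K \<Longrightarrow> b0 \<le> b t" "t \<in> K \<Longrightarrow> b t \<le> B" "0 < b0"
    and h_linear: "t \<in> K \<Longrightarrow> e > 0 \<Longrightarrow> \<exists>\<delta>>0. \<forall>u\<in>K. \<forall>v\<in>K. \<bar>u - t\<bar> < \<delta> \<longrightarrow> \<bar>v - t\<bar> < \<delta> \<longrightarrow>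
        \<bar>h u - h v - (a t * (u - v) + b t * (g u - g v))\<bar> \<le> e * \<bar>u - v\<bar>"
    and g_linear: "t \<in> K \<Longrightarrow> e > 0 \<Longrightarrow> \<exists>\<delta>>0. \<forall>u\<in>K. \<forall>v\<in>K. \<bar>u - t\<bar> < \<delta> \<longrightarrow> \<bar>v - t\<bar> < \<delta> \<longrightarrow>
        \<bar>g (h u) - g (h v) - (c t * (u - v) + d t * (g u - g v))\<bar> \<le> e * \<bar>u - v\<bar>"
begin

text \<open>
  Secants of the graph near \<open>t\<close> are indexed by this filter, so the slopes of the paratingent cone are
  the cluster points of difference quotients along it.
\<close>

definition pairs :: "real \<Rightarrow> (real \<times> real) filter" where
  "pairs t = at (t, t) within {p. fst p \<in> K \<and> snd p \<in> K \<and> fst p \<noteq> snd p}"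

lemma eventually_pairs:
  "eventually P (pairs t) \<longleftrightarrow>
     (\<exists>\<delta>>0. \<forall>u\<in>K. \<forall>v\<in>K. u \<noteq> v \<and> \<bar>u - t\<bar> < \<delta> \<and> \<bar>v - t\<bar> < \<delta> \<longrightarrow> P (u, v))"
proof
  assume "eventually P (pairs t)"
  then obtain \<delta> where "\<delta> > 0" and ball:
    "\<forall>p\<in>{p. fst p \<in> K \<and> snd p \<in> K \<and> fst p \<noteq> snd p}. p \<noteq> (t, t) \<and> dist p (t, t) < \<delta> \<longrightarrow> P p"
    unfolding pairs_def eventually_at by blast
  have \<delta>: "\<delta> > 0"
    "\<And>p. fst p \<in> K \<Longrightarrow> snd p \<in> K \<Longrightarrow> fst p \<noteq> snd p \<Longrightarrow> dist p (t, t) < \<delta> \<Longrightarrow> P p"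
    using \<open>\<delta> > 0\<close> ball by fastforce+
  have "P (u, v)" if "u \<in> K" "v \<in> K" "u \<noteq> v" "\<bar>u - t\<bar> < \<delta> / 2" "\<bar>v - t\<bar> < \<delta> / 2" for u v
  proof (rule \<delta>(2))
    have "dist (u, v) (t, t) \<le> \<bar>u - t\<bar> + \<bar>v - t\<bar>"
      unfolding dist_Pair_Pair dist_real_def by (rule real_le_lsqrt) (auto simp: power2_sum)
    then show "dist (u, v) (t, t) < \<delta>" using that by linarith
  qed (use that in auto)
  then show "\<exists>\<delta>>0. \<forall>u\<in>K. \<forall>v\<in>K. u \<noteq> v \<and> \<bar>u - t\<bar> < \<delta> \<and> \<bar>v - t\<bar> < \<delta> \<longrightarrow> P (u, v)"
    using \<delta>(1) by (intro exI[of _ "\<delta> / 2"]) auto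
next
  assume "\<exists>\<delta>>0. \<forall>u\<in>K. \<forall>v\<in>K. u \<noteq> v \<and> \<bar>u - t\<bar> < \<delta> \<and> \<bar>v - t\<bar> < \<delta> \<longrightarrow> P (u, v)"
  then obtain \<delta> where \<delta>: "\<delta> > 0"
    "\<And>u v. u \<in> K \<Longrightarrow> v \<in> K \<Longrightarrow> u \<noteq> v \<Longrightarrow> \<bar>u - t\<bar> < \<delta> \<Longrightarrow> \<bar>v - t\<bar> < \<delta> \<Longrightarrow> P (u, v)" by blast
  show "eventually P (pairs t)"
    unfolding pairs_def eventually_at
  proof (intro exI[of _ \<delta>] conjI ballI impI)
    fix p assume p: "p \<in> {p. fst p \<in> K \<and> snd p \<in> K \<and> fst p \<noteq> snd p}" "p \<noteq> (t, t) \<and> dist p (t, t) < \<delta>"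
    have "\<bar>fst p - t\<bar> < \<delta>" "\<bar>snd p - t\<bar> < \<delta>"
      using p dist_fst_le[of p "(t,t)"] dist_snd_le[of p "(t,t)"] by (auto simp: dist_real_def)
    then have "P (fst p, snd p)" using p by (intro \<delta>(2)) auto
    then show "P p" by simp
  qed (fact \<delta>(1))
qed

lemma pairs_neq_bot:
  assumes "t \<in> K" shows "pairs t \<noteq> bot"
proof
  assume "pairs t = bot"
  then have "eventually (\<lambda>_. False) (pairs t)" by simp
  then obtain \<delta> where \<delta>: "\<delta> > 0" "\<And>u v. u \<in> K \<Longrightarrow> v \<in> K \<Longrightarrow> u \<noteq> v \<Longrightarrow> \<bar>u - t\<bar> < \<delta> \<Longrightarrow> \<bar>v - t\<bar> < \<delta> \<Longrightarrow> False"
    unfolding eventually_pairs by blast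
  obtain u where "u \<in> K" "u \<noteq> t" "dist u t < \<delta>"
    using K_islimpt[OF assms] \<delta>(1) unfolding islimpt_approachable by blast
  then show False using \<delta>(2)[of u t] assms \<delta>(1) by (auto simp: dist_real_def)
qed

lemma frequently_eventually_ex:
  assumes "frequently P F" "eventually Q F" shows "\<exists>x. P x \<and> Q x"
  using frequently_ex[OF frequently_eventually_conj[OF assms]] by blast

lemma eventually_imp_frequently_pairs:
  assumes "t \<in> K" "eventually P (pairs t)" shows "frequently P (pairs t)"
  using assms pairs_neq_bot eventually_frequently by blast

lemma inv_h: "h (inv h t) = t" "inv h (h t) = t"
  using h_bij by (auto simp: bij_def surj_f_inv_f)

lemma L_pos: "0 < L"
  using h_lower[of 0 1] h_shift[of 0] by simp

lemma L_ge_1: "1 \<le> L"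
  using h_lower[of 0 1] h_shift[of 0] by simp

lemma h_le: "u \<le> v \<Longrightarrow> h u \<le> h v"
  using h_mono by (simp add: strict_mono_less_eq)

lemma h_upper_abs: "\<bar>h u - h v\<bar> \<le> L * \<bar>u - v\<bar>"
proof (cases "u \<le> v")
  case True
  then show ?thesis using h_upper[OF True] h_le[OF True] by simp
next
  case False
  then have "v \<le> u" by simp
  then show ?thesis using h_upper[of v u] h_le[of v u] by simp
qed

lemma h_lower_abs: "\<bar>u - v\<bar> \<le> L * \<bar>h u - h v\<bar>"
proof (cases "u \<le> v")
  case True
  then show ?thesis using h_lower[OF True] h_le[OF True] by simp
next
  case False
  then have "v \<le> u" by simp
  then show ?thesis using h_lower[of v u] h_le[of v u] by simp
qed

lemma eventually_pairs_h:
  "eventually P (pairs (h t)) \<longleftrightarrow> eventually (\<lambda>p. P (map_prod h h p)) (pairs t)"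
proof
  assume "eventually P (pairs (h t))"
  then obtain \<delta> where \<delta>: "\<delta> > 0"
    "\<And>u v. u \<in> K \<Longrightarrow> v \<in> K \<Longrightarrow> u \<noteq> v \<Longrightarrow> \<bar>u - h t\<bar> < \<delta> \<Longrightarrow> \<bar>v - h t\<bar> < \<delta> \<Longrightarrow> P (u, v)"
    unfolding eventually_pairs by blast
  show "eventually (\<lambda>p. P (map_prod h h p)) (pairs t)"
    unfolding eventually_pairs
  proof (intro exI[of _ "\<delta> / L"] conjI ballI impI)
    fix u v assume uv: "u \<in> K" "v \<in> K" "u \<noteq> v \<and> \<bar>u - t\<bar> < \<delta> / L \<and> \<bar>v - t\<bar> < \<delta> / L"
    have "\<bar>h u - h t\<bar> < \<delta>" "\<bar>h v - h t\<bar> < \<delta>"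
      using h_upper_abs[of u t] h_upper_abs[of v t] uv L_pos by (auto simp: field_simps)
    then show "P (map_prod h h (u, v))"
      using uv \<delta>(2)[of "h u" "h v"] h_K h_mono by (auto simp: strict_mono_eq)
  qed (use \<delta> L_pos in auto)
next
  assume "eventually (\<lambda>p. P (map_prod h h p)) (pairs t)"
  then obtain \<delta> where \<delta>: "\<delta> > 0"
    "\<And>u v. u \<in> K \<Longrightarrow> v \<in> K \<Longrightarrow> u \<noteq> v \<Longrightarrow> \<bar>u - t\<bar> < \<delta> \<Longrightarrow> \<bar>v - t\<bar> < \<delta> \<Longrightarrow> P (h u, h v)"
    unfolding eventually_pairs by auto
  show "eventually P (pairs (h t))"
    unfolding eventually_pairs
  proof (intro exI[of _ "\<delta> / L"] conjI ballI impI)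
    fix u v assume uv: "u \<in> K" "v \<in> K" "u \<noteq> v \<and> \<bar>u - h t\<bar> < \<delta> / L \<and> \<bar>v - h t\<bar> < \<delta> / L"
    have "\<bar>inv h u - t\<bar> < \<delta>" "\<bar>inv h v - t\<bar> < \<delta>"
      using h_lower_abs[of "inv h u" t] h_lower_abs[of "inv h v" t] uv L_pos by (auto simp: field_simps inv_h)
    moreover have "inv h u \<in> K" "inv h v \<in> K" "inv h u \<noteq> inv h v"
      using uv h_K[of "inv h u"] h_K[of "inv h v"] inv_h by metis+
    ultimately show "P (u, v)"
      using \<delta>(2)[of "inv h u" "inv h v"] by (simp add: inv_h)
  qed (use \<delta> L_pos in auto)
qed

lemma eventually_pairs_shift:
  "eventually P (pairs (t + 1)) \<longleftrightarrow> eventually (\<lambda>p. P (fst p + 1, snd p + 1)) (pairs t)"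
  (is "?l \<longleftrightarrow> ?r")
proof
  assume ?l
  then obtain \<delta> where \<delta>: "\<delta> > 0"
    "\<And>u v. u \<in> K \<Longrightarrow> v \<in> K \<Longrightarrow> u \<noteq> v \<Longrightarrow> \<bar>u - (t + 1)\<bar> < \<delta> \<Longrightarrow> \<bar>v - (t + 1)\<bar> < \<delta> \<Longrightarrow> P (u, v)"
    unfolding eventually_pairs by blast
  show ?r unfolding eventually_pairs
    by (intro exI[of _ \<delta>] conjI \<delta>(1) ballI impI) (auto intro!: \<delta>(2) simp: K_shift)
next
  assume ?r
  then obtain \<delta> where \<delta>: "\<delta> > 0"
    "\<And>u v. u \<in> K \<Longrightarrow> v \<in> K \<Longrightarrow> u \<noteq> v \<Longrightarrow> \<bar>u - t\<bar> < \<delta> \<Longrightarrow> \<bar>v - t\<bar> < \<delta> \<Longrightarrow> P (u + 1, v + 1)"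
    unfolding eventually_pairs by auto
  show ?l unfolding eventually_pairs
  proof (intro exI[of _ \<delta>] conjI \<delta>(1) ballI impI)
    fix u v assume "u \<in> K" "v \<in> K" "u \<noteq> v \<and> \<bar>u - (t + 1)\<bar> < \<delta> \<and> \<bar>v - (t + 1)\<bar> < \<delta>"
    then show "P (u, v)" using \<delta>(2)[of "u - 1" "v - 1"] K_shift[of "u - 1"] K_shift[of "v - 1"]
      by (auto simp: algebra_simps)
  qed
qed

lemma frequently_pairs_h:
  "frequently P (pairs (h t)) \<longleftrightarrow> frequently (\<lambda>p. P (map_prod h h p)) (pairs t)"
  unfolding frequently_def eventually_pairs_h by simp

text \<open>
  The upper limit of \<open>q\<close> along \<open>pairs t\<close> for \<open>\<sigma> = 1\<close>, the lower limit for \<open>\<sigma> = - 1\<close>. The sign lets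
  one proof treat both ends of the paratingent cone.
\<close>

definition extreme_limit :: "real \<Rightarrow> (real \<times> real \<Rightarrow> real) \<Rightarrow> real \<Rightarrow> real" where
  "extreme_limit \<sigma> q t = \<sigma> * Inf {x. eventually (\<lambda>p. \<sigma> * q p \<le> x) (pairs t)}"

definition bounded_on_pairs :: "(real \<times> real \<Rightarrow> real) \<Rightarrow> bool" where
  "bounded_on_pairs q \<longleftrightarrow> (\<exists>D. \<forall>u\<in>K. \<forall>v\<in>K. \<bar>q (u, v)\<bar> \<le> D)"

lemma bounded_on_pairsD: assumes "bounded_on_pairs q"
  obtains D where "D > 0" "\<And>t. eventually (\<lambda>p. \<bar>q p\<bar> \<le> D) (pairs t)"
proof -
  obtain D where D: "\<forall>u\<in>K. \<forall>v\<in>K. \<bar>q (u, v)\<bar> \<le> D" using assms unfolding bounded_on_pairs_def by blast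
  show thesis
  proof
    show "max D 1 > 0" by simp
    show "eventually (\<lambda>p. \<bar>q p\<bar> \<le> max D 1) (pairs t)" for t
      unfolding eventually_pairs using D by (intro exI[of _ 1]) (auto simp: max_def intro: order_trans)
  qed
qed

lemma extreme_limit_set:
  assumes "t \<in> K" "bounded_on_pairs q" and \<sigma>: "\<sigma> = 1 \<or> \<sigma> = - 1"
  shows "{x. eventually (\<lambda>p. \<sigma> * q p \<le> x) (pairs t)} \<noteq> {}" (is "?S \<noteq> _")
    and "bdd_below {x. eventually (\<lambda>p. \<sigma> * q p \<le> x) (pairs t)}"
proof -
  obtain D where D: "\<And>t. eventually (\<lambda>p. \<bar>q p\<bar> \<le> D) (pairs t)" using bounded_on_pairsD assms(2) by metis
  have ev: "eventually (\<lambda>p. \<sigma> * q p \<le> D \<and> - D \<le> \<sigma> * q p) (pairs t)"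
    using D[of t] by eventually_elim (use \<sigma> in auto)
  then have "D \<in> ?S" by (auto elim: eventually_mono)
  then show "?S \<noteq> {}" by blast
  show "bdd_below ?S"
  proof (rule bdd_belowI)
    fix x assume "x \<in> ?S"
    then have "eventually (\<lambda>p. - D \<le> x) (pairs t)"
      using ev unfolding mem_Collect_eq by eventually_elim auto
    then show "- D \<le> x" using pairs_neq_bot[OF assms(1)] by (simp add: eventually_const)
  qed
qed

lemma extreme_limit_eventually:
  assumes "t \<in> K" "bounded_on_pairs q" and \<sigma>: "\<sigma> = 1 \<or> \<sigma> = - 1" and "e > 0"
  shows "eventually (\<lambda>p. \<sigma> * q p < \<sigma> * extreme_limit \<sigma> q t + e) (pairs t)"
proof -
  let ?S = "{x. eventually (\<lambda>p. \<sigma> * q p \<le> x) (pairs t)}"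
  have "Inf ?S < Inf ?S + e" using assms(4) by simp
  then obtain x where "x \<in> ?S" "x < Inf ?S + e"
    using cInf_lessD[OF extreme_limit_set(1)[OF assms(1-3)]] by blast
  moreover have "\<sigma> * extreme_limit \<sigma> q t = Inf ?S" using \<sigma> by (auto simp: extreme_limit_def)
  ultimately show ?thesis by (auto elim!: eventually_mono)
qed

lemma extreme_limit_frequently_ge:
  assumes "t \<in> K" "bounded_on_pairs q" and \<sigma>: "\<sigma> = 1 \<or> \<sigma> = - 1" and "e > 0"
  shows "frequently (\<lambda>p. \<sigma> * extreme_limit \<sigma> q t - e < \<sigma> * q p) (pairs t)"
proof (rule ccontr)
  let ?S = "{x. eventually (\<lambda>p. \<sigma> * q p \<le> x) (pairs t)}"
  assume "\<not> ?thesis"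
  then have "\<sigma> * extreme_limit \<sigma> q t - e \<in> ?S" by (simp add: not_frequently not_less)
  then have "Inf ?S \<le> \<sigma> * extreme_limit \<sigma> q t - e" by (rule cInf_lower[OF _ extreme_limit_set(2)[OF assms(1-3)]])
  moreover have "\<sigma> * extreme_limit \<sigma> q t = Inf ?S" using \<sigma> by (auto simp: extreme_limit_def)
  ultimately show False using assms by simp
qed

lemma extreme_limit_frequently:
  assumes "t \<in> K" "bounded_on_pairs q" and \<sigma>: "\<sigma> = 1 \<or> \<sigma> = - 1" and "e > 0"
  shows "frequently (\<lambda>p. \<bar>q p - extreme_limit \<sigma> q t\<bar> < e) (pairs t)"
  by (rule frequently_mono[OF _ frequently_eventually_conj[OF extreme_limit_frequently_ge extreme_limit_eventually, OF assms assms]])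
     (use \<sigma> in auto)

lemma extreme_limit_le:
  assumes "t \<in> K" "bounded_on_pairs q" and \<sigma>: "\<sigma> = 1 \<or> \<sigma> = - 1" and "eventually (\<lambda>p. \<sigma> * q p \<le> x) (pairs t)"
  shows "\<sigma> * extreme_limit \<sigma> q t \<le> x"
proof -
  let ?S = "{x. eventually (\<lambda>p. \<sigma> * q p \<le> x) (pairs t)}"
  have "\<sigma> * extreme_limit \<sigma> q t = Inf ?S" using \<sigma> by (auto simp: extreme_limit_def)
  then show ?thesis using cInf_lower[OF _ extreme_limit_set(2)[OF assms(1-3)], of x] assms(4) by simp
qed

lemma extreme_limit_ge:
  assumes "t \<in> K" "bounded_on_pairs q" and \<sigma>: "\<sigma> = 1 \<or> \<sigma> = - 1" and "frequently (\<lambda>p. x \<le> \<sigma> * q p) (pairs t)"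
  shows "x \<le> \<sigma> * extreme_limit \<sigma> q t"
proof (rule field_le_epsilon)
  fix e :: real assume "e > 0"
  from frequently_eventually_ex[OF assms(4) extreme_limit_eventually[OF assms(1-3) this]]
  show "x \<le> \<sigma> * extreme_limit \<sigma> q t + e" by auto
qed

lemma extreme_limit_eqI:
  assumes "t \<in> K" "bounded_on_pairs q" and \<sigma>: "\<sigma> = 1 \<or> \<sigma> = - 1"
    and "\<And>e. e > 0 \<Longrightarrow> eventually (\<lambda>p. \<sigma> * q p \<le> \<sigma> * x + e) (pairs t)"
    and "\<And>e. e > 0 \<Longrightarrow> frequently (\<lambda>p. \<sigma> * x - e \<le> \<sigma> * q p) (pairs t)"
  shows "extreme_limit \<sigma> q t = x"
proof -
  have "\<sigma> * extreme_limit \<sigma> q t \<le> \<sigma> * x" by (rule field_le_epsilon) (intro extreme_limit_le assms)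
  moreover have "\<sigma> * x \<le> \<sigma> * extreme_limit \<sigma> q t"
  proof (rule field_le_epsilon)
    fix e :: real assume "e > 0"
    from extreme_limit_ge[OF assms(1-3) assms(5)[OF this]] show "\<sigma> * x \<le> \<sigma> * extreme_limit \<sigma> q t + e" by simp
  qed
  ultimately show ?thesis using \<sigma> by auto
qed

lemma lower_limit_le_upper_limit:
  assumes "t \<in> K" "bounded_on_pairs q"
  shows "extreme_limit (-1) q t \<le> extreme_limit 1 q t"
proof (rule field_le_epsilon)
  fix e :: real assume e: "e > 0"
  have "frequently (\<lambda>p. extreme_limit (-1) q t - e / 2 \<le> q p) (pairs t)"
    using extreme_limit_eventually[OF assms, of "-1" "e/2"] e
    by (intro eventually_imp_frequently_pairs assms) (auto elim!: eventually_mono)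
  with extreme_limit_ge[OF assms, of 1 "extreme_limit (-1) q t - e / 2"] show "extreme_limit (-1) q t \<le> extreme_limit 1 q t + e"
    using e by simp
qed

lemma extreme_limit_affine:
  assumes "t \<in> K" "bounded_on_pairs q" "bounded_on_pairs q'" and \<sigma>: "\<sigma> = 1 \<or> \<sigma> = - 1" and "\<beta> > 0"
    and lim: "((\<lambda>p. q' p - (\<alpha> + \<beta> * q p)) \<longlongrightarrow> 0) (pairs t)"
  shows "extreme_limit \<sigma> q' t = \<alpha> + \<beta> * extreme_limit \<sigma> q t"
proof (rule extreme_limit_eqI)
  fix e :: real assume e: "e > 0"
  have small: "eventually (\<lambda>p. \<bar>q' p - (\<alpha> + \<beta> * q p)\<bar> < e / 2) (pairs t)"
    using tendstoD[OF lim, of "e / 2"] e by (simp add: dist_real_def)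
  have e': "e / (2 * \<beta>) > 0" using e assms by simp
  show "eventually (\<lambda>p. \<sigma> * q' p \<le> \<sigma> * (\<alpha> + \<beta> * extreme_limit \<sigma> q t) + e) (pairs t)"
    using small extreme_limit_eventually[OF assms(1,2) \<sigma> e']
  proof eventually_elim
    case (elim p)
    have "\<beta> * (\<sigma> * q p) < \<beta> * (\<sigma> * extreme_limit \<sigma> q t + e / (2 * \<beta>))"
      using elim(2) \<open>\<beta> > 0\<close> by simp
    moreover have "\<beta> * (\<sigma> * extreme_limit \<sigma> q t + e / (2 * \<beta>)) = \<beta> * (\<sigma> * extreme_limit \<sigma> q t) + e / 2"
      using \<open>\<beta> > 0\<close> by (simp add: distrib_left)
    ultimately have "\<beta> * (\<sigma> * q p) < \<beta> * (\<sigma> * extreme_limit \<sigma> q t) + e / 2" by simp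
    moreover have "q' p < \<alpha> + \<beta> * q p + e / 2" "\<alpha> + \<beta> * q p - e / 2 < q' p"
      using elim(1) by linarith+
    ultimately show ?case using \<sigma> by (auto simp: algebra_simps)
  qed
  have "frequently (\<lambda>p. \<sigma> * extreme_limit \<sigma> q t - e / (2 * \<beta>) < \<sigma> * q p \<and> \<bar>q' p - (\<alpha> + \<beta> * q p)\<bar> < e / 2) (pairs t)"
    using frequently_eventually_conj[OF extreme_limit_frequently_ge[OF assms(1,2) \<sigma> e'] small] by (simp add: conj_commute)
  then show "frequently (\<lambda>p. \<sigma> * (\<alpha> + \<beta> * extreme_limit \<sigma> q t) - e \<le> \<sigma> * q' p) (pairs t)"
  proof (rule frequently_mono[rotated], intro allI impI)
    fix p assume p: "\<sigma> * extreme_limit \<sigma> q t - e / (2 * \<beta>) < \<sigma> * q p \<and> \<bar>q' p - (\<alpha> + \<beta> * q p)\<bar> < e / 2"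
    have "\<beta> * (\<sigma> * extreme_limit \<sigma> q t - e / (2 * \<beta>)) < \<beta> * (\<sigma> * q p)"
      using p \<open>\<beta> > 0\<close> by simp
    moreover have "\<beta> * (\<sigma> * extreme_limit \<sigma> q t - e / (2 * \<beta>)) = \<beta> * (\<sigma> * extreme_limit \<sigma> q t) - e / 2"
      using \<open>\<beta> > 0\<close> by (simp add: right_diff_distrib)
    ultimately have p': "\<beta> * (\<sigma> * extreme_limit \<sigma> q t) - e / 2 < \<beta> * (\<sigma> * q p)"
      "q' p < \<alpha> + \<beta> * q p + e / 2" "\<alpha> + \<beta> * q p - e / 2 < q' p"
      using p by linarith+
    then show "\<sigma> * (\<alpha> + \<beta> * extreme_limit \<sigma> q t) - e \<le> \<sigma> * q' p" using p' \<sigma> by (auto simp: algebra_simps)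
  qed
qed (use assms in auto)

definition slope :: "(real \<Rightarrow> real) \<Rightarrow> real \<times> real \<Rightarrow> real" where
  "slope q p = (q (fst p) - q (snd p)) / (fst p - snd p)"

abbreviation S :: "real \<Rightarrow> real \<Rightarrow> real" where "S \<sigma> \<equiv> extreme_limit \<sigma> (slope g)"
abbreviation D :: "real \<Rightarrow> real \<Rightarrow> real" where "D \<sigma> \<equiv> extreme_limit \<sigma> (slope h)"

lemma C_nonneg: "0 \<le> C"
proof -
  obtain t where t: "t \<in> K" using K_nonempty by blast
  have "0 \<le> C * 1" using g_lipschitz[of "t + 1" t] t K_shift[of t] by auto
  then show ?thesis by simp
qed

lemma slope_g_bound: "u \<in> K \<Longrightarrow> v \<in> K \<Longrightarrow> \<bar>slope g (u, v)\<bar> \<le> C"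
  using g_lipschitz[of u v] C_nonneg by (cases "u = v") (auto simp: slope_def field_simps)

lemma slope_h_bounds: "u \<noteq> v \<Longrightarrow> 1 / L \<le> slope h (u, v)" "u \<noteq> v \<Longrightarrow> slope h (u, v) \<le> L"
proof -
  have *: "1 / L \<le> slope h (u, v) \<and> slope h (u, v) \<le> L" if "v < u" for u v
    using h_upper[of v u] h_lower[of v u] that L_pos by (auto simp: slope_def field_simps)
  have sym: "slope h (u, v) = slope h (v, u)" for u v
    unfolding slope_def fst_conv snd_conv by (metis minus_diff_eq minus_divide_divide)
  assume "u \<noteq> v"
  then show "1 / L \<le> slope h (u, v)" "slope h (u, v) \<le> L"
    using *[of u v] *[of v u] sym[of u v] by (cases "v < u"; simp)+
qed

lemma bounded_slope_g: "bounded_on_pairs (slope g)"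
  unfolding bounded_on_pairs_def using slope_g_bound by blast

lemma bounded_slope_h: "bounded_on_pairs (slope h)"
proof -
  have "\<bar>slope h (u, v)\<bar> \<le> L" for u v
  proof (cases "u = v")
    case False
    have "0 < 1 / L" using L_pos by simp
    then show ?thesis using slope_h_bounds[OF False] by linarith
  qed (use L_pos in \<open>simp add: slope_def\<close>)
  then show ?thesis unfolding bounded_on_pairs_def by blast
qed

lemma eventually_slope_h:
  "eventually (\<lambda>p. 1 / L \<le> slope h p \<and> slope h p \<le> L) (pairs t)"
  unfolding eventually_pairs using slope_h_bounds by (intro exI[of _ 1]) auto

lemma quotient_residual:
  "w \<noteq> 0 \<Longrightarrow> H / w - (\<alpha> + \<beta> * (G / w)) = (H - (\<alpha> * w + \<beta> * G)) / w" for w :: real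
  by (simp add: field_simps)

lemma slope_h_tendsto:
  assumes t: "t \<in> K"
  shows "((\<lambda>p. slope h p - (a t + b t * slope g p)) \<longlongrightarrow> 0) (pairs t)"
proof (rule tendstoI)
  fix e :: real assume e: "e > 0"
  obtain \<delta> where \<delta>: "\<delta> > 0" "\<And>u v. u\<in>K \<Longrightarrow> v\<in>K \<Longrightarrow> \<bar>u - t\<bar> < \<delta> \<Longrightarrow> \<bar>v - t\<bar> < \<delta> \<Longrightarrow>
        \<bar>h u - h v - (a t * (u - v) + b t * (g u - g v))\<bar> \<le> (e/2) * \<bar>u - v\<bar>"
    using h_linear[OF t, of "e/2"] e by auto
  show "eventually (\<lambda>p. dist (slope h p - (a t + b t * slope g p)) 0 < e) (pairs t)"
    unfolding eventually_pairs
  proof (intro exI[of _ \<delta>] conjI ballI impI \<delta>(1))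
    fix u v assume uv: "u \<in> K" "v \<in> K" "u \<noteq> v \<and> \<bar>u - t\<bar> < \<delta> \<and> \<bar>v - t\<bar> < \<delta>"
    have "slope h (u, v) - (a t + b t * slope g (u, v))
        = (h u - h v - (a t * (u - v) + b t * (g u - g v))) / (u - v)"
      using uv quotient_residual[of "u - v"] by (simp add: slope_def)
    then have "\<bar>slope h (u, v) - (a t + b t * slope g (u, v))\<bar> \<le> e / 2"
      using \<delta>(2)[of u v] uv by (simp add: abs_divide divide_le_eq)
    then show "dist (slope h (u, v) - (a t + b t * slope g (u, v))) 0 < e" using e by simp
  qed
qed

lemma slope_gh_tendsto:
  assumes t: "t \<in> K"
  shows "((\<lambda>p. slope (g \<circ> h) p - (c t + d t * slope g p)) \<longlongrightarrow> 0) (pairs t)"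
proof (rule tendstoI)
  fix e :: real assume e: "e > 0"
  obtain \<delta> where \<delta>: "\<delta> > 0" "\<And>u v. u\<in>K \<Longrightarrow> v\<in>K \<Longrightarrow> \<bar>u - t\<bar> < \<delta> \<Longrightarrow> \<bar>v - t\<bar> < \<delta> \<Longrightarrow>
        \<bar>g (h u) - g (h v) - (c t * (u - v) + d t * (g u - g v))\<bar> \<le> (e/2) * \<bar>u - v\<bar>"
    using g_linear[OF t, of "e/2"] e by auto
  show "eventually (\<lambda>p. dist (slope (g \<circ> h) p - (c t + d t * slope g p)) 0 < e) (pairs t)"
    unfolding eventually_pairs
  proof (intro exI[of _ \<delta>] conjI ballI impI \<delta>(1))
    fix u v assume uv: "u \<in> K" "v \<in> K" "u \<noteq> v \<and> \<bar>u - t\<bar> < \<delta> \<and> \<bar>v - t\<bar> < \<delta>"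
    have "slope (g \<circ> h) (u, v) - (c t + d t * slope g (u, v))
        = (g (h u) - g (h v) - (c t * (u - v) + d t * (g u - g v))) / (u - v)"
      using uv quotient_residual[of "u - v"] by (simp add: slope_def)
    then have "\<bar>slope (g \<circ> h) (u, v) - (c t + d t * slope g (u, v))\<bar> \<le> e / 2"
      using \<delta>(2)[of u v] uv by (simp add: abs_divide divide_le_eq)
    then show "dist (slope (g \<circ> h) (u, v) - (c t + d t * slope g (u, v))) 0 < e" using e by simp
  qed
qed

lemma b_pos: "t \<in> K \<Longrightarrow> 0 < b t"
  using b_bounds(1)[of t] b_bounds(3) by linarith

text \<open>
  Difference quotients of \<open>h\<close> are \<open>a\<close> plus \<open>b\<close> times those of \<open>g\<close>, up to \<open>o(1)\<close>; as \<open>b > 0\<close>, the extreme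
  values correspond.
\<close>

lemma D_eq:
  assumes "t \<in> K" "\<sigma> = 1 \<or> \<sigma> = - 1"
  shows "D \<sigma> t = a t + b t * S \<sigma> t"
  by (rule extreme_limit_affine[OF assms(1) bounded_slope_g bounded_slope_h assms(2) b_pos slope_h_tendsto]) (use assms in auto)

lemma D_bounds:
  assumes "t \<in> K" "\<sigma> = 1 \<or> \<sigma> = - 1"
  shows "1 / L \<le> D \<sigma> t" "D \<sigma> t \<le> L"
proof -
  have *: "\<exists>x. 1 / L \<le> x \<and> x \<le> L \<and> \<bar>x - D \<sigma> t\<bar> < e" if "e > 0" for e
    using frequently_eventually_ex[OF extreme_limit_frequently[OF assms(1) bounded_slope_h assms(2) that] eventually_slope_h] by blast
  show "1 / L \<le> D \<sigma> t"
    by (rule field_le_epsilon) (use * in \<open>force simp: abs_less_iff\<close>)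
  show "D \<sigma> t \<le> L"
    by (rule field_le_epsilon) (use * in \<open>force simp: abs_less_iff\<close>)
qed

lemma D_pos: "t \<in> K \<Longrightarrow> \<sigma> = 1 \<or> \<sigma> = - 1 \<Longrightarrow> 0 < D \<sigma> t"
  using D_bounds(1)[of t \<sigma>] L_pos by (meson less_le_trans zero_less_divide_1_iff)

lemma S_bound:
  assumes "t \<in> K" "\<sigma> = 1 \<or> \<sigma> = - 1"
  shows "\<bar>S \<sigma> t\<bar> \<le> C"
proof (rule field_le_epsilon)
  fix e :: real assume e: "e > 0"
  have "eventually (\<lambda>p. \<bar>slope g p\<bar> \<le> C) (pairs t)"
    unfolding eventually_pairs using slope_g_bound by (intro exI[of _ 1]) auto
  from frequently_eventually_ex[OF extreme_limit_frequently[OF assms(1) bounded_slope_g assms(2) e] this]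
  show "\<bar>S \<sigma> t\<bar> \<le> C + e" by auto
qed

lemma S_le: "t \<in> K \<Longrightarrow> S (-1) t \<le> S 1 t"
  by (rule lower_limit_le_upper_limit[OF _ bounded_slope_g])

lemma D_le: "t \<in> K \<Longrightarrow> D (-1) t \<le> D 1 t"
  by (rule lower_limit_le_upper_limit[OF _ bounded_slope_h])

text \<open>
  The derivative maps the slope \<open>s\<close> to \<open>(c + d s) / (a + b s)\<close>. The determinant is \<open>1\<close>, so this map
  is increasing where the denominator is positive, and it carries the extreme slopes at \<open>t\<close> to those
  at \<open>h t\<close>.
\<close>

lemma S_equivariant:
  assumes t: "t \<in> K" and \<sigma>: "\<sigma> = 1 \<or> \<sigma> = - 1"
  shows "D \<sigma> t * S \<sigma> (h t) = c t + d t * S \<sigma> t"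
proof -
  define A where "A = D \<sigma> t"
  have A: "A > 0" unfolding A_def by (rule D_pos[OF assms])
  have A_eq: "A = a t + b t * S \<sigma> t" unfolding A_def by (rule D_eq[OF assms])
  define m where "m = (c t + d t * S \<sigma> t) / A"
  define \<eta> where "\<eta> = (\<lambda>p. (slope (g \<circ> h) p - (c t + d t * slope g p)) * A
     - (slope h p - (a t + b t * slope g p)) * (c t + d t * S \<sigma> t))"
  have "(\<eta> \<longlongrightarrow> 0 * A - 0 * (c t + d t * S \<sigma> t)) (pairs t)"
    unfolding \<eta>_def by (intro tendsto_intros slope_h_tendsto slope_gh_tendsto t)
  then have \<eta>: "(\<eta> \<longlongrightarrow> 0) (pairs t)" by simp
  \<comment> \<open>Exact form of the Moebius difference formula for secants: the denominator is the quotient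
    of \<open>h\<close> itself, which is bounded away from \<open>0\<close>, and all errors are collected in \<open>\<eta>\<close>.\<close>
  have key: "slope g (map_prod h h p) - m = (slope g p - S \<sigma> t + \<eta> p) / (slope h p * A)"
    if p: "1 / L \<le> slope h p \<and> slope h p \<le> L" "fst p \<noteq> snd p" for p
  proof -
    have pos: "slope h p > 0" using p(1) L_pos by (meson less_le_trans zero_less_divide_1_iff)
    have neq: "h (fst p) \<noteq> h (snd p)" using h_mono p(2) by (simp add: strict_mono_eq)
    have 1: "slope g (map_prod h h p) * slope h p = slope (g \<circ> h) p"
      using neq p(2) by (cases p) (simp add: slope_def)
    have "slope (g \<circ> h) p * A - (c t + d t * S \<sigma> t) * slope h p
       = (a t * d t - b t * c t) * (slope g p - S \<sigma> t) + \<eta> p"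
      unfolding \<eta>_def A_eq by (simp add: algebra_simps)
    then have "slope (g \<circ> h) p * A - (c t + d t * S \<sigma> t) * slope h p = slope g p - S \<sigma> t + \<eta> p"
      using det[OF t] by simp
    then have "slope g p - S \<sigma> t + \<eta> p = (slope g (map_prod h h p) - m) * (slope h p * A)"
    proof -
      have mA: "m * A = c t + d t * S \<sigma> t" using A by (simp add: m_def)
      have "(slope g (map_prod h h p) - m) * (slope h p * A)
          = (slope g (map_prod h h p) * slope h p) * A - m * A * slope h p" by algebra
      also have "\<dots> = slope (g \<circ> h) p * A - (c t + d t * S \<sigma> t) * slope h p" unfolding 1 mA ..
      also have "\<dots> = slope g p - S \<sigma> t + \<eta> p" by fact
      finally show ?thesis by simp
    qed
    then show ?thesis using pos A by simp
  qed
  have ev: "eventually (\<lambda>p. fst p \<noteq> snd p \<and> 1 / L \<le> slope h p \<and> slope h p \<le> L) (pairs t)"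
    unfolding eventually_pairs using slope_h_bounds by (intro exI[of _ 1]) auto
  have est: "\<bar>x / (s * A)\<bar> \<le> e" if "\<bar>x\<bar> \<le> e * A / L" "1 / L \<le> s" for x s e
  proof -
    have s: "s > 0" using that(2) L_pos by (meson less_le_trans zero_less_divide_1_iff)
    have e0: "0 \<le> e * A" using that(1) L_pos by (smt (verit) abs_ge_zero divide_neg_pos)
    have "\<bar>x\<bar> \<le> (e * A) * (1 / L)" using that by simp
    also have "\<dots> \<le> (e * A) * s" by (rule mult_left_mono[OF that(2) e0])
    finally show ?thesis using s A by (simp add: abs_divide abs_mult divide_le_eq algebra_simps)
  qed
  have "S \<sigma> (h t) = m"
  proof (rule extreme_limit_eqI[OF _ bounded_slope_g \<sigma>])
    show "h t \<in> K" using h_K t by simp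
    fix e :: real assume e: "e > 0"
    define e' where "e' = e * A / L / 2"
    have e': "e' > 0" unfolding e'_def using e A L_pos by simp
    have small: "eventually (\<lambda>p. \<bar>\<eta> p\<bar> < e') (pairs t)"
      using tendstoD[OF \<eta> e'] by simp
    show "eventually (\<lambda>p. \<sigma> * slope g p \<le> \<sigma> * m + e) (pairs (h t))"
      unfolding eventually_pairs_h
      using ev small extreme_limit_eventually[OF t bounded_slope_g \<sigma> e']
    proof eventually_elim
      case (elim p)
      let ?x = "slope g p - S \<sigma> t + \<eta> p" and ?y = "slope h p * A"
      have y: "?y > 0" using elim(1) A L_pos by (intro mult_pos_pos) (meson less_le_trans zero_less_divide_1_iff)+
      have "\<sigma> * ?x \<le> 2 * e'" using elim \<sigma> by (auto simp: abs_less_iff)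
      then have "\<sigma> * ?x / ?y \<le> (2 * e') / ?y" using y by (simp add: divide_right_mono)
      also have "\<dots> \<le> e"
      proof -
        have "2 * e' = e * A / L" by (simp add: e'_def)
        then have "\<bar>2 * e'\<bar> \<le> e * A / L" using e' by linarith
        from est[OF this, of "slope h p"] show ?thesis using elim(1) by (simp only: abs_le_iff)
      qed
      finally have "\<sigma> * (slope g (map_prod h h p) - m) \<le> e" using key[of p] elim(1) by simp
      then show ?case by (simp add: algebra_simps)
    qed
    have "frequently (\<lambda>p. \<bar>slope g p - S \<sigma> t\<bar> < e' \<and> (fst p \<noteq> snd p \<and> 1 / L \<le> slope h p \<and> slope h p \<le> L) \<and> \<bar>\<eta> p\<bar> < e') (pairs t)"
      by (rule frequently_mono[OF _ frequently_eventually_conj[OF extreme_limit_frequently[OF t bounded_slope_g \<sigma> e']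
            eventually_conj[OF ev small]]]) auto
    then show "frequently (\<lambda>p. \<sigma> * m - e \<le> \<sigma> * slope g p) (pairs (h t))"
      unfolding frequently_pairs_h
    proof (rule frequently_mono[rotated], intro allI impI)
      fix p assume p: "\<bar>slope g p - S \<sigma> t\<bar> < e' \<and> (fst p \<noteq> snd p \<and> 1 / L \<le> slope h p \<and> slope h p \<le> L) \<and> \<bar>\<eta> p\<bar> < e'"
      have "2 * e' = e * A / L" by (simp add: e'_def)
      then have "\<bar>slope g p - S \<sigma> t + \<eta> p\<bar> \<le> e * A / L" using p by linarith
      from est[OF this, of "slope h p"] have "\<bar>slope g (map_prod h h p) - m\<bar> \<le> e"
        using key[of p] p by simp
      then show "\<sigma> * m - e \<le> \<sigma> * slope g (map_prod h h p)" using \<sigma> by (auto simp: abs_le_iff)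
    qed
  qed
  then show ?thesis using A by (simp add: m_def A_def)
qed

lemma S_shift:
  assumes "t \<in> K" shows "extreme_limit \<sigma> (slope g) (t + 1) = extreme_limit \<sigma> (slope g) t"
proof -
  have "eventually (\<lambda>p. slope g (fst p + 1, snd p + 1) = slope g p) (pairs t)"
    unfolding eventually_pairs by (intro exI[of _ 1]) (auto simp: slope_def g_shift)
  then have "eventually (\<lambda>p. \<sigma> * slope g (fst p + 1, snd p + 1) \<le> x) (pairs t) \<longleftrightarrow> eventually (\<lambda>p. \<sigma> * slope g p \<le> x) (pairs t)" for x
    by (intro eventually_subst) (auto elim: eventually_mono)
  then show ?thesis unfolding extreme_limit_def eventually_pairs_shift by simp
qed

lemma D_shift:
  "extreme_limit \<sigma> (slope h) (t + 1) = extreme_limit \<sigma> (slope h) t"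
  unfolding extreme_limit_def eventually_pairs_shift by (simp add: slope_def h_shift)

text \<open>
  A bound on the difference quotients of all pairs near \<open>t\<close> is one for all pairs near a point \<open>s\<close> close
  to \<open>t\<close>.
\<close>

lemma extreme_limit_semicontinuous:
  assumes "t \<in> K" "bounded_on_pairs q" and \<sigma>: "\<sigma> = 1 \<or> \<sigma> = - 1" and "e > 0"
  shows "\<exists>\<delta>>0. \<forall>s\<in>K. \<bar>s - t\<bar> < \<delta> \<longrightarrow> \<sigma> * extreme_limit \<sigma> q s \<le> \<sigma> * extreme_limit \<sigma> q t + e"
proof -
  obtain \<delta> where \<delta>: "\<delta> > 0"
    "\<And>u v. u \<in> K \<Longrightarrow> v \<in> K \<Longrightarrow> u \<noteq> v \<Longrightarrow> \<bar>u - t\<bar> < \<delta> \<Longrightarrow> \<bar>v - t\<bar> < \<delta> \<Longrightarrow> \<sigma> * q (u, v) < \<sigma> * extreme_limit \<sigma> q t + e"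
    using extreme_limit_eventually[OF assms] unfolding eventually_pairs by blast
  show ?thesis
  proof (intro exI[of _ "\<delta> / 2"] conjI ballI impI)
    fix s assume s: "s \<in> K" "\<bar>s - t\<bar> < \<delta> / 2"
    have "eventually (\<lambda>p. \<sigma> * q p \<le> \<sigma> * extreme_limit \<sigma> q t + e) (pairs s)"
      unfolding eventually_pairs
      by (intro exI[of _ "\<delta> / 2"] conjI ballI impI less_imp_le \<delta>(2)) (use \<delta>(1) s in \<open>auto simp: abs_real_def split: if_splits\<close>)
    then show "\<sigma> * extreme_limit \<sigma> q s \<le> \<sigma> * extreme_limit \<sigma> q t + e" by (rule extreme_limit_le[OF s(1) assms(2) \<sigma>])
  qed (use \<delta> in auto)
qed

end

section \<open>Growth of the cocycle along an invariant slope\<close>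

lemma sublinear_iff:
  fixes z :: "nat \<Rightarrow> real"
  shows "(\<lambda>n. z n / real n) \<longlonglongrightarrow> 0 \<longleftrightarrow> (\<forall>e>0. \<exists>M. \<forall>n. \<bar>z n\<bar> \<le> e * real n + M)"
proof
  assume lim: "(\<lambda>n. z n / real n) \<longlonglongrightarrow> 0"
  show "\<forall>e>0. \<exists>M. \<forall>n. \<bar>z n\<bar> \<le> e * real n + M"
  proof (intro allI impI)
    fix e :: real assume e: "e > 0"
    obtain N where N: "\<forall>n\<ge>N. \<bar>z n / real n\<bar> < e"
      using LIMSEQ_D[OF lim e] by auto
    define M where "M = (\<Sum>n\<le>N. \<bar>z n\<bar>)"
    have M: "0 \<le> M" unfolding M_def by (intro sum_nonneg) auto
    have "\<bar>z n\<bar> \<le> e * real n + M" for n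
    proof (cases "n \<le> N")
      case True
      then have "\<bar>z n\<bar> \<le> M" unfolding M_def by (intro member_le_sum) auto
      then show ?thesis using e by (simp add: add_increasing)
    next
      case False
      then have "n > 0" "\<bar>z n / real n\<bar> < e" using N by auto
      then have "\<bar>z n\<bar> < e * real n" by (simp add: abs_divide divide_less_eq)
      then show ?thesis using M by simp
    qed
    then show "\<exists>M. \<forall>n. \<bar>z n\<bar> \<le> e * real n + M" by blast
  qed
next
  assume bnd: "\<forall>e>0. \<exists>M. \<forall>n. \<bar>z n\<bar> \<le> e * real n + M"
  show "(\<lambda>n. z n / real n) \<longlonglongrightarrow> 0"
  proof (rule LIMSEQ_I)
    fix r :: real assume r: "r > 0"
    then obtain M where M: "\<And>n. \<bar>z n\<bar> \<le> (r/2) * real n + M" using bnd[rule_format, of "r/2"] by auto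
    obtain N :: nat where N: "2 * \<bar>M\<bar> / r < real N" using reals_Archimedean2 by blast
    have "norm (z n / real n - 0) < r" if "n \<ge> Suc N" for n
    proof -
      have n: "real n > 0" "2 * \<bar>M\<bar> / r < real n" using that N by auto
      then have "\<bar>M\<bar> < (r/2) * real n" using r by (simp add: field_simps)
      then have "\<bar>z n\<bar> < r * real n" using M[of n] by (simp add: field_simps)
      then show ?thesis using n by (simp add: abs_divide divide_less_eq)
    qed
    then show "\<exists>no. \<forall>n\<ge>no. norm (z n / real n - 0) < r" by blast
  qed
qed

context invariant_graph
begin

lemma h_iter_K: "(h ^^ n) t \<in> K \<longleftrightarrow> t \<in> K"
  by (induction n) (auto simp: h_K)

lemma h_iter_mono: "strict_mono (h ^^ n)"
proof (induction n)
  case (Suc n)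
  then show ?case using h_mono by (auto simp: strict_mono_def)
qed (simp add: strict_mono_def)

lemma h_iter_int_shift: "(h ^^ n) (t + of_int k) = (h ^^ n) t + of_int k"
  by (rule iterate_int_shift) (rule h_shift)

lemma h_int_shift: "h (t + of_int k) = h t + of_int k"
  using h_iter_int_shift[of 1] by simp

lemma K_int_shift: "t + of_int k \<in> K \<longleftrightarrow> t \<in> K"
proof (induction k arbitrary: t rule: int_induct[where k = 0])
  case (step1 i)
  then show ?case using K_shift[of "t + of_int i"] by (simp add: add.assoc)
next
  case (step2 i)
  then show ?case using K_shift[of "t + of_int (i - 1)"] by (simp add: add.assoc)
qed simp

lemma h_iter_lower: "\<bar>u - v\<bar> \<le> L ^ n * \<bar>(h ^^ n) u - (h ^^ n) v\<bar>"
proof (induction n)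
  case (Suc n)
  note Suc
  also have "L ^ n * \<bar>(h ^^ n) u - (h ^^ n) v\<bar> \<le> L ^ n * (L * \<bar>(h ^^ Suc n) u - (h ^^ Suc n) v\<bar>)"
    using h_lower_abs[of "(h ^^ n) u" "(h ^^ n) v"] L_pos by (intro mult_left_mono) auto
  finally show ?case by (simp add: algebra_simps)
qed simp

definition jacobian :: "real \<Rightarrow> real \<times> real \<Rightarrow> real \<times> real" where
  "jacobian t v = (a t * fst v + b t * snd v, c t * fst v + d t * snd v)"

definition multiplier :: "real \<Rightarrow> nat \<Rightarrow> real \<Rightarrow> real" where
  "multiplier \<sigma> n t = (\<Prod>j<n. D \<sigma> ((h ^^ j) t))"

lemma multiplier_Suc: "multiplier \<sigma> (Suc n) t = multiplier \<sigma> n t * D \<sigma> ((h ^^ n) t)"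
  by (simp add: multiplier_def)

lemma multiplier_pos: "t \<in> K \<Longrightarrow> \<sigma> = 1 \<or> \<sigma> = - 1 \<Longrightarrow> 0 < multiplier \<sigma> n t"
  unfolding multiplier_def by (intro prod_pos) (auto simp: D_pos h_iter_K)

lemma ln_multiplier:
  "t \<in> K \<Longrightarrow> \<sigma> = 1 \<or> \<sigma> = - 1 \<Longrightarrow> ln (multiplier \<sigma> n t) = (\<Sum>j<n. ln (D \<sigma> ((h ^^ j) t)))"
  unfolding multiplier_def by (rule ln_prod) (simp, metis D_pos h_iter_K less_numeral_extra(3))

text \<open>
  In the bases \<open>(1, S \<sigma>), (0, 1)\<close> the derivative is triangular with diagonal \<open>D \<sigma>, 1 / D \<sigma>\<close>, the second
  entry being forced by the determinant. So the coordinate transverse to the invariant slope is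
  divided by the multiplier.
\<close>

lemma cocycle_coordinates:
  assumes t: "t \<in> K" and \<sigma>: "\<sigma> = 1 \<or> \<sigma> = - 1"
  shows "snd (cocycle jacobian h n t w) =
    fst (cocycle jacobian h n t w) * S \<sigma> ((h ^^ n) t) + (snd w - fst w * S \<sigma> t) / multiplier \<sigma> n t"
proof (induction n)
  case 0
  then show ?case by (simp add: multiplier_def)
next
  case (Suc n)
  let ?t = "(h ^^ n) t" and ?v = "cocycle jacobian h n t w"
  define y where "y = (snd w - fst w * S \<sigma> t) / multiplier \<sigma> n t"
  have tK: "?t \<in> K" using t by (simp add: h_iter_K)
  have A: "D \<sigma> ?t > 0" by (rule D_pos[OF tK \<sigma>])
  define s' where "s' = S \<sigma> (h ?t)"
  have 1: "D \<sigma> ?t * s' = c ?t + d ?t * S \<sigma> ?t" unfolding s'_def by (rule S_equivariant[OF tK \<sigma>])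
  have 2: "D \<sigma> ?t = a ?t + b ?t * S \<sigma> ?t" by (rule D_eq[OF tK \<sigma>])
  have dd: "D \<sigma> ?t * (d ?t - b ?t * s') = 1"
  proof -
    have "D \<sigma> ?t * (d ?t - b ?t * s') = D \<sigma> ?t * d ?t - b ?t * (D \<sigma> ?t * s')" by (simp add: algebra_simps)
    also have "\<dots> = 1" unfolding 1 unfolding 2 using det[OF tK] by (simp add: algebra_simps)
    finally show ?thesis .
  qed
  have IH: "snd ?v = fst ?v * S \<sigma> ?t + y" using Suc y_def by simp
  have "snd (jacobian ?t ?v) - fst (jacobian ?t ?v) * s' = fst ?v * (D \<sigma> ?t * s') + d ?t * y
     - (fst ?v * D \<sigma> ?t + b ?t * y) * s'"
    unfolding jacobian_def fst_conv snd_conv IH 1 unfolding 2 by (simp add: algebra_simps)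
  also have "\<dots> = (d ?t - b ?t * s') * y" by (simp add: algebra_simps)
  also have "\<dots> = y / D \<sigma> ?t" using dd A by (simp add: field_simps)
  finally show ?case by (simp add: multiplier_Suc y_def s'_def)
qed

lemma cocycle_fst:
  assumes t: "t \<in> K" and \<sigma>: "\<sigma> = 1 \<or> \<sigma> = - 1"
  shows "fst (cocycle jacobian h (Suc n) t w) = D \<sigma> ((h ^^ n) t) * fst (cocycle jacobian h n t w)
    + b ((h ^^ n) t) * ((snd w - fst w * S \<sigma> t) / multiplier \<sigma> n t)"
proof -
  have tK: "(h ^^ n) t \<in> K" using t by (simp add: h_iter_K)
  show ?thesis
    by (simp add: jacobian_def cocycle_coordinates[OF assms, of n w] D_eq[OF tK \<sigma>] algebra_simps)
qed

lemma norm_ge_fst: "\<bar>fst v\<bar> \<le> norm v" for v :: "real \<times> real"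
  using norm_fst_le[of "fst v" "snd v"] by simp

lemma norm_ge_residue: "\<bar>s\<bar> \<le> C \<Longrightarrow> \<bar>snd v - fst v * s\<bar> \<le> (1 + C) * norm v" for v :: "real \<times> real"
proof -
  assume s: "\<bar>s\<bar> \<le> C"
  have "\<bar>snd v - fst v * s\<bar> \<le> \<bar>snd v\<bar> + \<bar>fst v\<bar> * \<bar>s\<bar>"
    by (simp add: abs_mult[symmetric])
  also have "\<dots> \<le> norm v + norm v * C"
    using norm_snd_le[of "snd v" "fst v"] norm_ge_fst[of v] s by (intro add_mono mult_mono) auto
  finally show ?thesis by (simp add: algebra_simps)
qed

lemma norm_le_coordinates: "\<bar>s\<bar> \<le> C \<Longrightarrow> norm v \<le> (1 + C) * \<bar>fst v\<bar> + \<bar>snd v - fst v * s\<bar>" for v :: "real \<times> real"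
proof -
  assume s: "\<bar>s\<bar> \<le> C"
  have "norm v \<le> \<bar>fst v\<bar> + \<bar>snd v\<bar>"
    using norm_Pair_le[of "fst v" "snd v"] by simp
  also have "\<bar>snd v\<bar> \<le> \<bar>snd v - fst v * s\<bar> + \<bar>fst v\<bar> * \<bar>s\<bar>"
    by (simp add: abs_mult[symmetric])
  also have "\<bar>fst v\<bar> * \<bar>s\<bar> \<le> \<bar>fst v\<bar> * C" using s by (intro mult_left_mono) auto
  finally show ?thesis by (simp add: algebra_simps)
qed

text \<open>
  The transverse coordinate is the one divided by the multiplier, so the growth of a vector off the
  invariant slope is at least the inverse of that along the slope.
\<close>

lemma cocycle_norm_transverse:
  assumes t: "t \<in> K" and \<sigma>: "\<sigma> = 1 \<or> \<sigma> = - 1"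
  shows "\<bar>snd w - fst w * S \<sigma> t\<bar> \<le> (1 + C) * multiplier \<sigma> n t * norm (cocycle jacobian h n t w)"
proof -
  have tK: "(h ^^ n) t \<in> K" using t by (simp add: h_iter_K)
  have "\<bar>snd w - fst w * S \<sigma> t\<bar> / multiplier \<sigma> n t \<le> (1 + C) * norm (cocycle jacobian h n t w)"
    using norm_ge_residue[OF S_bound[OF tK \<sigma>], of "cocycle jacobian h n t w"]
      cocycle_coordinates[OF assms, of n w] multiplier_pos[OF assms, of n]
    by (simp add: abs_divide)
  then show ?thesis using multiplier_pos[OF assms, of n] by (simp add: divide_le_eq algebra_simps)
qed

lemma cocycle_fst_parallel:
  assumes t: "t \<in> K" and \<sigma>: "\<sigma> = 1 \<or> \<sigma> = - 1" and w: "snd w = fst w * S \<sigma> t"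
  shows "fst (cocycle jacobian h n t w) = fst w * multiplier \<sigma> n t"
proof (induction n)
  case (Suc n)
  then show ?case using cocycle_fst[OF t \<sigma>, of n w] w by (simp add: multiplier_Suc)
qed (simp add: multiplier_def)

lemma cocycle_norm_parallel:
  assumes t: "t \<in> K" and \<sigma>: "\<sigma> = 1 \<or> \<sigma> = - 1" and w: "snd w = fst w * S \<sigma> t"
  shows "\<bar>fst w\<bar> * multiplier \<sigma> n t \<le> norm (cocycle jacobian h n t w)"
    and "norm (cocycle jacobian h n t w) \<le> (1 + C) * \<bar>fst w\<bar> * multiplier \<sigma> n t"
proof -
  have tK: "(h ^^ n) t \<in> K" using t by (simp add: h_iter_K)
  have pos: "multiplier \<sigma> n t > 0" by (rule multiplier_pos[OF t \<sigma>])
  show "\<bar>fst w\<bar> * multiplier \<sigma> n t \<le> norm (cocycle jacobian h n t w)"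
    using norm_ge_fst[of "cocycle jacobian h n t w"] cocycle_fst_parallel[OF assms, of n] pos
    by (simp add: abs_mult)
  show "norm (cocycle jacobian h n t w) \<le> (1 + C) * \<bar>fst w\<bar> * multiplier \<sigma> n t"
    using norm_le_coordinates[OF S_bound[OF tK \<sigma>], of "cocycle jacobian h n t w"] cocycle_fst_parallel[OF assms, of n] pos
      cocycle_coordinates[OF t \<sigma>, of n w] w
    by (simp add: abs_mult mult.assoc)
qed

lemma B_pos: "0 < B"
proof -
  obtain t where "t \<in> K" using K_nonempty by blast
  then show ?thesis using b_bounds(1)[of t] b_bounds(2)[of t] b_bounds(3) by linarith
qed

lemma exp_minus_mult_le: "x \<le> exp z * y \<Longrightarrow> x * exp (- z) \<le> y" for x y z :: real
  by (simp add: exp_minus field_simps)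

text \<open>
  By \<open>cocycle_fst\<close>, the first coordinate divided by the multiplier grows at each step by \<open>b y\<close> over a
  product of two multipliers. A sum of \<open>n\<close> subexponential terms is subexponential, and the bound from
  below is \<open>cocycle_norm_parallel\<close> or \<open>cocycle_norm_transverse\<close>.
\<close>

lemma subexponential_cocycle:
  assumes t: "t \<in> K" and \<sigma>: "\<sigma> = 1 \<or> \<sigma> = - 1" and w: "w \<noteq> 0"
    and sub: "(\<lambda>n. ln (multiplier \<sigma> n t) / real n) \<longlonglongrightarrow> 0"
  shows "(\<lambda>n. ln (norm (cocycle jacobian h n t w)) / real n) \<longlonglongrightarrow> 0"
  unfolding sublinear_iff
proof (intro allI impI)
  fix e :: real assume "e > 0"
  define \<epsilon> where "\<epsilon> = e / 4"
  have \<epsilon>: "\<epsilon> > 0" using \<open>e > 0\<close> by (simp add: \<epsilon>_def)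
  obtain M where M: "\<And>n. \<bar>ln (multiplier \<sigma> n t)\<bar> \<le> \<epsilon> * real n + M"
    using sub[unfolded sublinear_iff, rule_format, OF \<epsilon>] by blast
  define y where "y = snd w - fst w * S \<sigma> t"
  let ?v = "\<lambda>n. cocycle jacobian h n t w"
  have pos: "multiplier \<sigma> n t > 0" for n by (rule multiplier_pos[OF t \<sigma>])
  have cell_sup: "multiplier \<sigma> n t \<le> exp (\<epsilon> * n + M)" for n
    using M[of n] pos[of n] by (metis abs_le_iff exp_le_cancel_iff exp_ln)
  have lo': "exp (- (\<epsilon> * n + M)) \<le> multiplier \<sigma> n t" for n
  proof -
    have "- (\<epsilon> * n + M) \<le> ln (multiplier \<sigma> n t)" using M[of n] by linarith
    then show ?thesis using pos[of n] by (metis exp_le_cancel_iff exp_ln)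
  qed
  have cell_inf: "1 / multiplier \<sigma> n t \<le> exp (\<epsilon> * n + M)" for n
  proof -
    from lo'[of n] have "inverse (multiplier \<sigma> n t) \<le> inverse (exp (- (\<epsilon> * n + M)))" by (intro le_imp_inverse_le) auto
    then show ?thesis by (simp only: exp_minus inverse_inverse_eq inverse_eq_divide[of "multiplier \<sigma> n t"])
  qed
  have coord: "\<bar>fst (?v n)\<bar> \<le> multiplier \<sigma> n t * (\<bar>fst w\<bar> + real n * (B * \<bar>y\<bar> * exp (2 * (\<epsilon> * n + M))))" for n
  proof (induction n)
    case 0
    then show ?case by (simp add: multiplier_def)
  next
    case (Suc n)
    define Dn where "Dn = D \<sigma> ((h ^^ n) t)"
    have tK: "(h ^^ n) t \<in> K" using t by (simp add: h_iter_K)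
    have Dn: "Dn > 0" unfolding Dn_def by (rule D_pos[OF tK \<sigma>])
    define R where "R = B * \<bar>y\<bar> * exp (2 * (\<epsilon> * Suc n + M))"
    have R0: "0 \<le> R" using B_pos by (simp add: R_def)
    have mS: "multiplier \<sigma> (Suc n) t = multiplier \<sigma> n t * Dn" by (simp add: multiplier_Suc Dn_def)
    have "\<bar>fst (?v n)\<bar> \<le> multiplier \<sigma> n t * (\<bar>fst w\<bar> + real n * R)"
    proof -
      have "exp (2 * (\<epsilon> * n + M)) \<le> exp (2 * (\<epsilon> * Suc n + M))" using \<epsilon> by simp
      then have "B * \<bar>y\<bar> * exp (2 * (\<epsilon> * n + M)) \<le> R"
        unfolding R_def using B_pos by (intro mult_left_mono) auto
      then have "\<bar>fst w\<bar> + real n * (B * \<bar>y\<bar> * exp (2 * (\<epsilon> * n + M))) \<le> \<bar>fst w\<bar> + real n * R"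
        by (intro add_left_mono mult_left_mono) auto
      then show ?thesis using Suc pos[of n] by (meson mult_left_mono order_trans less_imp_le)
    qed
    then have "Dn * \<bar>fst (?v n)\<bar> \<le> Dn * (multiplier \<sigma> n t * (\<bar>fst w\<bar> + real n * R))"
      using Dn by (intro mult_left_mono) auto
    then have 1: "Dn * \<bar>fst (?v n)\<bar> \<le> multiplier \<sigma> (Suc n) t * (\<bar>fst w\<bar> + real n * R)"
      by (simp only: mS mult.assoc mult.left_commute[of Dn])
    have 2: "\<bar>b ((h ^^ n) t)\<bar> * (\<bar>y\<bar> / multiplier \<sigma> n t) \<le> multiplier \<sigma> (Suc n) t * R"
    proof -
      have e1: "1 / multiplier \<sigma> n t \<le> exp (\<epsilon> * Suc n + M)"
        by (rule order_trans[OF cell_inf]) (use \<epsilon> in auto)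
      have e2: "1 \<le> multiplier \<sigma> (Suc n) t * exp (\<epsilon> * Suc n + M)"
        using cell_inf[of "Suc n"] pos[of "Suc n"] by (simp add: field_simps)
      have "1 / multiplier \<sigma> n t * 1 \<le> exp (\<epsilon> * Suc n + M) * (multiplier \<sigma> (Suc n) t * exp (\<epsilon> * Suc n + M))"
        by (intro mult_mono e1 e2) auto
      then have e3: "1 / multiplier \<sigma> n t \<le> multiplier \<sigma> (Suc n) t * exp (2 * (\<epsilon> * Suc n + M))"
        by (simp only: mult_2[of "\<epsilon> * Suc n + M"] exp_add[of "\<epsilon> * Suc n + M"] mult_1_right mult_ac)
      have "\<bar>b ((h ^^ n) t)\<bar> \<le> B" using b_bounds(2)[OF tK] b_pos[OF tK] by simp
      then have "\<bar>b ((h ^^ n) t)\<bar> * \<bar>y\<bar> * (1 / multiplier \<sigma> n t) \<le> B * \<bar>y\<bar> * (multiplier \<sigma> (Suc n) t * exp (2 * (\<epsilon> * Suc n + M)))"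
        using e3 pos[of n] B_pos by (intro mult_mono) auto
      then show ?thesis by (simp add: R_def algebra_simps)
    qed
    have "\<bar>fst (?v (Suc n))\<bar> \<le> \<bar>Dn * fst (?v n)\<bar> + \<bar>b ((h ^^ n) t) * (y / multiplier \<sigma> n t)\<bar>"
      unfolding cocycle_fst[OF t \<sigma>] y_def Dn_def by (rule abs_triangle_ineq)
    also have "\<dots> = Dn * \<bar>fst (?v n)\<bar> + \<bar>b ((h ^^ n) t)\<bar> * (\<bar>y\<bar> / multiplier \<sigma> n t)"
      using Dn pos[of n] by (simp add: abs_mult abs_divide)
    also have "\<dots> \<le> multiplier \<sigma> (Suc n) t * (\<bar>fst w\<bar> + real n * R) + multiplier \<sigma> (Suc n) t * R"
      using 1 2 by (rule add_mono)
    finally show ?case by (simp add: R_def algebra_simps)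
  qed
  \<comment> \<open>Four factors \<open>exp (\<epsilon> n)\<close> have to be absorbed: three from multipliers and one from the
    number \<open>n\<close> of terms, by \<open>n \<le> exp (\<epsilon> n) / \<epsilon>\<close>. Hence \<open>\<epsilon> = e / 4\<close>.\<close>
  define Q where "Q = ((1 + C) * (\<bar>fst w\<bar> + (1 / \<epsilon>) * (B * \<bar>y\<bar>)) + \<bar>y\<bar>) * exp (3 * \<bar>M\<bar>)"
  have normup: "norm (?v n) \<le> Q * exp (e * n)" for n
  proof -
    have tK: "(h ^^ n) t \<in> K" using t by (simp add: h_iter_K)
    define X where "X = exp (\<epsilon> * n)" define Y where "Y = exp \<bar>M\<bar>"
    have X: "1 \<le> X" "real n \<le> (1 / \<epsilon>) * X" and Y: "1 \<le> Y"
      using \<epsilon> exp_ge_add_one_self[of "\<epsilon> * n"] unfolding X_def Y_def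
      by (auto simp: field_simps simp del: exp_ge_add_one_self)
    have ex: "exp (\<epsilon> * n + M) \<le> X * Y" by (simp add: X_def Y_def exp_add[symmetric])
    have ex2: "exp (2 * (\<epsilon> * n + M)) \<le> X * Y * (X * Y)"
    proof -
      have "exp (2 * (\<epsilon> * n + M)) = exp (\<epsilon> * n + M) * exp (\<epsilon> * n + M)" by (simp only: mult_2 exp_add)
      then show ?thesis using mult_mono[OF ex ex] X Y by simp
    qed
    have mu: "multiplier \<sigma> n t \<le> X * Y" "1 / multiplier \<sigma> n t \<le> X * Y" using cell_sup[of n] cell_inf[of n] ex by linarith+
    have XY: "1 \<le> X * Y" using X Y mult_mono[of 1 X 1 Y] by simp
    have "\<bar>fst (?v n)\<bar> \<le> multiplier \<sigma> n t * (\<bar>fst w\<bar> + real n * (B * \<bar>y\<bar> * exp (2 * (\<epsilon> * n + M))))" by (rule coord)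
    also have "\<dots> \<le> (X * Y) * (\<bar>fst w\<bar> + ((1 / \<epsilon>) * X) * (B * \<bar>y\<bar> * (X * Y * (X * Y))))"
      using mu ex2 X Y XY pos[of n] B_pos \<epsilon> by (intro mult_mono add_mono mult_nonneg_nonneg add_nonneg_nonneg) auto
    also have "\<dots> = \<bar>fst w\<bar> * (X * Y) + (1 / \<epsilon>) * (B * \<bar>y\<bar>) * (X^4 * Y^3)" by (simp add: algebra_simps power_def)
    also have "\<dots> \<le> \<bar>fst w\<bar> * (X^4 * Y^3) + (1 / \<epsilon>) * (B * \<bar>y\<bar>) * (X^4 * Y^3)"
    proof -
      have "X ^ 1 * Y ^ 1 \<le> X ^ 4 * Y ^ 3" using X Y by (intro mult_mono power_increasing) auto
      then show ?thesis by (intro add_right_mono mult_left_mono) auto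
    qed
    finally have f: "\<bar>fst (?v n)\<bar> \<le> (\<bar>fst w\<bar> + (1 / \<epsilon>) * (B * \<bar>y\<bar>)) * (X^4 * Y^3)" by (simp add: algebra_simps)
    have "\<bar>y\<bar> / multiplier \<sigma> n t \<le> \<bar>y\<bar> * (X * Y)" using mu(2) mult_left_mono[OF mu(2), of "\<bar>y\<bar>"] by simp
    also have "\<dots> \<le> \<bar>y\<bar> * (X^4 * Y^3)"
    proof -
      have "X ^ 1 * Y ^ 1 \<le> X ^ 4 * Y ^ 3" using X Y by (intro mult_mono power_increasing) auto
      then show ?thesis by (intro mult_left_mono) auto
    qed
    finally have g: "\<bar>y\<bar> / multiplier \<sigma> n t \<le> \<bar>y\<bar> * (X^4 * Y^3)" .
    have "norm (?v n) \<le> (1 + C) * \<bar>fst (?v n)\<bar> + \<bar>y\<bar> / multiplier \<sigma> n t"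
      using norm_le_coordinates[OF S_bound[OF tK \<sigma>], of "?v n"] cocycle_coordinates[OF t \<sigma>, of n w] pos[of n]
      by (simp add: y_def abs_divide)
    also have "\<dots> \<le> (1 + C) * ((\<bar>fst w\<bar> + (1 / \<epsilon>) * (B * \<bar>y\<bar>)) * (X^4 * Y^3)) + \<bar>y\<bar> * (X^4 * Y^3)"
      using f g C_nonneg by (intro add_mono mult_left_mono) auto
    also have "\<dots> = ((1 + C) * (\<bar>fst w\<bar> + (1 / \<epsilon>) * (B * \<bar>y\<bar>)) + \<bar>y\<bar>) * (X^4 * Y^3)" by (simp add: algebra_simps)
    also have "X ^ 4 = exp (e * n)" by (simp add: X_def \<epsilon>_def exp_of_nat_mult[symmetric])
    also have "Y ^ 3 = exp (3 * \<bar>M\<bar>)" by (simp add: Y_def exp_of_nat_mult[symmetric])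
    finally show ?thesis by (simp add: Q_def algebra_simps)
  qed
  obtain q where q: "q > 0" "\<And>n. q * exp (- (\<epsilon> * n)) \<le> norm (?v n)"
  proof (cases "y = 0")
    case True
    then have par: "snd w = fst w * S \<sigma> t" by (simp add: y_def)
    have f0: "fst w \<noteq> 0" using par w by (metis mult_zero_left prod_eq_iff fst_zero snd_zero)
    show thesis
    proof (rule that[of "\<bar>fst w\<bar> * exp (- M)"])
      fix n :: nat
      have "\<bar>fst w\<bar> * exp (- (\<epsilon> * n + M)) \<le> \<bar>fst w\<bar> * multiplier \<sigma> n t" using lo'[of n] by (intro mult_left_mono) auto
      also have "\<dots> \<le> norm (?v n)" by (rule cocycle_norm_parallel[OF t \<sigma> par])
      finally show "\<bar>fst w\<bar> * exp (- M) * exp (- (\<epsilon> * n)) \<le> norm (?v n)"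
        by (simp add: mult.assoc exp_add[symmetric] algebra_simps)
    qed (use f0 in auto)
  next
    case False
    show thesis
    proof (rule that[of "\<bar>y\<bar> / (1 + C) * exp (- M)"])
      fix n :: nat
      have "\<bar>y\<bar> \<le> (1 + C) * multiplier \<sigma> n t * norm (?v n)"
        using cocycle_norm_transverse[OF t \<sigma>, of w n] by (simp add: y_def)
      also have "\<dots> \<le> (1 + C) * exp (\<epsilon> * n + M) * norm (?v n)"
        using cell_sup[of n] C_nonneg by (intro mult_right_mono mult_left_mono) auto
      finally have "\<bar>y\<bar> / (1 + C) \<le> exp (\<epsilon> * n + M) * norm (?v n)"
        using C_nonneg by (simp add: divide_le_eq algebra_simps)
      then have "\<bar>y\<bar> / (1 + C) * exp (- (\<epsilon> * n + M)) \<le> norm (?v n)"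
        by (rule exp_minus_mult_le)
      then show "\<bar>y\<bar> / (1 + C) * exp (- M) * exp (- (\<epsilon> * n)) \<le> norm (?v n)"
        by (simp add: mult.assoc exp_add[symmetric] algebra_simps)
    qed (use False C_nonneg in auto)
  qed
  have nv: "norm (?v n) > 0" for n using q(1) q(2)[of n] by (meson exp_gt_zero mult_pos_pos order_less_le_trans)
  have Qp: "Q > 0" using normup[of 0] nv[of 0] by (simp del: zero_less_norm_iff)
  have "\<bar>ln (norm (?v n))\<bar> \<le> e * real n + (\<bar>ln Q\<bar> + \<bar>ln q\<bar>)" for n
  proof -
    have "ln (norm (?v n)) \<le> ln (Q * exp (e * n))" using nv normup[of n] Qp by (subst ln_le_cancel_iff) auto
    then have 1: "ln (norm (?v n)) \<le> ln Q + e * n" using Qp by (simp add: ln_mult)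
    have "ln (q * exp (- (\<epsilon> * n))) \<le> ln (norm (?v n))" using nv q by (subst ln_le_cancel_iff) auto
    then have 2: "ln q - \<epsilon> * n \<le> ln (norm (?v n))" using q(1) by (simp add: ln_mult)
    have "\<epsilon> * n \<le> e * n" using \<open>e > 0\<close> by (simp add: \<epsilon>_def)
    then show ?thesis using 1 2 by linarith
  qed
  then show "\<exists>M. \<forall>n. \<bar>ln (norm (?v n))\<bar> \<le> e * real n + M" by blast
qed

end

section \<open>Zero exponents force regularity\<close>

text \<open>
  The Mather measure appears as its distribution \<open>\<nu>\<close> on the fundamental domain \<open>{0..<1}\<close>, on which the
  circle map is \<open>t \<mapsto> frac (h t)\<close>.
\<close>

locale irrational_graph = invariant_graph +
  fixes \<nu> :: "real measure" and \<rho> :: real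
  assumes sets_\<nu>: "sets \<nu> = sets borel"
    and total: "emeasure \<nu> UNIV = 1"
    and AE_K: "AE t in \<nu>. t \<in> K \<and> 0 \<le> t \<and> t < 1"
    and invariant: "distr \<nu> borel (\<lambda>t. frac (h t)) = \<nu>"
    and support: "t \<in> K \<Longrightarrow> e > 0 \<Longrightarrow> 0 < measure \<nu> {s. \<exists>k::int. \<bar>s + of_int k - t\<bar> < e}"
    and rotation: "(\<lambda>n. ((h ^^ n) t - t) / real n) \<longlonglongrightarrow> \<rho>"
    and irrational: "\<rho> \<notin> \<rat>"
    and atomless: "measure \<nu> {t} = 0"
begin

lemma space_\<nu> [simp]: "space \<nu> = UNIV"
  using sets_eq_imp_space_eq[OF sets_\<nu>] by simp

sublocale finite_measure \<nu>
  by (rule finite_measureI) (simp add: total)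

lemma measure_UNIV [simp]: "measure \<nu> UNIV = 1"
  using total by (simp add: measure_def)

lemma measurable_\<nu>: "f \<in> borel_measurable borel \<Longrightarrow> f \<in> borel_measurable \<nu>"
  using measurable_cong_sets[OF sets_\<nu> refl] by blast

lemma h_measurable [measurable]: "h \<in> borel_measurable borel"
  by (intro borel_measurable_mono strict_mono_mono h_mono)

lemma frac_measurable [measurable]: "(frac :: real \<Rightarrow> real) \<in> borel_measurable borel"
  unfolding frac_def by measurable

lemma integral_frac_h:
  fixes \<phi> :: "real \<Rightarrow> real"
  assumes [measurable]: "\<phi> \<in> borel_measurable borel"
  shows "(\<integral>s. \<phi> (frac (h s)) \<partial>\<nu>) = (\<integral>s. \<phi> s \<partial>\<nu>)"
proof -
  have "(\<integral>s. \<phi> s \<partial>\<nu>) = (\<integral>s. \<phi> s \<partial>(distr \<nu> borel (\<lambda>t. frac (h t))))" by (simp add: invariant)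
  also have "\<dots> = (\<integral>s. \<phi> (frac (h s)) \<partial>\<nu>)"
    by (rule integral_distr[OF measurable_\<nu> assms]) measurable
  finally show ?thesis by simp
qed

lemma frac_shift: "frac x = x + of_int (- \<lfloor>x\<rfloor>)" for x :: real
  by (simp add: frac_def)

text \<open>
  For periodic functions the passage to fractional parts is invisible, so \<open>\<nu>\<close> behaves like a measure
  invariant under \<open>h\<close>.
\<close>

lemma integral_h_iter:
  fixes \<phi> :: "real \<Rightarrow> real"
  assumes [measurable]: "\<phi> \<in> borel_measurable borel" and per: "\<And>s k. \<phi> (s + of_int k) = \<phi> s"
  shows "(\<integral>s. \<phi> ((h ^^ n) s) \<partial>\<nu>) = (\<integral>s. \<phi> s \<partial>\<nu>)"
proof (induction n)
  case (Suc n)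
  have iter: "(h ^^ n) \<in> borel_measurable borel"
    by (intro borel_measurable_mono strict_mono_mono h_iter_mono)
  have "(\<integral>s. \<phi> ((h ^^ n) s) \<partial>\<nu>) = (\<integral>s. \<phi> ((h ^^ n) (frac (h s))) \<partial>\<nu>)"
    by (rule integral_frac_h[symmetric]) (rule measurable_compose[OF iter assms(1)])
  also have "\<dots> = (\<integral>s. \<phi> ((h ^^ Suc n) s) \<partial>\<nu>)"
    unfolding frac_shift h_iter_int_shift per by (simp add: funpow_swap1)
  finally show ?case using Suc by simp
qed simp

definition irregular :: "real \<Rightarrow> real set" where
  "irregular \<delta> = {t \<in> K. \<delta> \<le> S 1 t - S (-1) t}"

text \<open>
  The gap \<open>S 1 - S (- 1)\<close> is upper semicontinuous.
\<close>

lemma irregular_closed: "closed (irregular \<delta>)"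
proof -
  have "open (- irregular \<delta>)"
    unfolding open_dist
  proof
    fix t assume t: "t \<in> - irregular \<delta>"
    show "\<exists>e>0. \<forall>y. dist y t < e \<longrightarrow> y \<in> - irregular \<delta>"
    proof (cases "t \<in> K")
      case False
      then obtain e where e: "e > 0" "\<forall>y. dist y t < e \<longrightarrow> y \<notin> K"
        using closed_K unfolding closed_def open_dist by blast
      then have "\<forall>y. dist y t < e \<longrightarrow> y \<in> - irregular \<delta>" by (simp add: irregular_def)
      then show ?thesis using e(1) by blast
    next
      case True
      define e where "e = (\<delta> - (S 1 t - S (-1) t)) / 3"
      have e: "e > 0" using t True by (simp add: irregular_def e_def)
      obtain \<delta>1 where 1: "\<delta>1 > 0" "\<And>s. s \<in> K \<Longrightarrow> \<bar>s - t\<bar> < \<delta>1 \<Longrightarrow> S 1 s \<le> S 1 t + e"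
        using extreme_limit_semicontinuous[OF True bounded_slope_g _ e, of 1] by auto
      from extreme_limit_semicontinuous[OF True bounded_slope_g _ e, of "-1"] obtain \<delta>2 where "\<delta>2 > 0"
        and \<delta>2: "\<forall>s\<in>K. \<bar>s - t\<bar> < \<delta>2 \<longrightarrow> (- 1) * S (-1) s \<le> (- 1) * S (-1) t + e" by blast
      have 2: "\<delta>2 > 0" "\<And>s. s \<in> K \<Longrightarrow> \<bar>s - t\<bar> < \<delta>2 \<Longrightarrow> S (-1) t \<le> S (-1) s + e"
        using \<open>\<delta>2 > 0\<close> \<delta>2 by force+
      show ?thesis
      proof (intro exI[of _ "min \<delta>1 \<delta>2"] conjI allI impI)
        fix s assume s: "dist s t < min \<delta>1 \<delta>2"
        have "S 1 s - S (-1) s < \<delta>" if "s \<in> K"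
        proof -
          have "S 1 s - S (-1) s \<le> S 1 t - S (-1) t + 2 * e"
            using 1(2)[OF that] 2(2)[OF that] s by (auto simp: dist_real_def)
          also have "\<dots> < \<delta>" using e by (simp add: e_def field_simps)
          finally show ?thesis .
        qed
        then show "s \<in> - irregular \<delta>" by (auto simp: irregular_def)
      qed (use 1 2 in auto)
    qed
  qed
  then show ?thesis by (simp add: closed_def)
qed

lemma S_int_shift:
  assumes "t \<in> K" shows "extreme_limit \<sigma> (slope g) (t + of_int k) = extreme_limit \<sigma> (slope g) t"
proof (induction k rule: int_induct[where k = 0])
  case (step1 i)
  then show ?case using S_shift[of "t + of_int i" \<sigma>] assms K_int_shift by (simp add: add.assoc)
next
  case (step2 i)
  then show ?case using S_shift[of "t + of_int (i - 1)" \<sigma>] assms K_int_shift[of t "i - 1"] by (simp add: add.assoc)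
qed simp

lemma irregular_shift: "t + of_int k \<in> irregular \<delta> \<longleftrightarrow> t \<in> irregular \<delta>"
  unfolding irregular_def using K_int_shift[of t k] S_int_shift[of t _ k] by auto

lemma D_difference: "t \<in> K \<Longrightarrow> D 1 t - D (-1) t = b t * (S 1 t - S (-1) t)"
  using D_eq[of t 1] D_eq[of t "-1"] by (simp add: algebra_simps)

text \<open>
  \<open>S 1 t - S (- 1) t\<close> is the area of the parallelogram spanned by \<open>(1, S 1 t)\<close> and \<open>(1, S (- 1) t)\<close>,
  and the derivative preserves area.
\<close>

lemma slope_gap_invariant:
  assumes t: "t \<in> K"
  shows "multiplier 1 n t * multiplier (-1) n t * (S 1 ((h ^^ n) t) - S (-1) ((h ^^ n) t)) = S 1 t - S (-1) t"
proof (induction n)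
  case (Suc n)
  let ?t = "(h ^^ n) t"
  have tK: "?t \<in> K" using t by (simp add: h_iter_K)
  have p: "D 1 ?t * S 1 (h ?t) = c ?t + d ?t * S 1 ?t"
    and m: "D (-1) ?t * S (-1) (h ?t) = c ?t + d ?t * S (-1) ?t"
    using S_equivariant[OF tK] by auto
  have "D 1 ?t * D (-1) ?t * (S 1 (h ?t) - S (-1) (h ?t))
      = D (-1) ?t * (D 1 ?t * S 1 (h ?t)) - D 1 ?t * (D (-1) ?t * S (-1) (h ?t))" by (simp add: algebra_simps)
  also have "\<dots> = (a ?t * d ?t - b ?t * c ?t) * (S 1 ?t - S (-1) ?t)"
    unfolding p m using D_eq[OF tK, of 1] D_eq[OF tK, of "-1"] by (simp add: algebra_simps)
  finally have "D 1 ?t * D (-1) ?t * (S 1 (h ?t) - S (-1) (h ?t)) = S 1 ?t - S (-1) ?t"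
    using det[OF tK] by simp
  then show ?case using Suc by (simp add: multiplier_Suc mult_ac)
qed (simp add: multiplier_def)

text \<open>
  By \<open>D_difference\<close>, each visit to \<open>irregular \<delta>\<close> multiplies the ratio of the two multipliers by at least
  \<open>1 + b0 \<delta> / L\<close>, and at other times the ratio does not decrease.
\<close>

lemma multiplier_ratio:
  assumes t: "t \<in> K" and \<delta>: "\<delta> > 0"
  shows "(1 + b0 * \<delta> / L) ^ card {j. j < n \<and> (h ^^ j) t \<in> irregular \<delta>} * multiplier (-1) n t \<le> multiplier 1 n t"
proof (induction n)
  case (Suc n)
  let ?t = "(h ^^ n) t" and ?N = "\<lambda>n. card {j. j < n \<and> (h ^^ j) t \<in> irregular \<delta>}"
  define q where "q = 1 + b0 * \<delta> / L"
  have q1: "1 \<le> q" using b_bounds(3) \<delta> L_pos by (simp add: q_def)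
  have tK: "?t \<in> K" using t by (simp add: h_iter_K)
  have pos: "D 1 ?t > 0" "D (-1) ?t > 0" "multiplier (-1) n t > 0" "multiplier 1 n t > 0"
    using D_pos[OF tK] multiplier_pos[OF t] by auto
  have step: "q ^ ?N (Suc n) * D (-1) ?t \<le> q ^ ?N n * D 1 ?t"
  proof (cases "?t \<in> irregular \<delta>")
    case True
    have "{j. j < Suc n \<and> (h ^^ j) t \<in> irregular \<delta>} = insert n {j. j < n \<and> (h ^^ j) t \<in> irregular \<delta>}"
      using True by (auto simp: less_Suc_eq)
    then have N: "?N (Suc n) = Suc (?N n)" by simp
    have "b0 * \<delta> \<le> D 1 ?t - D (-1) ?t"
      using True b_bounds(1)[OF tK] b_bounds(3) \<delta> unfolding D_difference[OF tK]
      by (intro mult_mono) (auto simp: irregular_def)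
    moreover have "b0 * \<delta> / L * D (-1) ?t \<le> b0 * \<delta> / L * L"
      using D_bounds(2)[OF tK, of "-1"] b_bounds(3) \<delta> L_pos by (intro mult_left_mono) auto
    ultimately have "q * D (-1) ?t \<le> D 1 ?t" using L_pos by (simp add: q_def algebra_simps)
    then show ?thesis using q1 mult_left_mono[of "q * D (-1) ?t" "D 1 ?t" "q ^ ?N n"] by (simp add: N mult_ac)
  next
    case False
    then have "{j. j < Suc n \<and> (h ^^ j) t \<in> irregular \<delta>} = {j. j < n \<and> (h ^^ j) t \<in> irregular \<delta>}"
      by (auto simp: less_Suc_eq)
    then show ?thesis using D_le[OF tK] q1 by (simp add: mult_left_mono)
  qed
  have "q ^ ?N (Suc n) * multiplier (-1) (Suc n) t = (q ^ ?N (Suc n) * D (-1) ?t) * multiplier (-1) n t"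
    by (simp add: multiplier_Suc mult_ac)
  also have "\<dots> \<le> (q ^ ?N n * D 1 ?t) * multiplier (-1) n t" using step pos by (intro mult_right_mono) auto
  also have "\<dots> = (q ^ ?N n * multiplier (-1) n t) * D 1 ?t" by (simp add: mult_ac)
  also have "\<dots> \<le> multiplier 1 n t * D 1 ?t" using Suc pos by (intro mult_right_mono) (auto simp: q_def)
  finally show ?case by (simp add: multiplier_Suc q_def)
qed (simp add: multiplier_def)

text \<open>
  At a visit that follows \<open>N\<close> earlier ones, \<open>slope_gap_invariant\<close> bounds the product of the two multipliers and
  \<open>multiplier_ratio\<close> their quotient, so the lower multiplier is at most a constant times \<open>q\<^sup>-\<^sup>N\<^sup>/\<^sup>2\<close>. A
  vector on the lower slope is contracted at this rate and any other vector is expanded, so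
  \<open>N\<close> is bounded by \<open>\<bar>ln (norm _)\<bar>\<close> up to constants. The estimate is available only at visits, but
  the counter does not change in between.
\<close>

lemma irregular_visits_rare:
  assumes t: "t \<in> K" and \<delta>: "\<delta> > 0" and w: "w \<noteq> 0"
    and zero: "(\<lambda>n. ln (norm (cocycle jacobian h n t w)) / real n) \<longlonglongrightarrow> 0"
  shows "(\<lambda>n. real (card {j. j < n \<and> (h ^^ j) t \<in> irregular \<delta>}) / real n) \<longlonglongrightarrow> 0"
  unfolding sublinear_iff
proof (intro allI impI)
  fix e :: real assume e: "e > 0"
  let ?N = "\<lambda>n. card {j. j < n \<and> (h ^^ j) t \<in> irregular \<delta>}" and ?v = "\<lambda>n. norm (cocycle jacobian h n t w)"
  define q where "q = 1 + b0 * \<delta> / L"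
  have q1: "1 < q" using b_bounds(3) \<delta> L_pos by (simp add: q_def)
  then have lnq: "ln q > 0" by simp
  have pos: "multiplier (-1) n t > 0" "multiplier 1 n t > 0" for n using multiplier_pos[OF t] by auto
  have visit: "real (?N n) * ln q \<le> ln ((2 * C + 1) / \<delta>) - 2 * ln (multiplier (-1) n t)" if "(h ^^ n) t \<in> irregular \<delta>" for n
  proof -
    let ?m = "multiplier (-1) n t"
    have gap: "S 1 t - S (-1) t \<le> 2 * C + 1" using S_bound[OF t, of 1] S_bound[OF t, of "-1"] by (simp add: abs_le_iff)
    have "q ^ ?N n * ?m * ?m * \<delta> \<le> multiplier 1 n t * ?m * \<delta>"
      using multiplier_ratio[OF t \<delta>, of n] pos[of n] \<delta> by (simp add: q_def)
    also have "\<dots> \<le> multiplier 1 n t * ?m * (S 1 ((h ^^ n) t) - S (-1) ((h ^^ n) t))"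
      using that pos[of n] by (intro mult_left_mono) (auto simp: irregular_def)
    also have "\<dots> \<le> 2 * C + 1" using slope_gap_invariant[OF t, of n] gap by simp
    finally have "q ^ ?N n * ?m * ?m \<le> (2 * C + 1) / \<delta>" using \<delta> by (simp add: le_divide_eq)
    moreover have "0 < q ^ ?N n * ?m * ?m" using q1 pos[of n] by simp
    ultimately have "ln (q ^ ?N n * ?m * ?m) \<le> ln ((2 * C + 1) / \<delta>)" by (subst ln_le_cancel_iff) auto
    then show ?thesis using q1 pos[of n] by (simp add: ln_mult ln_realpow)
  qed
  obtain R where R: "\<And>n. - ln (multiplier (-1) n t) \<le> R + \<bar>ln (?v n)\<bar>"
  proof (cases "snd w = fst w * S (-1) t")
    case True
    have f0: "fst w \<noteq> 0" using True w by (metis mult_zero_left prod_eq_iff fst_zero snd_zero)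
    define R where "R = ln ((1 + C) * \<bar>fst w\<bar>)"
    have "- ln (multiplier (-1) n t) \<le> R + \<bar>ln (?v n)\<bar>" for n
    proof -
      have "0 < \<bar>fst w\<bar> * multiplier (-1) n t" using f0 pos by simp
      then have v0: "0 < ?v n" using cocycle_norm_parallel(1)[OF t _ True, of n] by linarith
      have "ln (?v n) \<le> ln ((1 + C) * \<bar>fst w\<bar> * multiplier (-1) n t)"
      proof (rule ln_mono)
        show "?v n \<le> (1 + C) * \<bar>fst w\<bar> * multiplier (-1) n t" by (rule cocycle_norm_parallel(2)[OF t _ True]) simp
      qed (rule v0)
      also have "\<dots> = R + ln (multiplier (-1) n t)" unfolding R_def using f0 pos[of n] C_nonneg by (subst ln_mult) auto
      finally show ?thesis by linarith
    qed
    then show thesis by (rule that)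
  next
    case False
    define y where "y = \<bar>snd w - fst w * S (-1) t\<bar>"
    have y: "y > 0" using False by (simp add: y_def)
    define R where "R = ln ((1 + C) / y)"
    have "- ln (multiplier (-1) n t) \<le> R + \<bar>ln (?v n)\<bar>" for n
    proof -
      have le: "y \<le> (1 + C) * multiplier (-1) n t * ?v n"
        using cocycle_norm_transverse[OF t, of "-1" w n] by (simp add: y_def)
      then have "?v n \<noteq> 0" using y by auto
      then have v0: "?v n > 0" by simp
      have "ln y \<le> ln ((1 + C) * multiplier (-1) n t * ?v n)"
        using le y by (subst ln_le_cancel_iff) auto
      also have "\<dots> = ln (1 + C) + ln (multiplier (-1) n t) + ln (?v n)"
        using C_nonneg pos[of n] v0 by (simp add: ln_mult)
      finally show ?thesis using C_nonneg y unfolding R_def by (simp add: ln_div)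
    qed
    then show thesis by (rule that)
  qed
  have "e * ln q / 2 > 0" using e lnq by simp
  then obtain M where M: "\<And>n. \<bar>ln (?v n)\<bar> \<le> e * ln q / 2 * real n + M"
    using zero[unfolded sublinear_iff] by blast
  define Q where "Q = \<bar>ln ((2 * C + 1) / \<delta>) + 2 * R + 2 * M\<bar> / ln q"
  have Q0: "Q \<ge> 0" using lnq by (simp add: Q_def)
  have visit': "real (?N n) \<le> e * real n + Q" if "(h ^^ n) t \<in> irregular \<delta>" for n
  proof -
    have "real (?N n) * ln q \<le> e * ln q * real n + Q * ln q"
      using visit[OF that] R[of n] M[of n] lnq by (simp add: Q_def)
    then have "real (?N n) * ln q \<le> (e * real n + Q) * ln q" by (simp add: algebra_simps)
    then show ?thesis using lnq by simp
  qed
  have "real (?N n) \<le> e * real n + (Q + 1)" for n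
  proof (induction n)
    case (Suc n)
    show ?case
    proof (cases "(h ^^ n) t \<in> irregular \<delta>")
      case True
      have "{j. j < Suc n \<and> (h ^^ j) t \<in> irregular \<delta>} = insert n {j. j < n \<and> (h ^^ j) t \<in> irregular \<delta>}"
        using True by (auto simp: less_Suc_eq)
      then have "?N (Suc n) = Suc (?N n)" by simp
      then show ?thesis using visit'[OF True] e by (simp add: algebra_simps)
    next
      case False
      then have "{j. j < Suc n \<and> (h ^^ j) t \<in> irregular \<delta>} = {j. j < n \<and> (h ^^ j) t \<in> irregular \<delta>}"
        by (auto simp: less_Suc_eq)
      then show ?thesis using Suc e by (simp add: algebra_simps)
    qed
  qed (use Q0 in simp)
  then show "\<exists>M. \<forall>n. \<bar>real (?N n)\<bar> \<le> e * real n + M" by auto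
qed

text \<open>
  By invariance, the mean number of visits to \<open>irregular \<delta>\<close> per unit of time is its measure. If almost
  every orbit has visit frequency \<open>0\<close>, dominated convergence shows that this measure vanishes.
\<close>

theorem zero_exponents_imp_regular:
  assumes "AE t in \<nu>. \<exists>w. w \<noteq> 0 \<and> (\<lambda>n. ln (norm (cocycle jacobian h n t w)) / real n) \<longlonglongrightarrow> 0"
  shows "AE t in \<nu>. S 1 t = S (-1) t"
proof -
  have null: "measure \<nu> (irregular \<delta>) = 0" if \<delta>: "\<delta> > 0" for \<delta>
  proof -
    let ?E = "irregular \<delta>"
    let ?f = "\<lambda>n t. (\<Sum>j<n. indicat_real ?E ((h ^^ j) t)) / real n"
    have Eb [measurable]: "?E \<in> sets borel" using irregular_closed by (rule borel_closed)
    have iter [measurable]: "(h ^^ n) \<in> borel_measurable borel" for n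
      by (intro borel_measurable_mono strict_mono_mono h_iter_mono)
    have meas: "?f n \<in> borel_measurable borel" for n by measurable
    have cnt: "(\<Sum>j<n. indicat_real ?E ((h ^^ j) t)) = real (card {j. j < n \<and> (h ^^ j) t \<in> ?E})" for n t
    proof -
      have "(\<Sum>j<n. indicat_real ?E ((h ^^ j) t)) = real (card ({..<n} \<inter> {j. (h ^^ j) t \<in> ?E}))"
        by (simp add: indicator_def sum.If_cases)
      also have "{..<n} \<inter> {j. (h ^^ j) t \<in> ?E} = {j. j < n \<and> (h ^^ j) t \<in> ?E}" by auto
      finally show ?thesis .
    qed
    have "AE t in \<nu>. (\<lambda>n. ?f n t) \<longlonglongrightarrow> 0"
      using assms AE_K
    proof eventually_elim
      case (elim t)
      then show ?case unfolding cnt using irregular_visits_rare[OF _ \<delta>] by blast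
    qed
    then have lim: "(\<lambda>n. \<integral>t. ?f n t \<partial>\<nu>) \<longlonglongrightarrow> (\<integral>t. 0 \<partial>\<nu>)"
    proof (rule integral_dominated_convergence[where w = "\<lambda>_. 1", rotated -2])
      show "AE t in \<nu>. norm (?f n t) \<le> 1" for n
      proof (rule AE_I2)
        fix t
        have "card {j. j < n \<and> (h ^^ j) t \<in> ?E} \<le> card {..<n}" by (intro card_mono) auto
        then show "norm (?f n t) \<le> 1" unfolding cnt by (simp add: divide_le_eq)
      qed
    qed (use meas in \<open>auto intro: measurable_\<nu>\<close>)
    have int: "(\<integral>t. ?f n t \<partial>\<nu>) = measure \<nu> ?E" if "n > 0" for n
    proof -
      have "(\<integral>t. (\<Sum>j<n. indicat_real ?E ((h ^^ j) t)) \<partial>\<nu>) = (\<Sum>j<n. \<integral>t. indicat_real ?E ((h ^^ j) t) \<partial>\<nu>)"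
        by (intro Bochner_Integration.integral_sum integrable_const_bound[where B = 1] AE_I2)
           (auto simp: indicator_def intro!: measurable_\<nu>)
      also have "\<dots> = (\<Sum>j<n. \<integral>t. indicat_real ?E t \<partial>\<nu>)"
        by (intro sum.cong refl integral_h_iter) (auto simp: indicator_def irregular_shift)
      also have "\<dots> = real n * measure \<nu> ?E" by (simp add: sets_\<nu>)
      finally show ?thesis using that by simp
    qed
    have "(\<lambda>n. measure \<nu> ?E) \<longlonglongrightarrow> (\<integral>t. 0 \<partial>\<nu>)"
      by (rule Lim_transform_eventually[OF lim], rule eventually_mono[OF eventually_gt_at_top[of 0]]) (rule int)
    then show ?thesis by (simp add: LIMSEQ_const_iff)
  qed
  have "AE t in \<nu>. \<forall>n. t \<notin> irregular (1 / real (Suc n))"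
    unfolding AE_all_countable
  proof
    fix n
    have "irregular (1 / real (Suc n)) \<in> null_sets \<nu>"
      using null[of "1 / real (Suc n)"] irregular_closed by (auto simp: null_sets_def emeasure_eq_measure sets_\<nu>)
    then show "AE t in \<nu>. t \<notin> irregular (1 / real (Suc n))" by (rule AE_not_in)
  qed
  then show ?thesis using AE_K
  proof eventually_elim
    case (elim t)
    show ?case
    proof (rule ccontr)
      assume "S 1 t \<noteq> S (-1) t"
      then have "0 < S 1 t - S (-1) t" using S_le[of t] elim by auto
      from reals_Archimedean[OF this] obtain n where "1 / real (Suc n) < S 1 t - S (-1) t"
        unfolding inverse_eq_divide by blast
      then show False using elim by (auto simp: irregular_def not_le dest!: spec[of _ n])
    qed
  qed
qed

end

section \<open>The semiconjugacy to the rotation\<close>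

context irrational_graph
begin

text \<open>
  For \<open>s\<close> and \<open>t\<close> in the fundamental domain the floor is \<open>0\<close> or \<open>- 1\<close> according to \<open>s \<le> t\<close> or \<open>t < s\<close>.
  So \<open>H\<close> is the distribution function of \<open>\<nu>\<close>, up to a constant, extended to the line by \<open>H (t + 1) = H t + 1\<close>.
\<close>

definition H :: "real \<Rightarrow> real" where
  "H t = (\<integral>s. real_of_int \<lfloor>t - s\<rfloor> \<partial>\<nu>)"

lemma floor_borel [measurable]: "(\<lambda>s. real_of_int \<lfloor>t - s\<rfloor>) \<in> borel_measurable borel" for t :: real
  by measurable

lemma floor_integrable: "integrable \<nu> (\<lambda>s. real_of_int \<lfloor>t - s\<rfloor>)"
proof (rule integrable_const_bound[where B = "\<bar>t\<bar> + 2"])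
  show "AE s in \<nu>. norm (real_of_int \<lfloor>t - s\<rfloor>) \<le> \<bar>t\<bar> + 2"
    using AE_K
  proof eventually_elim
    case (elim s)
    then show ?case using floor_correct[of "t - s"] by (simp add: abs_le_iff) linarith
  qed
qed (rule measurable_\<nu>[OF floor_borel])

lemma integral_const_\<nu> [simp]: "(\<integral>s. x \<partial>\<nu>) = x" for x :: real
  by simp

lemma H_mono: "s \<le> t \<Longrightarrow> H s \<le> H t"
  unfolding H_def by (intro integral_mono floor_integrable) (auto intro!: floor_mono)

lemma H_int_shift: "H (t + of_int k) = H t + of_int k"
proof -
  have "H (t + of_int k) = (\<integral>s. real_of_int \<lfloor>t - s\<rfloor> + of_int k \<partial>\<nu>)"
    unfolding H_def by (intro Bochner_Integration.integral_cong refl) (simp add: diff_add_eq[symmetric])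
  also have "\<dots> = H t + of_int k"
    unfolding H_def by (subst Bochner_Integration.integral_add[OF floor_integrable]) auto
  finally show ?thesis .
qed

lemma H_bounds: "t - 2 \<le> H t" "H t \<le> t"
proof -
  have "(\<integral>s. t - 2 \<partial>\<nu>) \<le> H t"
    unfolding H_def
  proof (rule integral_mono_AE)
    show "AE s in \<nu>. t - 2 \<le> real_of_int \<lfloor>t - s\<rfloor>" using AE_K by eventually_elim linarith
  qed (auto intro: floor_integrable)
  then show "t - 2 \<le> H t" by simp
  have "H t \<le> (\<integral>s. t \<partial>\<nu>)"
    unfolding H_def
  proof (rule integral_mono_AE)
    show "AE s in \<nu>. real_of_int \<lfloor>t - s\<rfloor> \<le> t" using AE_K by eventually_elim linarith
  qed (auto intro: floor_integrable)
  then show "H t \<le> t" by simp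
qed

text \<open>
  Only the order and the integer translations enter \<open>\<lfloor>t - s\<rfloor>\<close>, and \<open>h\<close> respects both.
\<close>

lemma floor_h_diff: "\<lfloor>h t - h s\<rfloor> = \<lfloor>t - s\<rfloor>"
proof -
  have iff: "of_int m \<le> h t - h s \<longleftrightarrow> of_int m \<le> t - s" for m
    using strict_mono_less_eq[OF h_mono, of "s + of_int m" t] by (auto simp: h_int_shift algebra_simps)
  show ?thesis
    using iff[of "\<lfloor>h t - h s\<rfloor>"] iff[of "\<lfloor>t - s\<rfloor>"] by (intro antisym) (simp_all add: le_floor_iff)
qed

lemma H_h_const: "\<exists>\<kappa>. \<forall>t. H (h t) = H t + \<kappa>"
proof (intro exI allI)
  fix t
  have fl: "real_of_int \<lfloor>h t - frac (h s)\<rfloor> = real_of_int \<lfloor>t - s\<rfloor> + real_of_int \<lfloor>h s\<rfloor>" for s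
  proof -
    have "h t - frac (h s) = (h t - h s) + of_int \<lfloor>h s\<rfloor>" by (simp add: frac_def)
    then have "\<lfloor>h t - frac (h s)\<rfloor> = \<lfloor>h t - h s\<rfloor> + \<lfloor>h s\<rfloor>" by (simp only: floor_add_int)
    also have "\<lfloor>h t - h s\<rfloor> = \<lfloor>t - s\<rfloor>" by (rule floor_h_diff)
    finally have "\<lfloor>h t - frac (h s)\<rfloor> = \<lfloor>t - s\<rfloor> + \<lfloor>h s\<rfloor>" .
    then show ?thesis by simp
  qed
  have int2: "integrable \<nu> (\<lambda>s. real_of_int \<lfloor>h s\<rfloor>)"
  proof (rule integrable_const_bound[where B = "\<bar>h 0\<bar> + \<bar>h 1\<bar> + 2"])
    show "AE s in \<nu>. norm (real_of_int \<lfloor>h s\<rfloor>) \<le> \<bar>h 0\<bar> + \<bar>h 1\<bar> + 2"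
      using AE_K
    proof eventually_elim
      case (elim s)
      then have "h 0 \<le> h s" "h s \<le> h 1" by (auto intro: h_le)
      then show ?case using floor_correct[of "h s"] by (simp add: abs_le_iff) linarith
    qed
    have "(\<lambda>s. real_of_int \<lfloor>h s\<rfloor>) \<in> borel_measurable borel" by measurable
    then show "(\<lambda>s. real_of_int \<lfloor>h s\<rfloor>) \<in> borel_measurable \<nu>" by (rule measurable_\<nu>)
  qed
  have "H (h t) = (\<integral>s. real_of_int \<lfloor>h t - frac (h s)\<rfloor> \<partial>\<nu>)"
    unfolding H_def by (rule integral_frac_h[OF floor_borel, symmetric])
  also have "\<dots> = H t + (\<integral>s. real_of_int \<lfloor>h s\<rfloor> \<partial>\<nu>)"
    unfolding fl H_def by (rule Bochner_Integration.integral_add[OF floor_integrable int2])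
  finally show "H (h t) = H t + (\<integral>s. real_of_int \<lfloor>h s\<rfloor> \<partial>\<nu>)" .
qed

text \<open>
  \<open>H\<close> is at bounded distance from the identity, so the constant increment of \<open>H\<close> along orbits is the
  rotation number.
\<close>

lemma H_h: "H (h t) = H t + \<rho>"
proof -
  obtain \<kappa> where \<kappa>: "\<And>t. H (h t) = H t + \<kappa>" using H_h_const by blast
  have iter: "H ((h ^^ n) t) = H t + real n * \<kappa>" for n
    by (induction n) (auto simp: \<kappa> algebra_simps)
  have "(\<lambda>n. ((h ^^ n) t - t) / real n - (H ((h ^^ n) t) - H t) / real n) \<longlonglongrightarrow> 0"
  proof (rule Lim_null_comparison)
    show "eventually (\<lambda>n. norm (((h ^^ n) t - t) / real n - (H ((h ^^ n) t) - H t) / real n) \<le> 4 / real n) sequentially"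
    proof (rule always_eventually, intro allI)
      fix n
      have "\<bar>((h ^^ n) t - t) - (H ((h ^^ n) t) - H t)\<bar> \<le> 4"
        using H_bounds[of t] H_bounds[of "(h ^^ n) t"] by linarith
      then show "norm (((h ^^ n) t - t) / real n - (H ((h ^^ n) t) - H t) / real n) \<le> 4 / real n"
        by (simp add: diff_divide_distrib[symmetric] abs_divide divide_right_mono)
    qed
    show "(\<lambda>n. 4 / real n) \<longlonglongrightarrow> 0" by (rule lim_const_over_n)
  qed
  from tendsto_diff[OF rotation[of t] this]
  have "(\<lambda>n. (H ((h ^^ n) t) - H t) / real n) \<longlonglongrightarrow> \<rho>" by simp
  moreover have "(\<lambda>n. (H ((h ^^ n) t) - H t) / real n) \<longlonglongrightarrow> \<kappa>"
    by (rule tendsto_eventually, rule eventually_mono[OF eventually_gt_at_top[of 0]]) (simp add: iter)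
  ultimately have "\<kappa> = \<rho>" by (metis LIMSEQ_unique)
  then show ?thesis using \<kappa> by simp
qed

lemma H_h_iter: "H ((h ^^ n) t) = H t + real n * \<rho>"
  by (induction n) (auto simp: H_h algebra_simps)

lemma countable_null: "countable A \<Longrightarrow> AE t in \<nu>. t \<notin> A"
proof -
  assume "countable A"
  then have "(\<Union>t\<in>A. {t}) \<in> null_sets \<nu>"
    by (intro null_sets_UN') (auto simp: null_sets_def sets_\<nu> emeasure_eq_measure atomless)
  then show ?thesis by (intro AE_not_in) simp
qed

text \<open>
  Every neighbourhood of a point of \<open>K\<close> has positive measure.
\<close>

lemma H_increases:
  assumes t: "t \<in> K" and e: "e > 0"
  shows "H (t - e) < H (t + e)"
proof -
  let ?A = "{s. \<exists>k::int. \<bar>s + of_int k - t\<bar> < e}"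
  have "open ?A"
  proof -
    have "?A = (\<Union>k::int. ball (t - of_int k) e)" by (auto simp: dist_real_def abs_minus_commute algebra_simps)
    then show ?thesis by auto
  qed
  then have A: "?A \<in> sets \<nu>" by (simp add: sets_\<nu>)
  have "measure \<nu> ?A = (\<integral>s. indicator ?A s \<partial>\<nu>)" using A by simp
  also have "\<dots> \<le> (\<integral>s. real_of_int \<lfloor>(t + e) - s\<rfloor> - real_of_int \<lfloor>(t - e) - s\<rfloor> \<partial>\<nu>)"
  proof (rule integral_mono)
    fix s
    show "indicator ?A s \<le> real_of_int \<lfloor>(t + e) - s\<rfloor> - real_of_int \<lfloor>(t - e) - s\<rfloor>"
    proof (cases "s \<in> ?A")
      case True
      then obtain k :: int where k: "\<bar>s + of_int k - t\<bar> < e" by blast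
      then have "k \<le> \<lfloor>(t + e) - s\<rfloor>" "\<lfloor>(t - e) - s\<rfloor> < k" by (simp_all add: le_floor_iff floor_less_iff abs_less_iff)
      then show ?thesis using True by simp
    next
      case False
      have "\<lfloor>(t - e) - s\<rfloor> \<le> \<lfloor>(t + e) - s\<rfloor>" using e by (intro floor_mono) auto
      then show ?thesis using False by simp
    qed
    show "integrable \<nu> (indicat_real ?A)"
      by (rule integrable_const_bound[where B = 1]) (use A in \<open>auto simp: indicator_def\<close>)
  qed (intro Bochner_Integration.integrable_diff floor_integrable)
  also have "\<dots> = H (t + e) - H (t - e)"
    unfolding H_def by (intro Bochner_Integration.integral_diff floor_integrable)
  finally show ?thesis using support[OF t e] by linarith
qed

text \<open>
  If two points have the same value of \<open>H\<close>, there is no point of \<open>K\<close> between them by \<open>H_increases\<close>. A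
  point of \<open>K\<close> with this property is the last one before, or the first one after, a rational number of
  the gap; there are countably many such points, and \<open>\<nu>\<close> has no atoms.
\<close>

lemma AE_not_gap_end: "AE t in \<nu>. \<forall>s. s \<noteq> t \<longrightarrow> H s \<noteq> H t"
proof -
  let ?A = "(\<lambda>r::rat. Sup (K \<inter> {..of_rat r})) ` UNIV \<union> (\<lambda>r::rat. Inf (K \<inter> {of_rat r..})) ` UNIV"
  have gap: "x \<notin> K" if "u < x" "x < v" "H u = H v" for u v x
  proof
    assume x: "x \<in> K"
    define e where "e = min (x - u) (v - x)"
    have e: "e > 0" using that by (simp add: e_def)
    have "H u \<le> H (x - e)" "H (x + e) \<le> H v" by (intro H_mono; simp add: e_def min_def)+
    then show False using H_increases[OF x e] that(3) by linarith
  qed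
  have "AE t in \<nu>. t \<notin> ?A" by (intro countable_null) simp
  then show ?thesis using AE_K
  proof eventually_elim
    case (elim t)
    show ?case
    proof (intro allI impI notI)
      fix s assume "s \<noteq> t" and Hs: "H s = H t"
      then consider "t < s" | "s < t" by linarith
      then show False
      proof cases
        case 1
        then obtain r where r: "t < of_rat r" "of_rat r < s" using of_rat_dense by blast
        have "Sup (K \<inter> {..of_rat r}) = t"
        proof (rule cSup_eq_maximum)
          show "t \<in> K \<inter> {..of_rat r}" using elim r by simp
          fix x assume "x \<in> K \<inter> {..of_rat r}"
          then show "x \<le> t" using gap[of t x s] Hs r by force
        qed
        then show False using elim by blast
      next
        case 2
        then obtain r where r: "s < of_rat r" "of_rat r < t" using of_rat_dense by blast
        have "Inf (K \<inter> {of_rat r..}) = t"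
        proof (rule cInf_eq_minimum)
          show "t \<in> K \<inter> {of_rat r..}" using elim r by simp
          fix x assume "x \<in> K \<inter> {of_rat r..}"
          then show "t \<le> x" using gap[of s x t] Hs r by force
        qed
        then show False using elim by blast
      qed
    qed
  qed
qed

end

section \<open>Comparison of Birkhoff sums over one block\<close>

text \<open>
  \<open>j \<mapsto> k + j p\<close> permutes the residues modulo \<open>Q\<close>.
\<close>

lemma sum_over_coprime_progression:
  fixes F :: "int \<Rightarrow> real"
  assumes per: "\<And>i m. F (i + m * int Q) = F i" and Q: "Q > 0" and cop: "coprime p (int Q)"
  shows "(\<Sum>j<Q. F (k + int j * p)) = (\<Sum>i<Q. F (int i))"
proof -
  define r where "r j = nat ((k + int j * p) mod int Q)" for j :: nat
  have F: "F (k + int j * p) = F (int (r j))" for j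
  proof -
    have "int (r j) = (k + int j * p) mod int Q" using Q by (simp add: r_def)
    then have "k + int j * p = int (r j) + ((k + int j * p) div int Q) * int Q" by simp
    then show ?thesis using per by metis
  qed
  have sub: "r ` {..<Q} \<subseteq> {..<Q}" using Q by (auto simp: r_def nat_less_iff)
  have inj: "inj_on r {..<Q}"
  proof (rule inj_onI)
    fix i j assume ij: "i \<in> {..<Q}" "j \<in> {..<Q}" "r i = r j"
    have "(k + int i * p) mod int Q = (k + int j * p) mod int Q"
      using ij(3) Q by (simp add: r_def eq_nat_nat_iff)
    then have "int Q dvd (k + int i * p) - (k + int j * p)" by (simp add: mod_eq_dvd_iff)
    then have "int Q dvd (int i - int j) * p" by (simp add: algebra_simps)
    then have "int Q dvd int i - int j" using cop by (simp add: coprime_dvd_mult_left_iff coprime_commute)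
    moreover have "\<bar>int i - int j\<bar> < int Q" using ij(1,2) by auto
    ultimately have "int i - int j = 0" using dvd_imp_le_int[of "int i - int j" "int Q"] by fastforce
    then show "i = j" by simp
  qed
  have "(\<Sum>j<Q. F (k + int j * p)) = (\<Sum>j<Q. F (int (r j)))" by (simp add: F)
  also have "\<dots> = (\<Sum>i\<in>r ` {..<Q}. F (int i))" using inj by (simp add: sum.reindex)
  also have "r ` {..<Q} = {..<Q}" using endo_inj_surj[OF _ sub inj] by simp
  finally show ?thesis .
qed

context irrational_graph
begin

lemma D_int_shift: "extreme_limit \<sigma> (slope h) (t + of_int k) = extreme_limit \<sigma> (slope h) t"
proof (induction k rule: int_induct[where k = 0])
  case (step1 i)
  then show ?case using D_shift[of \<sigma> "t + of_int i"] by (simp add: add.assoc)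
next
  case (step2 i)
  then show ?case using D_shift[of \<sigma> "t + of_int (i - 1)"] by (simp add: add.assoc)
qed simp

lemma ln_D_bound: "t \<in> K \<Longrightarrow> \<sigma> = 1 \<or> \<sigma> = - 1 \<Longrightarrow> \<bar>ln (D \<sigma> t)\<bar> \<le> ln L"
proof -
  assume t: "t \<in> K" "\<sigma> = 1 \<or> \<sigma> = - 1"
  have "ln (D \<sigma> t) \<le> ln L" using D_bounds(2)[OF t] D_pos[OF t] by simp
  moreover have "ln (1 / L) \<le> ln (D \<sigma> t)" using D_bounds(1)[OF t] D_pos[OF t] L_pos by simp
  ultimately show ?thesis using L_pos by (simp add: ln_div abs_le_iff)
qed

definition cell_index :: "nat \<Rightarrow> real \<Rightarrow> int" where "cell_index Q t = \<lfloor>real Q * H t\<rfloor>"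

text \<open>
  Points whose value of \<open>H\<close> is at most \<open>w / Q\<close> away from the interval \<open>[i / Q, (i + 1) / Q]\<close>. The
  tolerance \<open>w\<close> absorbs the error made when \<open>\<rho>\<close> is replaced by \<open>p / Q\<close>.
\<close>

definition cell :: "nat \<Rightarrow> int \<Rightarrow> int \<Rightarrow> real set" where
  "cell Q w i = {s \<in> K. \<bar>cell_index Q s - i\<bar> \<le> w}"

definition cell_sup :: "nat \<Rightarrow> int \<Rightarrow> int \<Rightarrow> real" where
  "cell_sup Q w i = (SUP s\<in>cell Q w i. ln (D 1 s))"

definition cell_inf :: "nat \<Rightarrow> int \<Rightarrow> int \<Rightarrow> real" where
  "cell_inf Q w i = (INF s\<in>cell Q w i. ln (D (-1) s))"

lemma cell_index_int_shift: "cell_index Q (t + of_int m) = cell_index Q t + m * int Q"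
proof -
  have "real Q * H (t + of_int m) = real Q * H t + of_int (m * int Q)"
    by (simp add: H_int_shift algebra_simps)
  then show ?thesis unfolding cell_index_def by (simp only: floor_add_int)
qed

lemma cell_int_shift: "cell Q w (i + m * int Q) = (\<lambda>s. s + of_int m) ` cell Q w i"
proof (intro equalityI subsetI)
  fix s assume s: "s \<in> cell Q w (i + m * int Q)"
  have "s - of_int m \<in> cell Q w i"
    using s cell_index_int_shift[of Q s "- m"] K_int_shift[of s "- m"] by (auto simp: cell_def algebra_simps)
  then show "s \<in> (\<lambda>s. s + of_int m) ` cell Q w i" by (rule rev_image_eqI) simp
next
  fix s assume "s \<in> (\<lambda>s. s + of_int m) ` cell Q w i"
  then show "s \<in> cell Q w (i + m * int Q)" by (auto simp: cell_def cell_index_int_shift K_int_shift)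
qed

lemma cell_sup_periodic: "cell_sup Q w (i + m * int Q) = cell_sup Q w i"
  unfolding cell_sup_def cell_int_shift image_image D_int_shift ..

lemma cell_inf_periodic: "cell_inf Q w (i + m * int Q) = cell_inf Q w i"
  unfolding cell_inf_def cell_int_shift image_image D_int_shift ..

lemma bdd_above_cell: "bdd_above ((\<lambda>s. ln (D 1 s)) ` cell Q w i)"
  by (rule bdd_aboveI2[of _ _ "ln L"]) (use ln_D_bound in \<open>auto simp: cell_def abs_le_iff\<close>)

lemma bdd_below_cell: "bdd_below ((\<lambda>s. ln (D (-1) s)) ` cell Q w i)"
  by (rule bdd_belowI2[of _ "- ln L"]) (use ln_D_bound in \<open>fastforce simp: cell_def abs_le_iff\<close>)

lemma le_cell_sup: "s \<in> cell Q w i \<Longrightarrow> ln (D 1 s) \<le> cell_sup Q w i"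
  unfolding cell_sup_def by (rule cSUP_upper[OF _ bdd_above_cell])

lemma cell_inf_le: "s \<in> cell Q w i \<Longrightarrow> cell_inf Q w i \<le> ln (D (-1) s)"
  unfolding cell_inf_def by (rule cINF_lower[OF bdd_below_cell])

text \<open>
  In fewer than \<open>Q\<close> steps the error \<open>\<bar>Q \<rho> - p\<bar>\<close> accumulates to less than \<open>1\<close>.
\<close>

lemma cell_index_orbit:
  assumes j: "j < Q" and p: "\<bar>real Q * \<rho> - of_int p\<bar> < 1 / real Q"
  shows "\<bar>cell_index Q ((h ^^ j) x) - (cell_index Q x + int j * p)\<bar> \<le> 1"
proof -
  have Q: "real Q > 0" using j by simp
  have "\<bar>real j * (real Q * \<rho>) - real j * of_int p\<bar> = real j * \<bar>real Q * \<rho> - of_int p\<bar>"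
    by (simp add: abs_mult flip: right_diff_distrib)
  also have "\<dots> \<le> real j * (1 / real Q)" using p by (intro mult_left_mono) auto
  also have "\<dots> < 1" using j by simp
  finally have e: "\<bar>real j * (real Q * \<rho>) - of_int (int j * p)\<bar> < 1" by simp
  have "real Q * H ((h ^^ j) x) = real Q * H x + real j * (real Q * \<rho>)"
    by (simp add: H_h_iter algebra_simps)
  then show ?thesis
    using e floor_correct[of "real Q * H x"] floor_correct[of "real Q * H ((h ^^ j) x)"]
    unfolding cell_index_def by linarith
qed

lemma orbit_in_cell:
  assumes "x \<in> K" "j < Q" "\<bar>real Q * \<rho> - of_int p\<bar> < 1 / real Q"
  shows "(h ^^ j) x \<in> cell Q 1 (cell_index Q x + int j * p)"
  unfolding cell_def using cell_index_orbit[OF assms(2,3)] assms(1) by (simp add: h_iter_K)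

text \<open>
  Up to the tolerance, \<open>Q\<close> steps visit each residue class of cells once, whatever the starting point.
\<close>

lemma block_upper:
  assumes "x \<in> K" "Q > 0" "coprime p (int Q)" "\<bar>real Q * \<rho> - of_int p\<bar> < 1 / real Q"
  shows "(\<Sum>j<Q. ln (D 1 ((h ^^ j) x))) \<le> (\<Sum>i<Q. cell_sup Q 1 (int i))"
proof -
  have "(\<Sum>j<Q. ln (D 1 ((h ^^ j) x))) \<le> (\<Sum>j<Q. cell_sup Q 1 (cell_index Q x + int j * p))"
    by (intro sum_mono le_cell_sup orbit_in_cell assms) auto
  also have "\<dots> = (\<Sum>i<Q. cell_sup Q 1 (int i))"
    by (intro sum_over_coprime_progression assms cell_sup_periodic)
  finally show ?thesis .
qed

lemma block_lower:
  assumes "x \<in> K" "Q > 0" "coprime p (int Q)" "\<bar>real Q * \<rho> - of_int p\<bar> < 1 / real Q"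
  shows "(\<Sum>i<Q. cell_inf Q 1 (int i)) \<le> (\<Sum>j<Q. ln (D (-1) ((h ^^ j) x)))"
proof -
  have "(\<Sum>j<Q. cell_inf Q 1 (cell_index Q x + int j * p)) \<le> (\<Sum>j<Q. ln (D (-1) ((h ^^ j) x)))"
    by (intro sum_mono cell_inf_le orbit_in_cell assms) auto
  also have "(\<Sum>j<Q. cell_inf Q 1 (cell_index Q x + int j * p)) = (\<Sum>i<Q. cell_inf Q 1 (int i))"
    by (intro sum_over_coprime_progression assms cell_inf_periodic)
  finally show ?thesis .
qed

text \<open>
  Tolerance \<open>2\<close>: a cell of tolerance \<open>1\<close> around the predicted index \<open>k + j p\<close> lies in the cell of
  tolerance \<open>2\<close> around the actual index of the point of the orbit.
\<close>

definition oscillation :: "nat \<Rightarrow> int \<Rightarrow> real" where "oscillation Q i = cell_sup Q 2 i - cell_inf Q 2 i"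

lemma self_in_cell: "z \<in> K \<Longrightarrow> z \<in> cell Q 2 (cell_index Q z)"
  by (simp add: cell_def)

lemma oscillation_bounds: assumes "z \<in> K" shows "0 \<le> oscillation Q (cell_index Q z)" "oscillation Q (cell_index Q z) \<le> 2 * ln L"
proof -
  have z: "z \<in> cell Q 2 (cell_index Q z)" by (rule self_in_cell[OF assms])
  have "ln (D (-1) z) \<le> ln (D 1 z)" using D_le[OF assms] D_pos[OF assms, of "-1"] by simp
  then show "0 \<le> oscillation Q (cell_index Q z)" using le_cell_sup[OF z] cell_inf_le[OF z] by (simp add: oscillation_def)
  have ne: "cell Q 2 (cell_index Q z) \<noteq> {}" using z by blast
  have "cell_sup Q 2 (cell_index Q z) \<le> ln L"
    unfolding cell_sup_def by (rule cSUP_least[OF ne]) (use ln_D_bound in \<open>auto simp: cell_def abs_le_iff\<close>)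
  moreover have "- ln L \<le> cell_inf Q 2 (cell_index Q z)"
    unfolding cell_inf_def by (rule cINF_greatest[OF ne]) (use ln_D_bound in \<open>fastforce simp: cell_def abs_le_iff\<close>)
  ultimately show "oscillation Q (cell_index Q z) \<le> 2 * ln L" by (simp add: oscillation_def)
qed

lemma block_oscillation:
  assumes z: "z \<in> K" and "Q > 0" "coprime p (int Q)" "\<bar>real Q * \<rho> - of_int p\<bar> < 1 / real Q"
  shows "(\<Sum>i<Q. cell_sup Q 1 (int i) - cell_inf Q 1 (int i)) \<le> (\<Sum>j<Q. oscillation Q (cell_index Q ((h ^^ j) z)))"
proof -
  have "(\<Sum>i<Q. cell_sup Q 1 (int i) - cell_inf Q 1 (int i)) = (\<Sum>j<Q. cell_sup Q 1 (cell_index Q z + int j * p) - cell_inf Q 1 (cell_index Q z + int j * p))"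
    by (rule sum_over_coprime_progression[symmetric, where F = "\<lambda>i. cell_sup Q 1 i - cell_inf Q 1 i"])
       (use assms in \<open>simp_all add: cell_sup_periodic cell_inf_periodic\<close>)
  also have "\<dots> \<le> (\<Sum>j<Q. oscillation Q (cell_index Q ((h ^^ j) z)))"
  proof (rule sum_mono)
    fix j assume "j \<in> {..<Q}"
    then have j: "j < Q" by simp
    let ?i = "cell_index Q z + int j * p" and ?k = "cell_index Q ((h ^^ j) z)"
    have ne: "cell Q 1 ?i \<noteq> {}" using orbit_in_cell[OF z j assms(4)] by blast
    have sub: "cell Q 1 ?i \<subseteq> cell Q 2 ?k" using cell_index_orbit[OF j assms(4), of z] by (auto simp: cell_def)
    have "cell_sup Q 1 ?i \<le> cell_sup Q 2 ?k" unfolding cell_sup_def by (rule cSUP_subset_mono[OF ne bdd_above_cell sub]) simp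
    moreover have "cell_inf Q 2 ?k \<le> cell_inf Q 1 ?i" unfolding cell_inf_def by (rule cINF_superset_mono[OF ne bdd_below_cell sub]) simp
    ultimately show "cell_sup Q 1 ?i - cell_inf Q 1 ?i \<le> oscillation Q ?k" by (simp add: oscillation_def)
  qed
  finally show ?thesis .
qed

lemma oscillation_measurable: "(\<lambda>z. oscillation Q (cell_index Q z)) \<in> borel_measurable borel"
proof -
  have [measurable]: "H \<in> borel_measurable borel"
    by (rule borel_measurable_mono) (auto intro!: monoI H_mono)
  have "cell_index Q \<in> borel \<rightarrow>\<^sub>M count_space UNIV"
    unfolding cell_index_def[abs_def] by measurable
  then show ?thesis by (rule measurable_compose) simp
qed

text \<open>
  The sum over all cells is at most the sum of the oscillations along the orbit of any \<open>z\<close>. Integrating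
  over \<open>z\<close> and using invariance replaces the latter by \<open>Q\<close> times one integral.
\<close>

lemma block_oscillation_integral:
  assumes "Q > 0" "coprime p (int Q)" "\<bar>real Q * \<rho> - of_int p\<bar> < 1 / real Q"
  shows "(\<Sum>i<Q. cell_sup Q 1 (int i) - cell_inf Q 1 (int i)) \<le> real Q * (\<integral>z. oscillation Q (cell_index Q z) \<partial>\<nu>)"
proof -
  let ?c = "\<Sum>i<Q. cell_sup Q 1 (int i) - cell_inf Q 1 (int i)"
  have meas: "(\<lambda>z. oscillation Q (cell_index Q ((h ^^ j) z))) \<in> borel_measurable borel" for j
    by (rule measurable_compose[OF _ oscillation_measurable]) (intro borel_measurable_mono strict_mono_mono h_iter_mono)
  have int: "integrable \<nu> (\<lambda>z. oscillation Q (cell_index Q ((h ^^ j) z)))" for j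
  proof (rule integrable_const_bound[where B = "2 * ln L"])
    show "AE z in \<nu>. norm (oscillation Q (cell_index Q ((h ^^ j) z))) \<le> 2 * ln L"
      using AE_K
    proof eventually_elim
      case (elim z)
      then have "(h ^^ j) z \<in> K" by (simp add: h_iter_K)
      from oscillation_bounds[OF this, of Q] show ?case by simp
    qed
  qed (rule measurable_\<nu>[OF meas])
  have "?c = (\<integral>z. ?c \<partial>\<nu>)" by simp
  also have "\<dots> \<le> (\<integral>z. (\<Sum>j<Q. oscillation Q (cell_index Q ((h ^^ j) z))) \<partial>\<nu>)"
  proof (rule integral_mono_AE)
    show "AE z in \<nu>. ?c \<le> (\<Sum>j<Q. oscillation Q (cell_index Q ((h ^^ j) z)))"
      using AE_K by eventually_elim (rule block_oscillation[OF _ assms], simp)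
  qed (auto intro: int)
  also have "\<dots> = (\<Sum>j<Q. \<integral>z. oscillation Q (cell_index Q ((h ^^ j) z)) \<partial>\<nu>)"
    by (rule Bochner_Integration.integral_sum[OF int])
  also have "\<dots> = (\<Sum>j<Q. \<integral>z. oscillation Q (cell_index Q z) \<partial>\<nu>)"
  proof (intro sum.cong refl integral_h_iter[OF oscillation_measurable])
    fix s k
    show "oscillation Q (cell_index Q (s + of_int k)) = oscillation Q (cell_index Q s)"
      unfolding cell_index_int_shift oscillation_def cell_sup_periodic cell_inf_periodic ..
  qed
  finally show ?thesis by simp
qed

text \<open>
  As \<open>z\<close> is not the end of a gap, the cells around it shrink to \<open>z\<close>. There the upper limit \<open>D 1\<close> is upper
  semicontinuous, the lower limit \<open>D (- 1)\<close> is lower semicontinuous, and both have the same value at \<open>z\<close>.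
\<close>

lemma oscillation_tendsto:
  assumes z: "z \<in> K" and reg: "S 1 z = S (-1) z" and gap: "\<forall>s. s \<noteq> z \<longrightarrow> H s \<noteq> H z"
  shows "(\<lambda>Q. oscillation Q (cell_index Q z)) \<longlonglongrightarrow> 0"
proof (rule LIMSEQ_I)
  fix r :: real assume r: "r > 0"
  define e where "e = r / 3"
  have e: "e > 0" using r by (simp add: e_def)
  define A where "A = D 1 z"
  have A: "A > 0" "D (-1) z = A"
    using D_pos[OF z, of 1] D_eq[OF z, of 1] D_eq[OF z, of "-1"] reg by (auto simp: A_def)
  have e1: "A * (exp e - 1) > 0" "A * (1 - exp (- e)) > 0" using A e by simp_all
  from extreme_limit_semicontinuous[OF z bounded_slope_h _ e1(1), of 1] obtain \<delta>1 where \<delta>1: "\<delta>1 > 0"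
    "\<forall>s\<in>K. \<bar>s - z\<bar> < \<delta>1 \<longrightarrow> 1 * D 1 s \<le> 1 * D 1 z + A * (exp e - 1)" by blast
  from extreme_limit_semicontinuous[OF z bounded_slope_h _ e1(2), of "-1"] obtain \<delta>2 where \<delta>2: "\<delta>2 > 0"
    "\<forall>s\<in>K. \<bar>s - z\<bar> < \<delta>2 \<longrightarrow> (- 1) * D (-1) s \<le> (- 1) * D (-1) z + A * (1 - exp (- e))" by blast
  define \<delta> where "\<delta> = min \<delta>1 \<delta>2"
  have \<delta>: "\<delta> > 0" using \<delta>1 \<delta>2 by (simp add: \<delta>_def)
  have near1: "ln (D 1 s) \<le> ln A + e" if "s \<in> K" "\<bar>s - z\<bar> < \<delta>" for s
  proof -
    have "D 1 s \<le> A * exp e" using \<delta>1(2) that by (auto simp: \<delta>_def A_def algebra_simps)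
    then have "ln (D 1 s) \<le> ln (A * exp e)" using D_pos[OF that(1), of 1] by (intro ln_mono) auto
    then show ?thesis using A by (simp add: ln_mult)
  qed
  have near2: "ln A - e \<le> ln (D (-1) s)" if "s \<in> K" "\<bar>s - z\<bar> < \<delta>" for s
  proof -
    have "A * exp (- e) \<le> D (-1) s" using \<delta>2(2) that A by (auto simp: \<delta>_def algebra_simps)
    then have "ln (A * exp (- e)) \<le> ln (D (-1) s)" using A by (intro ln_mono) auto
    then show ?thesis using A by (simp add: ln_mult)
  qed
  define \<eta> where "\<eta> = min (H (z + \<delta>) - H z) (H z - H (z - \<delta>))"
  have \<eta>: "\<eta> > 0"
    using gap[rule_format, of "z + \<delta>"] gap[rule_format, of "z - \<delta>"] H_mono[of z "z + \<delta>"] H_mono[of "z - \<delta>" z] \<delta>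
    by (auto simp: \<eta>_def)
  obtain N :: nat where N: "3 / \<eta> < real N" using reals_Archimedean2 by blast
  have "norm (oscillation Q (cell_index Q z) - 0) < r" if "Q \<ge> N" for Q
  proof -
    have Q: "3 / \<eta> < real Q" using N that by linarith
    then have Q0: "real Q > 0" using \<eta> by (meson divide_pos_pos less_trans zero_less_numeral)
    have Q\<eta>: "3 < real Q * \<eta>" using Q \<eta> by (simp add: field_simps)
    have near: "\<bar>s - z\<bar> < \<delta>" if s: "s \<in> cell Q 2 (cell_index Q z)" for s
    proof -
      have "\<bar>cell_index Q s - cell_index Q z\<bar> \<le> 2" using s by (simp add: cell_def)
      then have "\<bar>real Q * H s - real Q * H z\<bar> < 3"
        using floor_correct[of "real Q * H s"] floor_correct[of "real Q * H z"]
        unfolding cell_index_def by linarith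
      then have "\<bar>real Q * (H s - H z)\<bar> < real Q * \<eta>" using Q\<eta> by (simp add: algebra_simps)
      then have "\<bar>H s - H z\<bar> < \<eta>" using Q0 by (simp add: abs_mult)
      then have "H s < H (z + \<delta>)" "H (z - \<delta>) < H s" by (auto simp: \<eta>_def)
      then have "s < z + \<delta>" "z - \<delta> < s" using H_mono[of "z + \<delta>" s] H_mono[of s "z - \<delta>"] by (auto simp: not_le[symmetric])
      then show ?thesis by (simp add: abs_less_iff)
    qed
    have ne: "cell Q 2 (cell_index Q z) \<noteq> {}" using self_in_cell[OF z] by blast
    have "cell_sup Q 2 (cell_index Q z) \<le> ln A + e"
      unfolding cell_sup_def by (rule cSUP_least[OF ne]) (use near1 near in \<open>auto simp: cell_def\<close>)
    moreover have "ln A - e \<le> cell_inf Q 2 (cell_index Q z)"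
      unfolding cell_inf_def by (rule cINF_greatest[OF ne]) (use near2 near in \<open>auto simp: cell_def\<close>)
    ultimately have "oscillation Q (cell_index Q z) \<le> 2 * e" by (simp add: oscillation_def)
    then show ?thesis using oscillation_bounds(1)[OF z, of Q] r by (simp add: e_def)
  qed
  then show "\<exists>no. \<forall>Q\<ge>no. norm (oscillation Q (cell_index Q z) - 0) < r" by blast
qed

text \<open>
  \<open>block_upper\<close> and \<open>block_lower\<close> reduce the comparison of two orbits to the oscillations, whose integral
  tends to \<open>0\<close>. Irrationality of \<open>\<rho>\<close> provides arbitrarily large denominators \<open>Q\<close>.
\<close>

lemma small_block:
  assumes reg: "AE t in \<nu>. S 1 t = S (-1) t" and \<epsilon>: "\<epsilon> > 0"
  shows "\<exists>Q>0. \<forall>x\<in>K. \<forall>y\<in>K.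
    (\<Sum>j<Q. ln (D 1 ((h ^^ j) x))) - (\<Sum>j<Q. ln (D (-1) ((h ^^ j) y))) \<le> \<epsilon> * real Q"
proof -
  have "(\<lambda>Q. \<integral>z. oscillation Q (cell_index Q z) \<partial>\<nu>) \<longlonglongrightarrow> (\<integral>z. 0 \<partial>\<nu>)"
  proof (rule integral_dominated_convergence[where w = "\<lambda>_. 2 * ln L"])
    show "AE z in \<nu>. (\<lambda>Q. oscillation Q (cell_index Q z)) \<longlonglongrightarrow> 0"
      using reg AE_K AE_not_gap_end by eventually_elim (rule oscillation_tendsto, auto)
    show "AE z in \<nu>. norm (oscillation Q (cell_index Q z)) \<le> 2 * ln L" for Q
      using AE_K by eventually_elim (use oscillation_bounds in auto)
    show "(\<lambda>z. oscillation Q (cell_index Q z)) \<in> borel_measurable \<nu>" for Q by (rule measurable_\<nu>[OF oscillation_measurable])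
  qed auto
  then have "(\<lambda>Q. \<integral>z. oscillation Q (cell_index Q z) \<partial>\<nu>) \<longlonglongrightarrow> 0" by simp
  from LIMSEQ_D[OF this \<epsilon>] obtain N where N: "\<And>Q. Q \<ge> N \<Longrightarrow> (\<integral>z. oscillation Q (cell_index Q z) \<partial>\<nu>) < \<epsilon>" by force
  have "infinite (approx_set \<rho>)" using irrational rational_iff_finite_approx_set by blast
  from infinite_approx_set[OF this, of "int N"] obtain p k where pk: "(p, k) \<in> approx_set \<rho>" "int N < k" by blast
  then have k: "k > 0" "coprime p k" "\<bar>\<rho> - of_int p / of_int k\<bar> < 1 / (of_int k)\<^sup>2"
    by (auto simp: approx_set_def)
  define Q where "Q = nat k"
  have Qk: "k = int Q" using k by (simp add: Q_def)
  have Q: "Q > 0" "coprime p (int Q)" "N \<le> Q" using k pk Qk by auto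
  have app: "\<bar>real Q * \<rho> - of_int p\<bar> < 1 / real Q"
  proof -
    have "real Q * \<bar>\<rho> - of_int p / real Q\<bar> < real Q * (1 / (real Q)\<^sup>2)"
      using k(3) Qk Q(1) by (intro mult_strict_left_mono) auto
    moreover have "real Q * \<bar>\<rho> - of_int p / real Q\<bar> = \<bar>real Q * \<rho> - of_int p\<bar>"
      using Q(1) by (simp add: abs_mult_pos' right_diff_distrib)
    ultimately show ?thesis using Q(1) by (simp add: power2_eq_square)
  qed
  show ?thesis
  proof (intro exI[of _ Q] conjI ballI Q(1))
    fix x y assume x: "x \<in> K" and y: "y \<in> K"
    have "(\<Sum>j<Q. ln (D 1 ((h ^^ j) x))) - (\<Sum>j<Q. ln (D (-1) ((h ^^ j) y)))
      \<le> (\<Sum>i<Q. cell_sup Q 1 (int i)) - (\<Sum>i<Q. cell_inf Q 1 (int i))"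
      by (intro diff_mono block_upper[OF x Q(1,2) app] block_lower[OF y Q(1,2) app])
    also have "\<dots> = (\<Sum>i<Q. cell_sup Q 1 (int i) - cell_inf Q 1 (int i))" by (simp add: sum_subtractf)
    also have "\<dots> \<le> real Q * (\<integral>z. oscillation Q (cell_index Q z) \<partial>\<nu>)" by (rule block_oscillation_integral[OF Q(1,2) app])
    also have "\<dots> \<le> real Q * \<epsilon>" using N[OF Q(3)] by (intro mult_left_mono) auto
    finally show "(\<Sum>j<Q. ln (D 1 ((h ^^ j) x))) - (\<Sum>j<Q. ln (D (-1) ((h ^^ j) y))) \<le> \<epsilon> * real Q"
      by (simp add: mult.commute)
  qed
qed

end

section \<open>No iterate contracts uniformly\<close>

context invariant_graph
begin

text \<open>
  Take \<open>m + 1\<close> points of \<open>K\<close> in an open unit interval, with \<open>1 / m < \<delta>\<close>. For every \<open>k\<close>, two of their preimages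
  under \<open>G ^^ k\<close> are closer than \<open>1 / m\<close>. Applying the contraction \<open>k\<close> times, two of the original points
  have distance at most \<open>\<theta>\<^sup>k \<delta>\<close>, which is absurd for large \<open>k\<close>.
\<close>

lemma no_uniform_contraction:
  assumes bij: "bij G" and mono: "strict_mono G" and shift: "\<And>t. G (t + 1) = G t + 1"
    and GK: "\<And>t. G t \<in> K \<longleftrightarrow> t \<in> K" and \<theta>: "0 \<le> \<theta>" "\<theta> < 1" and \<delta>: "\<delta> > 0"
    and contr: "\<And>u v. u \<in> K \<Longrightarrow> v \<in> K \<Longrightarrow> \<bar>u - v\<bar> < \<delta> \<Longrightarrow> \<bar>G u - G v\<bar> \<le> \<theta> * \<bar>u - v\<bar>"
  shows False
proof -
  obtain m :: nat where m: "1 / \<delta> < real m" using reals_Archimedean2 by blast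
  have m0: "real m > 0" using m \<delta> by (meson divide_pos_pos less_trans zero_less_one)
  have m\<delta>: "1 / real m < \<delta>" using m m0 \<delta> by (simp add: field_simps)
  obtain t0 where t0: "t0 \<in> K" using K_nonempty by blast
  have "infinite (K \<inter> ball t0 (1/2))"
    using K_islimpt[OF t0] unfolding islimpt_eq_infinite_ball by simp
  then obtain P where P: "finite P" "card P = Suc m" "P \<subseteq> K \<inter> ball t0 (1/2)"
    using infinite_arbitrarily_large by metis
  define W where "W = (\<lambda>(x, y). \<bar>x - y\<bar>) ` (P \<times> P - Id)"
  have "finite W" using P(1) by (simp add: W_def)
  then obtain dd where dd: "dd > 0" "\<And>x y. x \<in> P \<Longrightarrow> y \<in> P \<Longrightarrow> x \<noteq> y \<Longrightarrow> dd \<le> \<bar>x - y\<bar>"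
  proof -
    assume that: "\<And>dd. 0 < dd \<Longrightarrow> (\<And>x y. x \<in> P \<Longrightarrow> y \<in> P \<Longrightarrow> x \<noteq> y \<Longrightarrow> dd \<le> \<bar>x - y\<bar>) \<Longrightarrow> thesis"
    have "Min (insert 1 W) > 0" using \<open>finite W\<close> by (auto simp: W_def)
    moreover have "Min (insert 1 W) \<le> \<bar>x - y\<bar>" if "x \<in> P" "y \<in> P" "x \<noteq> y" for x y
      using \<open>finite W\<close> that by (intro Min_le) (auto simp: W_def)
    ultimately show thesis by (rule that)
  qed
  have iterK: "(G ^^ k) t \<in> K \<longleftrightarrow> t \<in> K" for k t
    by (induction k) (auto simp: GK)
  have iter_mono: "strict_mono (G ^^ k)" for k
    using mono by (induction k) (auto simp: strict_mono_def)
  have iter_shift: "(G ^^ k) (t + 1) = (G ^^ k) t + 1" for k t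
    by (induction k) (auto simp: shift)
  have contr_iter: "\<bar>(G ^^ k) u - (G ^^ k) v\<bar> \<le> \<theta> ^ k * \<bar>u - v\<bar>" if "u \<in> K" "v \<in> K" "\<bar>u - v\<bar> < \<delta>" for k u v
  proof (induction k)
    case (Suc k)
    have "\<theta> ^ k * \<bar>u - v\<bar> \<le> 1 * \<bar>u - v\<bar>" using \<theta> by (intro mult_right_mono power_le_one) auto
    then have "\<theta> ^ k * \<bar>u - v\<bar> < \<delta>" using that(3) by (simp only: mult_1_left)
    with Suc have "\<bar>(G ^^ k) u - (G ^^ k) v\<bar> < \<delta>" by (rule le_less_trans)
    then have "\<bar>(G ^^ Suc k) u - (G ^^ Suc k) v\<bar> \<le> \<theta> * \<bar>(G ^^ k) u - (G ^^ k) v\<bar>"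
      using contr[of "(G ^^ k) u" "(G ^^ k) v"] that iterK by simp
    also have "\<dots> \<le> \<theta> * (\<theta> ^ k * \<bar>u - v\<bar>)" using Suc \<theta>(1) by (rule mult_left_mono)
    finally show ?case by simp
  qed simp
  have close: "\<exists>x\<in>P. \<exists>y\<in>P. x \<noteq> y \<and> \<bar>x - y\<bar> \<le> \<theta> ^ k * \<delta>" for k
  proof -
    define I where "I = inv (G ^^ k)"
    have bijk: "bij (G ^^ k)" using bij by simp
    have GI: "(G ^^ k) (I x) = x" for x using bijk by (simp add: I_def bij_def surj_f_inv_f)
    have I_mono: "x < y \<Longrightarrow> I x < I y" for x y
      using strict_mono_less[OF iter_mono, of k "I x" "I y"] GI by simp
    have I_shift: "I (x + 1) = I x + 1" for x
      using bij_is_inj[OF bijk] iter_shift[of k "I x"] GI by (metis I_def inv_f_f)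
    define c0 where "c0 = I (t0 - 1/2)"
    (* \<open>m + 1\<close> points of a unit interval: two of them share one of the \<open>m\<close> subintervals of length \<open>1/m\<close>. *)
    define r where "r x = nat \<lfloor>real m * (I x - c0)\<rfloor>" for x
    have rng: "0 < I x - c0 \<and> I x - c0 < 1" if "x \<in> P" for x
    proof -
      have "x \<in> ball t0 (1/2)" using that P(3) by blast
      then have "\<bar>t0 - x\<bar> < 1/2" by (simp add: dist_real_def)
      then have "t0 - 1/2 < x" "x < (t0 - 1/2) + 1" by linarith+
      from I_mono[OF this(1)] I_mono[OF this(2)] show ?thesis unfolding c0_def I_shift by linarith
    qed
    have nn: "0 \<le> real m * (I x - c0)" if "x \<in> P" for x using rng[OF that] by simp
    have "r ` P \<subseteq> {..<m}"
    proof
      fix n assume "n \<in> r ` P"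
      then obtain x where x: "x \<in> P" "n = r x" by blast
      have "real m * (I x - c0) < real m * 1" using rng[OF x(1)] m0 by (intro mult_strict_left_mono) auto
      then have "\<lfloor>real m * (I x - c0)\<rfloor> < int m" by (simp add: floor_less_iff)
      moreover have "0 \<le> \<lfloor>real m * (I x - c0)\<rfloor>" using nn[OF x(1)] by simp
      ultimately show "n \<in> {..<m}" using x(2) by (simp add: r_def nat_less_iff)
    qed
    then have "card (r ` P) \<le> m" using card_mono[of "{..<m}" "r ` P"] by simp
    then have "\<not> inj_on r P" using P(2) card_image[of r P] by force
    then obtain x y where xy: "x \<in> P" "y \<in> P" "x \<noteq> y" "r x = r y" unfolding inj_on_def by blast
    have "0 \<le> \<lfloor>real m * (I x - c0)\<rfloor>" "0 \<le> \<lfloor>real m * (I y - c0)\<rfloor>" using nn xy by auto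
    then have "\<lfloor>real m * (I x - c0)\<rfloor> = \<lfloor>real m * (I y - c0)\<rfloor>"
      using xy(4) unfolding r_def by (simp only: eq_nat_nat_iff)
    then have "\<bar>real m * (I x - c0) - real m * (I y - c0)\<bar> < 1"
      using floor_correct[of "real m * (I x - c0)"] floor_correct[of "real m * (I y - c0)"] by linarith
    then have "real m * \<bar>I x - I y\<bar> < 1"
      using m0 by (simp add: abs_mult_pos' right_diff_distrib)
    then have "\<bar>I x - I y\<bar> < 1 / real m" using m0 by (simp add: less_divide_eq mult.commute)
    then have lt: "\<bar>I x - I y\<bar> < \<delta>" using m\<delta> by (rule less_trans)
    have "I x \<in> K" "I y \<in> K" using iterK[of k "I x"] iterK[of k "I y"] GI xy P(3) by auto
    from contr_iter[OF this lt, of k] have "\<bar>x - y\<bar> \<le> \<theta> ^ k * \<bar>I x - I y\<bar>" by (simp add: GI)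
    also have "\<dots> \<le> \<theta> ^ k * \<delta>" using lt \<theta> by (intro mult_left_mono) auto
    finally show ?thesis using xy by blast
  qed
  obtain k where k: "\<theta> ^ k < dd / \<delta>"
    using real_arch_pow_inv[of "dd / \<delta>" \<theta>] dd(1) \<delta> \<theta>(2) by auto
  then have "\<theta> ^ k * \<delta> < dd" using \<delta> by (simp add: field_simps)
  moreover obtain x y where "x \<in> P" "y \<in> P" "x \<noteq> y" "\<bar>x - y\<bar> \<le> \<theta> ^ k * \<delta>" using close by blast
  ultimately show False using dd(2)[of x y] by linarith
qed

lemma eventually_pairs_h_iter:
  "eventually P (pairs ((h ^^ n) t)) \<longleftrightarrow> eventually (\<lambda>p. P (map_prod (h ^^ n) (h ^^ n) p)) (pairs t)"
proof (induction n arbitrary: P)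
  case (Suc n)
  have "eventually P (pairs ((h ^^ Suc n) t)) \<longleftrightarrow> eventually (\<lambda>p. P (map_prod h h p)) (pairs ((h ^^ n) t))"
    by (simp add: eventually_pairs_h)
  also have "\<dots> \<longleftrightarrow> eventually (\<lambda>p. P (map_prod h h (map_prod (h ^^ n) (h ^^ n) p))) (pairs t)"
    by (rule Suc)
  finally show ?case by (simp add: map_prod_def case_prod_unfold)
qed (simp add: map_prod_def)

text \<open>
  Lebesgue's covering lemma on the part of \<open>K\<close> in a fundamental domain.
\<close>

lemma eventually_pairs_uniform:
  assumes ev: "\<And>t. t \<in> K \<Longrightarrow> eventually P (pairs t)"
    and per: "\<And>u v k. P (u + of_int k, v + of_int k) \<longleftrightarrow> P (u, v)"
  shows "\<exists>\<delta>>0. \<forall>u\<in>K. \<forall>v\<in>K. u \<noteq> v \<and> \<bar>u - v\<bar> < \<delta> \<longrightarrow> P (u, v)"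
proof -
  have "\<forall>t\<in>K. \<exists>\<delta>>0. \<forall>u\<in>K. \<forall>v\<in>K. u \<noteq> v \<and> \<bar>u - t\<bar> < \<delta> \<and> \<bar>v - t\<bar> < \<delta> \<longrightarrow> P (u, v)"
    using ev unfolding eventually_pairs by blast
  then obtain r where r: "\<And>t. t \<in> K \<Longrightarrow> r t > 0"
    "\<And>t u v. t \<in> K \<Longrightarrow> u \<in> K \<Longrightarrow> v \<in> K \<Longrightarrow> u \<noteq> v \<Longrightarrow> \<bar>u - t\<bar> < r t \<Longrightarrow> \<bar>v - t\<bar> < r t \<Longrightarrow> P (u, v)"
    by metis
  have "compact (K \<inter> {0..1})" using closed_K by (simp add: closed_Int_compact)
  moreover have "K \<inter> {0..1} \<subseteq> \<Union> ((\<lambda>t. ball t (r t)) ` K)" using r(1) by force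
  moreover have "\<And>G. G \<in> (\<lambda>t. ball t (r t)) ` K \<Longrightarrow> open G" by auto
  ultimately obtain e where e: "e > 0" "\<And>x. x \<in> K \<inter> {0..1} \<Longrightarrow> \<exists>G\<in>(\<lambda>t. ball t (r t)) ` K. ball x e \<subseteq> G"
    by (rule Heine_Borel_lemma) (assumption, erule that)
  have "P (u, v)" if uv: "u \<in> K" "v \<in> K" "u \<noteq> v" "\<bar>u - v\<bar> < e" for u v
  proof -
    let ?k = "- \<lfloor>u\<rfloor>"
    define u' v' where "u' = u + of_int ?k" and "v' = v + of_int ?k"
    have "u' = frac u" unfolding u'_def by (simp add: frac_def)
    then have "u' \<in> {0..1}" using frac_ge_0[of u] frac_lt_1[of u] by simp
    moreover have K': "u' \<in> K" "v' \<in> K" using uv K_int_shift[of _ ?k] by (simp_all only: u'_def v'_def)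
    ultimately obtain t where t: "t \<in> K" "ball u' e \<subseteq> ball t (r t)" using e(2)[of u'] by blast
    have "u' \<in> ball u' e" "v' \<in> ball u' e" using e(1) uv by (auto simp: dist_real_def u'_def v'_def)
    then have "u' \<in> ball t (r t)" "v' \<in> ball t (r t)" using t by blast+
    then have "P (u', v')" using r(2)[OF t(1) K'] uv(3) by (simp add: dist_real_def u'_def v'_def abs_minus_commute)
    then show ?thesis unfolding u'_def v'_def per .
  qed
  then show ?thesis using e(1) by blast
qed

lemma slope_iter:
  assumes "fst p \<noteq> snd p"
  shows "slope (h ^^ n) p = (\<Prod>j<n. slope h (map_prod (h ^^ j) (h ^^ j) p))"
proof (induction n)
  case (Suc n)
  have "(h ^^ n) (fst p) \<noteq> (h ^^ n) (snd p)"
    using assms strict_mono_eq[OF h_iter_mono] by simp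
  then have "slope (h ^^ Suc n) p = slope (h ^^ n) p * slope h (map_prod (h ^^ n) (h ^^ n) p)"
    by (simp add: slope_def)
  then show ?case using Suc by (simp only: prod.lessThan_Suc)
qed (use assms in \<open>simp add: slope_def\<close>)

lemma slope_pos: "fst p \<noteq> snd p \<Longrightarrow> 0 < slope h p"
  using slope_h_bounds(1)[of "fst p" "snd p"] L_pos by (metis less_le_trans prod.collapse zero_less_divide_1_iff)

lemma ln_slope_eventually:
  assumes t: "t \<in> K" and \<sigma>: "\<sigma> = 1 \<or> \<sigma> = - 1" and e: "e > 0"
  shows "eventually (\<lambda>p. \<sigma> * ln (slope h p) \<le> \<sigma> * ln (D \<sigma> t) + e) (pairs t)"
proof -
  have D: "D \<sigma> t > 0" by (rule D_pos[OF t \<sigma>])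
  \<comment> \<open>Chosen such that \<open>\<sigma> D + e' = \<sigma> D exp (\<sigma> e)\<close>, so that the logarithm changes by exactly \<open>\<sigma> e\<close>.\<close>
  define e' where "e' = \<sigma> * D \<sigma> t * (exp (\<sigma> * e) - 1)"
  have "0 < D \<sigma> t * (1 - exp (- e))" "0 < D \<sigma> t * (exp e - 1)" using D e by simp_all
  then have e': "e' > 0" using \<sigma> by (auto simp: e'_def algebra_simps)
  have ne: "eventually (\<lambda>p. fst p \<noteq> snd p) (pairs t)"
    unfolding eventually_pairs by (intro exI[of _ 1]) auto
  show ?thesis
    using extreme_limit_eventually[OF t bounded_slope_h \<sigma> e'] ne
  proof eventually_elim
    case (elim p)
    have "\<sigma> * slope h p < \<sigma> * (D \<sigma> t * exp (\<sigma> * e))"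
      using elim(1) by (simp add: e'_def algebra_simps)
    then have "\<sigma> * ln (slope h p) \<le> \<sigma> * ln (D \<sigma> t * exp (\<sigma> * e))"
      using \<sigma> slope_pos[OF elim(2)] D by auto
    also have "\<dots> = \<sigma> * ln (D \<sigma> t) + \<sigma> * \<sigma> * e" using D by (simp add: ln_mult algebra_simps)
    finally show ?case using \<sigma> by auto
  qed
qed

lemma ln_slope_iter_eventually:
  assumes t: "t \<in> K" and \<sigma>: "\<sigma> = 1 \<or> \<sigma> = - 1" and e: "e > 0"
  shows "eventually (\<lambda>p. fst p \<noteq> snd p \<longrightarrow> \<sigma> * ln (slope (h ^^ n) p) \<le> \<sigma> * (\<Sum>j<n. ln (D \<sigma> ((h ^^ j) t))) + e) (pairs t)"
proof -
  define e' where "e' = e / (real n + 1)"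
  have e': "e' > 0" using e by (simp add: e'_def)
  have "eventually (\<lambda>p. \<forall>j\<in>{..<n}. \<sigma> * ln (slope h (map_prod (h ^^ j) (h ^^ j) p)) \<le> \<sigma> * ln (D \<sigma> ((h ^^ j) t)) + e') (pairs t)"
    unfolding eventually_ball_finite_distrib[OF finite_lessThan]
  proof
    fix j
    have "eventually (\<lambda>p. \<sigma> * ln (slope h p) \<le> \<sigma> * ln (D \<sigma> ((h ^^ j) t)) + e') (pairs ((h ^^ j) t))"
      by (rule ln_slope_eventually[OF _ \<sigma> e']) (simp add: h_iter_K t)
    then show "eventually (\<lambda>p. \<sigma> * ln (slope h (map_prod (h ^^ j) (h ^^ j) p)) \<le> \<sigma> * ln (D \<sigma> ((h ^^ j) t)) + e') (pairs t)"
      unfolding eventually_pairs_h_iter .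
  qed
  then show ?thesis
  proof eventually_elim
    case (elim p)
    show ?case
    proof
      assume p: "fst p \<noteq> snd p"
      have "(h ^^ j) (fst p) \<noteq> (h ^^ j) (snd p)" for j
        using p strict_mono_eq[OF h_iter_mono] by simp
      then have pos: "0 < slope h (map_prod (h ^^ j) (h ^^ j) p)" for j
        by (intro slope_pos) simp
      have "\<sigma> * ln (slope (h ^^ n) p) = (\<Sum>j<n. \<sigma> * ln (slope h (map_prod (h ^^ j) (h ^^ j) p)))"
        unfolding slope_iter[OF p] sum_distrib_left[symmetric]
        by (subst ln_prod) (use pos in \<open>auto simp: less_imp_neq[symmetric]\<close>)
      also have "\<dots> \<le> (\<Sum>j<n. \<sigma> * ln (D \<sigma> ((h ^^ j) t)) + e')" using elim by (intro sum_mono) auto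
      also have "\<dots> = \<sigma> * (\<Sum>j<n. ln (D \<sigma> ((h ^^ j) t))) + real n * e'"
        by (simp add: sum.distrib sum_distrib_left)
      also have "real n * e' \<le> e" using e by (simp add: e'_def field_simps)
      finally show "\<sigma> * ln (slope (h ^^ n) p) \<le> \<sigma> * (\<Sum>j<n. ln (D \<sigma> ((h ^^ j) t))) + e" by simp
    qed
  qed
qed

lemma slope_iter_pos: "u \<noteq> v \<Longrightarrow> 0 < slope (h ^^ n) (u, v)"
  using strict_mono_less[OF h_iter_mono, of n] 
  by (cases u v rule: linorder_cases) (auto simp: slope_def divide_neg_neg)

lemma abs_diff_slope:
  assumes "0 < slope q (u, v)" "u \<noteq> v"
  shows "\<bar>q u - q v\<bar> = slope q (u, v) * \<bar>u - v\<bar>"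
proof -
  have "q u - q v = slope q (u, v) * (u - v)" using assms(2) by (simp add: slope_def)
  then show ?thesis using assms(1) by (simp only: abs_mult abs_of_pos)
qed

lemma ln_slope_iter_uniform:
  assumes \<sigma>: "\<sigma> = 1 \<or> \<sigma> = - 1" and \<eta>: "\<eta> > 0"
    and sums: "\<And>t. t \<in> K \<Longrightarrow> \<sigma> * (\<Sum>j<n. ln (D \<sigma> ((h ^^ j) t))) \<le> - \<eta>"
  obtains \<delta> where "\<delta> > 0"
    "\<And>u v. u \<in> K \<Longrightarrow> v \<in> K \<Longrightarrow> u \<noteq> v \<Longrightarrow> \<bar>u - v\<bar> < \<delta> \<Longrightarrow> \<sigma> * ln (slope (h ^^ n) (u, v)) \<le> - (\<eta> / 2)"
proof -
  have "\<exists>\<delta>>0. \<forall>u\<in>K. \<forall>v\<in>K. u \<noteq> v \<and> \<bar>u - v\<bar> < \<delta> \<longrightarrow>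
     (fst (u, v) \<noteq> snd (u, v) \<longrightarrow> \<sigma> * ln (slope (h ^^ n) (u, v)) \<le> - (\<eta> / 2))"
  proof (rule eventually_pairs_uniform[where P = "\<lambda>p. fst p \<noteq> snd p \<longrightarrow> \<sigma> * ln (slope (h ^^ n) p) \<le> - (\<eta> / 2)"])
    fix t assume t: "t \<in> K"
    have "eventually (\<lambda>p. fst p \<noteq> snd p \<longrightarrow> \<sigma> * ln (slope (h ^^ n) p) \<le> \<sigma> * (\<Sum>j<n. ln (D \<sigma> ((h ^^ j) t))) + \<eta> / 2) (pairs t)"
      using ln_slope_iter_eventually[OF t \<sigma>, of "\<eta> / 2" n] \<eta> by simp
    then show "eventually (\<lambda>p. fst p \<noteq> snd p \<longrightarrow> \<sigma> * ln (slope (h ^^ n) p) \<le> - (\<eta> / 2)) (pairs t)"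
      by (rule eventually_mono) (use sums[OF t] in auto)
  qed (simp add: slope_def h_iter_int_shift)
  then show thesis using that by auto
qed

text \<open>
  Otherwise \<open>h ^^ n\<close> would be a uniform contraction of \<open>K\<close>.
\<close>

lemma sum_upper_nonneg:
  assumes \<eta>: "\<eta> > 0"
  shows "\<exists>x\<in>K. - \<eta> < (\<Sum>j<n. ln (D 1 ((h ^^ j) x)))"
proof (rule ccontr)
  assume "\<not> ?thesis"
  then have "\<And>t. t \<in> K \<Longrightarrow> 1 * (\<Sum>j<n. ln (D 1 ((h ^^ j) t))) \<le> - \<eta>" by (auto simp: not_less)
  from ln_slope_iter_uniform[OF _ \<eta> this] obtain \<delta> where \<delta>: "\<delta> > 0"
    "\<And>u v. u \<in> K \<Longrightarrow> v \<in> K \<Longrightarrow> u \<noteq> v \<Longrightarrow> \<bar>u - v\<bar> < \<delta> \<Longrightarrow> 1 * ln (slope (h ^^ n) (u, v)) \<le> - (\<eta> / 2)" by auto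
  show False
  proof (rule no_uniform_contraction[of "h ^^ n" "exp (- (\<eta> / 2))" \<delta>])
    fix u v assume uv: "u \<in> K" "v \<in> K" "\<bar>u - v\<bar> < \<delta>"
    show "\<bar>(h ^^ n) u - (h ^^ n) v\<bar> \<le> exp (- (\<eta> / 2)) * \<bar>u - v\<bar>"
    proof (cases "u = v")
      case False
      have "ln (slope (h ^^ n) (u, v)) \<le> - (\<eta> / 2)" using \<delta>(2)[OF uv(1,2) False uv(3)] by simp
      then have le: "slope (h ^^ n) (u, v) \<le> exp (- (\<eta> / 2))"
        using slope_iter_pos[OF False, of n] by (metis exp_le_cancel_iff exp_ln)
      have "\<bar>(h ^^ n) u - (h ^^ n) v\<bar> = slope (h ^^ n) (u, v) * \<bar>u - v\<bar>"
        by (rule abs_diff_slope[OF slope_iter_pos[OF False] False])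
      then show ?thesis using le by (simp add: mult_right_mono)
    qed simp
  qed (use h_bij h_iter_mono h_iter_int_shift[of n _ 1] h_iter_K \<delta> \<eta> in auto)
qed

text \<open>
  Otherwise \<open>h ^^ n\<close> would expand \<open>K\<close> uniformly, and its inverse would be a uniform contraction.
\<close>

lemma sum_lower_nonpos:
  assumes \<eta>: "\<eta> > 0"
  shows "\<exists>x\<in>K. (\<Sum>j<n. ln (D (-1) ((h ^^ j) x))) < \<eta>"
proof (rule ccontr)
  assume "\<not> ?thesis"
  then have "\<And>t. t \<in> K \<Longrightarrow> (- 1) * (\<Sum>j<n. ln (D (-1) ((h ^^ j) t))) \<le> - \<eta>" by (auto simp: not_less)
  from ln_slope_iter_uniform[OF _ \<eta> this] obtain \<delta> where \<delta>: "\<delta> > 0"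
    "\<And>u v. u \<in> K \<Longrightarrow> v \<in> K \<Longrightarrow> u \<noteq> v \<Longrightarrow> \<bar>u - v\<bar> < \<delta> \<Longrightarrow> (- 1) * ln (slope (h ^^ n) (u, v)) \<le> - (\<eta> / 2)" by auto
  define G where "G = inv (h ^^ n)"
  have bij: "bij (h ^^ n)" using h_bij by simp
  have hG: "(h ^^ n) (G x) = x" for x using bij by (simp add: G_def bij_def surj_f_inv_f)
  have Ln: "L ^ n > 0" using L_pos by simp
  show False
  \<comment> \<open>The inverse is Lipschitz with constant \<open>L ^ n\<close>, so points closer than \<open>\<delta> / L ^ n\<close> have preimages
    to which the expansion estimate applies.\<close>
  proof (rule no_uniform_contraction[of G "exp (- (\<eta> / 2))" "\<delta> / L ^ n"])
    show "bij G" using bij by (simp add: G_def bij_imp_bij_inv)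
    show "strict_mono G"
      by (rule strict_monoI) (use strict_mono_less[OF h_iter_mono, of n] hG in metis)
    show "G (t + 1) = G t + 1" for t
      using bij_is_inj[OF bij] h_iter_int_shift[of n "G t" 1] hG by (metis G_def inv_f_f of_int_1)
    show "G t \<in> K \<longleftrightarrow> t \<in> K" for t using h_iter_K[of n "G t"] hG by simp
    fix u v assume uv: "u \<in> K" "v \<in> K" "\<bar>u - v\<bar> < \<delta> / L ^ n"
    show "\<bar>G u - G v\<bar> \<le> exp (- (\<eta> / 2)) * \<bar>u - v\<bar>"
    proof (cases "u = v")
      case False
      have ne: "G u \<noteq> G v" using False hG by metis
      have GK: "G u \<in> K" "G v \<in> K" using uv h_iter_K[of n "G u"] h_iter_K[of n "G v"] hG by simp_all
      have "\<bar>G u - G v\<bar> \<le> L ^ n * \<bar>u - v\<bar>" using h_iter_lower[of "G u" "G v" n] by (simp add: hG)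
      also have "\<dots> < \<delta>" using uv(3) Ln by (simp add: field_simps)
      finally have "\<eta> / 2 \<le> ln (slope (h ^^ n) (G u, G v))" using \<delta>(2)[OF GK ne] by simp
      then have le: "exp (\<eta> / 2) \<le> slope (h ^^ n) (G u, G v)"
        using slope_iter_pos[OF ne, of n] by (metis exp_le_cancel_iff exp_ln)
      have "\<bar>u - v\<bar> = slope (h ^^ n) (G u, G v) * \<bar>G u - G v\<bar>"
        using abs_diff_slope[OF slope_iter_pos[OF ne, of n] ne] by (simp only: hG)
      then have "exp (\<eta> / 2) * \<bar>G u - G v\<bar> \<le> \<bar>u - v\<bar>" using le by (simp add: mult_right_mono)
      then show ?thesis by (simp add: exp_minus field_simps)
    qed simp
  qed (use \<delta> \<eta> Ln in auto)
qed

lemma sum_lessThan_plus: "(\<Sum>j<Q + m. F j) = (\<Sum>j<Q. F j) + (\<Sum>j<m. F (Q + j))" for F :: "nat \<Rightarrow> real"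
  by (induction m) (simp_all add: add.assoc)

lemma sum_block_bound:
  assumes Q: "Q > 0" and \<epsilon>: "\<epsilon> \<ge> 0" and M: "M \<ge> 0" "\<And>t. t \<in> K \<Longrightarrow> \<phi> t \<le> M"
    and block: "\<And>t. t \<in> K \<Longrightarrow> (\<Sum>j<Q. \<phi> ((h ^^ j) t)) \<le> \<epsilon> * real Q"
  shows "t \<in> K \<Longrightarrow> (\<Sum>j<n. \<phi> ((h ^^ j) t)) \<le> \<epsilon> * real n + real Q * M"
proof (induction n arbitrary: t rule: less_induct)
  case (less n)
  show ?case
  proof (cases "n < Q")
    case True
    have "(\<Sum>j<n. \<phi> ((h ^^ j) t)) \<le> (\<Sum>j<n. M)" by (intro sum_mono M(2)) (simp add: h_iter_K less.prems)
    also have "\<dots> \<le> real Q * M" using True M(1) by (simp add: mult_right_mono)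
    finally show ?thesis using \<epsilon> by (simp add: add_increasing)
  next
    case False
    then have n: "n = Q + (n - Q)" by simp
    have "(\<Sum>j<n. \<phi> ((h ^^ j) t)) = (\<Sum>j<Q. \<phi> ((h ^^ j) t)) + (\<Sum>j<n - Q. \<phi> ((h ^^ (Q + j)) t))"
      using sum_lessThan_plus[of "\<lambda>j. \<phi> ((h ^^ j) t)" Q "n - Q"] n by simp
    also have "(\<Sum>j<n - Q. \<phi> ((h ^^ (Q + j)) t)) = (\<Sum>j<n - Q. \<phi> ((h ^^ j) ((h ^^ Q) t)))"
      by (simp add: add.commute[of Q] funpow_add)
    also have "\<dots> \<le> \<epsilon> * real (n - Q) + real Q * M"
      by (rule less.IH) (use False Q less.prems in \<open>auto simp: h_iter_K\<close>)
    also have "(\<Sum>j<Q. \<phi> ((h ^^ j) t)) \<le> \<epsilon> * real Q" by (rule block[OF less.prems])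
    finally show ?thesis using False by (simp add: of_nat_diff algebra_simps)
  qed
qed

end

section \<open>Regularity forces zero exponents\<close>

context irrational_graph
begin

text \<open>
  By \<open>small_block\<close> all upper sums exceed all lower sums by at most \<open>\<epsilon> Q / 2\<close>, and by \<open>sum_upper_nonneg\<close> and
  \<open>sum_lower_nonpos\<close> neither family stays away from \<open>0\<close> on the wrong side.
\<close>

lemma birkhoff_block:
  assumes reg: "AE t in \<nu>. S 1 t = S (-1) t" and \<epsilon>: "\<epsilon> > 0"
  shows "\<exists>Q>0. \<forall>x\<in>K. (\<Sum>j<Q. ln (D 1 ((h ^^ j) x))) \<le> \<epsilon> * real Q
    \<and> (\<Sum>j<Q. - ln (D (-1) ((h ^^ j) x))) \<le> \<epsilon> * real Q"
proof -
  obtain Q where Q: "Q > 0" "\<And>x y. x \<in> K \<Longrightarrow> y \<in> K \<Longrightarrow>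
    (\<Sum>j<Q. ln (D 1 ((h ^^ j) x))) - (\<Sum>j<Q. ln (D (-1) ((h ^^ j) y))) \<le> \<epsilon> / 2 * real Q"
    using small_block[OF reg, of "\<epsilon> / 2"] \<epsilon> by auto
  have \<eta>: "\<epsilon> / 2 * real Q > 0" using Q(1) \<epsilon> by simp
  obtain x0 where x0: "x0 \<in> K" "- (\<epsilon> / 2 * real Q) < (\<Sum>j<Q. ln (D 1 ((h ^^ j) x0)))"
    using sum_upper_nonneg[OF \<eta>, of Q] by blast
  obtain y0 where y0: "y0 \<in> K" "(\<Sum>j<Q. ln (D (-1) ((h ^^ j) y0))) < \<epsilon> / 2 * real Q"
    using sum_lower_nonpos[OF \<eta>, of Q] by blast
  show ?thesis
  proof (intro exI[of _ Q] conjI ballI Q(1))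
    fix x assume x: "x \<in> K"
    show "(\<Sum>j<Q. ln (D 1 ((h ^^ j) x))) \<le> \<epsilon> * real Q"
      using Q(2)[OF x y0(1)] y0(2) by (simp add: field_simps)
    show "(\<Sum>j<Q. - ln (D (-1) ((h ^^ j) x))) \<le> \<epsilon> * real Q"
      using Q(2)[OF x0(1) x] x0(2) by (simp add: sum_negf field_simps)
  qed
qed

lemma regular_orbit:
  assumes "t \<in> K" "S 1 t = S (-1) t"
  shows "S 1 ((h ^^ n) t) = S (-1) ((h ^^ n) t)"
proof (induction n)
  case (Suc n)
  have tK: "(h ^^ n) t \<in> K" using assms by (simp add: h_iter_K)
  have "D 1 ((h ^^ n) t) = D (-1) ((h ^^ n) t)"
    using D_eq[OF tK, of 1] D_eq[OF tK, of "-1"] Suc by simp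
  then show ?case
    using S_equivariant[OF tK, of 1] S_equivariant[OF tK, of "-1"] D_pos[OF tK, of "-1"] Suc
    by (metis funpow.simps(2) comp_apply mult_left_cancel less_irrefl)
qed (use assms in simp)

text \<open>
  Cutting the orbit into blocks makes the logarithm of the multiplier sublinear. At a regular point the
  bounds for \<open>D 1\<close> from above and for \<open>D (- 1)\<close> from below concern the same number, along the whole orbit.
\<close>

theorem regular_imp_zero_exponents:
  assumes reg: "AE t in \<nu>. S 1 t = S (-1) t"
  shows "AE t in \<nu>. \<forall>w. w \<noteq> 0 \<longrightarrow> (\<lambda>n. ln (norm (cocycle jacobian h n t w)) / real n) \<longlonglongrightarrow> 0"
  using reg AE_K
proof eventually_elim
  case (elim t)
  then have t: "t \<in> K" by simp
  have "(\<lambda>n. ln (multiplier 1 n t) / real n) \<longlonglongrightarrow> 0"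
    unfolding sublinear_iff
  proof (intro allI impI)
    fix \<epsilon> :: real assume \<epsilon>: "\<epsilon> > 0"
    obtain Q where Q: "Q > 0" "\<And>x. x \<in> K \<Longrightarrow> (\<Sum>j<Q. ln (D 1 ((h ^^ j) x))) \<le> \<epsilon> * real Q"
      "\<And>x. x \<in> K \<Longrightarrow> (\<Sum>j<Q. - ln (D (-1) ((h ^^ j) x))) \<le> \<epsilon> * real Q"
      using birkhoff_block[OF reg \<epsilon>] by blast
    have L0: "ln L \<ge> 0" using L_ge_1 by simp
    have "\<bar>ln (multiplier 1 n t)\<bar> \<le> \<epsilon> * real n + real Q * ln L" for n
    proof -
      have "(\<Sum>j<n. ln (D 1 ((h ^^ j) t))) \<le> \<epsilon> * real n + real Q * ln L"
        using ln_D_bound[of _ 1] by (intro sum_block_bound[where \<phi> = "\<lambda>t. ln (D 1 t)", OF Q(1) _ L0 _ Q(2) t]) (use \<epsilon> in \<open>auto simp: abs_le_iff\<close>)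
      moreover have "(\<Sum>j<n. - ln (D (-1) ((h ^^ j) t))) \<le> \<epsilon> * real n + real Q * ln L"
        using ln_D_bound[of _ "-1"] by (intro sum_block_bound[where \<phi> = "\<lambda>t. - ln (D (-1) t)", OF Q(1) _ L0 _ Q(3) t]) (use \<epsilon> in \<open>auto simp: abs_le_iff\<close>)
      moreover have "D (-1) ((h ^^ j) t) = D 1 ((h ^^ j) t)" for j
        using D_eq[of "(h ^^ j) t" 1] D_eq[of "(h ^^ j) t" "-1"] regular_orbit[OF t, of j] elim h_iter_K by simp
      ultimately show ?thesis using ln_multiplier[OF t, of 1 n] by (simp add: sum_negf abs_le_iff)
    qed
    then show "\<exists>M. \<forall>n. \<bar>ln (multiplier 1 n t)\<bar> \<le> \<epsilon> * real n + M" by blast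
  qed
  then show ?case using subexponential_cocycle[OF t, of 1] by blast
qed

end

section \<open>The support of an invariant measure\<close>

definition circle_coord :: "circle \<Rightarrow> real" where
  "circle_coord x = frac (rep_circle x)"

lemma abs_circle_coord [simp]: "abs_circle (circle_coord x) = x"
proof -
  have "abs_circle (circle_coord x) = abs_circle (rep_circle x)"
    unfolding abs_circle_eq_iff circle_coord_def frac_def by simp
  then show ?thesis using Quotient3_abs_rep[OF Quotient3_circle] by simp
qed

lemma circle_coord_bounds: "0 \<le> circle_coord x" "circle_coord x < 1"
  by (simp_all add: circle_coord_def frac_lt_1)

lemma circle_coord_abs: "circle_coord (abs_circle t) = frac t"
proof -
  obtain k :: int where k: "circle_coord (abs_circle t) = t + of_int k"
    using abs_circle_eq_iff_ex abs_circle_coord by blast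
  have "frac (circle_coord (abs_circle t)) = circle_coord (abs_circle t)"
    using circle_coord_bounds by (simp add: frac_eq)
  then show ?thesis using k by (simp add: frac_def)
qed

text \<open>
  Its sublevel sets are images of compact intervals.
\<close>

lemma circle_coord_measurable [measurable]: "circle_coord \<in> borel_measurable borel"
proof (rule borel_measurableI_le)
  fix a :: real
  show "{x \<in> space borel. circle_coord x \<le> a} \<in> sets borel"
  proof (cases "a < 1")
    case True
    have "{x \<in> space borel. circle_coord x \<le> a} = abs_circle ` {0..a}"
    proof (intro equalityI subsetI)
      fix x assume "x \<in> {x \<in> space borel. circle_coord x \<le> a}"
      then show "x \<in> abs_circle ` {0..a}"
        using circle_coord_bounds(1)[of x] by (intro image_eqI[of _ _ "circle_coord x"]) auto
    next
      fix x assume "x \<in> abs_circle ` {0..a}"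
      then obtain t where t: "x = abs_circle t" "0 \<le> t" "t \<le> a" by auto
      then have "frac t = t" using True by (simp add: frac_eq)
      then show "x \<in> {x \<in> space borel. circle_coord x \<le> a}" using t by (simp add: circle_coord_abs)
    qed
    also have "\<dots> \<in> sets borel"
      by (intro borel_closed compact_imp_closed compact_continuous_image
          continuous_on_subset[OF continuous_abs_circle]) auto
    finally show ?thesis .
  next
    case False
    have "circle_coord x \<le> a" for x using circle_coord_bounds(2)[of x] False by linarith
    then have "{x \<in> space borel. circle_coord x \<le> a} = UNIV" by simp
    then show ?thesis by simp
  qed
qed

lemma closed_supp: "closed (supp \<mu>)"
proof -
  have "open (- supp \<mu>)"
  proof (subst open_subopen, intro ballI)
    fix x assume "x \<in> - supp \<mu>"
    then obtain U where U: "open U" "x \<in> U" "\<not> emeasure \<mu> U > 0" by (auto simp: supp_def)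
    then have "U \<subseteq> - supp \<mu>" by (auto simp: supp_def)
    then show "\<exists>T. open T \<and> x \<in> T \<and> T \<subseteq> - supp \<mu>" using U by blast
  qed
  then show ?thesis by (simp add: closed_def)
qed

text \<open>
  Otherwise finitely many open null sets would cover \<open>M\<close>.
\<close>

lemma supp_nonempty:
  assumes sets: "sets \<mu> = sets borel" and "compact M" and AE: "AE x in \<mu>. x \<in> M"
    and pos: "emeasure \<mu> (space \<mu>) \<noteq> 0"
  shows "supp \<mu> \<inter> M \<noteq> {}"
proof
  assume "supp \<mu> \<inter> M = {}"
  then have "\<forall>x\<in>M. \<exists>U. open U \<and> x \<in> U \<and> emeasure \<mu> U = 0"
    unfolding supp_def by (auto simp: zero_less_iff_neq_zero)
  then obtain U where U: "\<And>x. x \<in> M \<Longrightarrow> open (U x) \<and> x \<in> U x \<and> emeasure \<mu> (U x) = 0" by metis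
  obtain D where D: "D \<subseteq> M" "finite D" "M \<subseteq> (\<Union>x\<in>D. U x)"
    using compactE_image[OF \<open>compact M\<close>, of M U] U by blast
  have "(\<Union>x\<in>D. U x) \<in> null_sets \<mu>"
    using D U by (intro null_sets.finite_UN) (auto simp: null_sets_def sets borel_open subset_iff)
  then have "AE x in \<mu>. x \<notin> (\<Union>x\<in>D. U x)" by (rule AE_not_in)
  then have "AE x in \<mu>. False" using AE by eventually_elim (use D in auto)
  then show False using pos by (simp add: AE_iff_null sets.top null_sets_def)
qed

lemma supp_subset_closed:
  assumes "sets \<mu> = sets borel" "closed M" "AE x in \<mu>. x \<in> M"
  shows "supp \<mu> \<subseteq> M"
proof
  fix x assume x: "x \<in> supp \<mu>"
  show "x \<in> M"
  proof (rule ccontr)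
    assume "x \<notin> M"
    moreover have "emeasure \<mu> (- M) = 0"
    proof -
      have "{x \<in> space \<mu>. x \<notin> M} = - M"
        using sets_eq_imp_space_eq[OF assms(1)] by auto
      moreover have "- M \<in> sets \<mu>" using assms(1,2) by (simp add: borel_closed)
      ultimately show ?thesis
        using AE_E2[OF assms(3)] by simp
    qed
    ultimately show False using x assms(2) by (auto simp: supp_def open_Compl)
  qed
qed

lemma supp_image:
  assumes sets: "sets \<mu> = sets borel" and dist: "distr \<mu> borel f = \<mu>"
    and bij: "bij f" and cont: "continuous_on UNIV f" and cinv: "continuous_on UNIV (inv f)"
  shows "f ` supp \<mu> = supp \<mu>"
proof -
  have sp: "space \<mu> = UNIV" using sets_eq_imp_space_eq[OF sets] by simp
  have f: "f \<in> measurable \<mu> borel"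
    using borel_measurable_continuous_onI[OF cont] measurable_cong_sets[OF sets refl] by blast
  have em: "emeasure \<mu> U = emeasure \<mu> (f -` U)" if "open U" for U
    using emeasure_distr[OF f, of U] that by (simp add: dist sp borel_open)
  show ?thesis
  proof (intro equalityI subsetI)
    fix y assume "y \<in> f ` supp \<mu>"
    then obtain x where x: "x \<in> supp \<mu>" "y = f x" by blast
    have "emeasure \<mu> U > 0" if U: "open U" "y \<in> U" for U
    proof -
      have "open (f -` U)" using cont U(1) continuous_on_open_vimage[OF open_UNIV, of f] by auto
      then show ?thesis using x U by (auto simp: em supp_def)
    qed
    then show "y \<in> supp \<mu>" by (simp add: supp_def)
  next
    fix y assume y: "y \<in> supp \<mu>"
    have fy: "f (inv f y) = y" using bij by (simp add: bij_def surj_f_inv_f)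
    have "emeasure \<mu> U > 0" if U: "open U" "inv f y \<in> U" for U
    proof -
      have "open (inv f -` U)" using cinv U(1) continuous_on_open_vimage[OF open_UNIV, of "inv f"] by auto
      moreover have "f -` (inv f -` U) = U" using bij by (auto simp: bij_def inv_f_f)
      moreover have "emeasure \<mu> (inv f -` U) > 0" using y U calculation(1) by (auto simp: supp_def)
      ultimately show ?thesis using em[of "inv f -` U"] by simp
    qed
    then have "inv f y \<in> supp \<mu>" by (simp add: supp_def)
    then show "y \<in> f ` supp \<mu>" using fy by (metis imageI)
  qed
qed

text \<open>
  The support is itself an ordered set contained in \<open>M\<close>, so minimality of \<open>M\<close> applies.
\<close>

lemma supp_eq_Aubry_Mather_set:
  assumes AM: "Aubry_Mather_set f M" and inv: "invariant_prob_on f M \<mu>"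
    and bij: "bij f" and cont: "continuous_on UNIV f" and cinv: "continuous_on UNIV (inv f)"
  shows "supp \<mu> = M"
proof -
  have M: "M \<noteq> {}" "compact M" "f ` M = M"
    and ord: "\<And>F. is_lift f F \<Longrightarrow> \<forall>z\<in>proj -` M. \<forall>z'\<in>proj -` M. fst z < fst z' \<longleftrightarrow> fst (F z) < fst (F z')"
    and min: "\<And>N. N \<subseteq> M \<Longrightarrow> ordered_set f N \<Longrightarrow> N = M"
    using AM unfolding Aubry_Mather_set_def ordered_set_def by blast+
  have \<mu>: "sets \<mu> = sets borel" "emeasure \<mu> (space \<mu>) = 1" "distr \<mu> borel f = \<mu>" "AE x in \<mu>. x \<in> M"
    using inv unfolding invariant_prob_on_def by blast+
  have sub: "supp \<mu> \<subseteq> M" by (rule supp_subset_closed[OF \<mu>(1) compact_imp_closed[OF M(2)] \<mu>(4)])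
  have "supp \<mu> \<inter> M \<noteq> {}" by (rule supp_nonempty[OF \<mu>(1) M(2) \<mu>(4)]) (simp add: \<mu>)
  then have ne: "supp \<mu> \<noteq> {}" by blast
  have "compact (supp \<mu>)"
    using compact_Int_closed[OF M(2) closed_supp[of \<mu>]] sub by (simp add: Int_absorb1)
  moreover have "f ` supp \<mu> = supp \<mu>" by (rule supp_image[OF \<mu>(1,3) bij cont cinv])
  ultimately have "ordered_set f (supp \<mu>)"
    unfolding ordered_set_def using ne ord sub by blast
  then show ?thesis by (rule min[OF sub])
qed

section \<open>Lifts of twist maps and their derivatives\<close>

text \<open>
  The chain rule for the composition with the differentiable inverse.
\<close>

lemma C1_diffeo_real_deriv_nonzero:
  assumes "C1_diffeo_real q" "(q has_real_derivative D) (at r)"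
  shows "D \<noteq> 0"
proof
  assume "D = 0"
  have bij: "bij q" and "inv q C1_differentiable_on UNIV" using assms(1) by (auto simp: C1_diffeo_real_def)
  then obtain E where "(inv q has_vector_derivative E (q r)) (at (q r))"
    unfolding C1_differentiable_on_def by blast
  then have "(inv q has_real_derivative E (q r)) (at (q r))"
    by (simp add: has_real_derivative_iff_has_vector_derivative)
  from DERIV_chain2[OF this assms(2)] have "((\<lambda>x. inv q (q x)) has_real_derivative 0) (at r)"
    using \<open>D = 0\<close> by simp
  then have "((\<lambda>x. x) has_real_derivative 0) (at r)" using bij by (simp add: bij_def inv_f_f)
  moreover have "((\<lambda>x. x) has_real_derivative 1) (at r)" by (rule DERIV_ident)
  ultimately show False using DERIV_unique by fastforce
qed

lemma C1_diffeo_inv: "C1_diffeo g \<Longrightarrow> C1_diffeo (inv g)"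
  by (simp add: C1_diffeo_def bij_imp_bij_inv inv_inv_eq)

lemma twist_map_C1_diffeo: "twist_map f \<Longrightarrow> C1_diffeo f"
  unfolding twist_map_def negative_twist_map_def positive_twist_map_def
  using C1_diffeo_inv by blast

lemma lift_of_id: assumes "is_lift id G" shows "\<exists>k::int. \<forall>x. G x = x + (of_int k, 0)"
proof -
  have "is_lift id (\<lambda>x. x)" by (simp add: is_lift_def)
  from lift_unique[OF this assms] show ?thesis .
qed

text \<open>
  For a negative twist map the inverse of a lift is a lift of the positive twist map, which gives access to
  the second half of the twist condition.
\<close>

lemma inv_lift:
  assumes F: "is_lift (inv g) F" and bij: "bij g" and "C1_annulus g"
  shows "bij F" "is_lift g (inv F)"
proof -
  obtain G where G: "is_lift g G" using assms(3) by (auto simp: C1_annulus_def)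
  have contF: "continuous_on UNIV F" and contG: "continuous_on UNIV G" using F G by (auto simp: is_lift_def)
  have "is_lift id (\<lambda>x. F (G x))"
    unfolding is_lift_def
  proof (intro conjI allI)
    show "continuous_on UNIV (\<lambda>x. F (G x))" by (rule continuous_on_compose2[OF contF contG]) simp
    show "proj (F (G x)) = id (proj x)" for x
      using lift_proj[OF F, of "G x"] lift_proj[OF G, of x] bij by (metis bij_def id_apply inv_f_f)
  qed
  then obtain k :: int where k: "\<And>x. F (G x) = x + (of_int k, 0)" using lift_of_id by blast
  have "is_lift id (\<lambda>x. G (F x))"
    unfolding is_lift_def
  proof (intro conjI allI)
    show "continuous_on UNIV (\<lambda>x. G (F x))" by (rule continuous_on_compose2[OF contG contF]) simp
    show "proj (G (F x)) = id (proj x)" for x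
      using lift_proj[OF F, of x] lift_proj[OF G, of "F x"] bij by (metis bij_def id_apply surj_f_inv_f)
  qed
  then obtain l :: int where l: "\<And>x. G (F x) = x + (of_int l, 0)" using lift_of_id by blast
  have "inj F"
  proof (rule injI)
    fix x y assume "F x = F y"
    then have "G (F x) = G (F y)" by simp
    then show "x = y" unfolding l by simp
  qed
  moreover have FG: "F (G (y - (of_int k, 0))) = y" for y using k[of "y - (of_int k, 0)"] by simp
  then have "surj F" by (rule surjI[of F "\<lambda>y. G (y - (of_int k, 0))"])
  ultimately show bijF: "bij F" by (simp add: bij_def)
  have inv: "inv F y = G (y + (of_int (- k), 0))" for y
  proof (rule inv_f_eq[OF \<open>inj F\<close>])
    have "y + (of_int (- k), 0) = y - (of_int k, 0)" by (simp add: prod_eq_iff)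
    then show "F (G (y + (of_int (- k), 0))) = y" by (simp only: FG)
  qed
  have "inv F = (\<lambda>y. G (y + (of_int (- k), 0)))" using inv by blast
  then show "is_lift g (inv F)" using lift_translate[OF G, of "- k"] by (simp only:)
qed

lemma twist_map_vertical_diffeo:
  assumes "twist_map f" "is_lift f F"
  shows "C1_diffeo_real (\<lambda>r. fst (F (\<theta>, r)))"
  using assms(1) unfolding twist_map_def
proof
  assume "positive_twist_map f"
  then show ?thesis using assms(2) unfolding positive_twist_map_def by blast
next
  assume "negative_twist_map f"
  then obtain g where g: "positive_twist_map g" "f = inv g" unfolding negative_twist_map_def by blast
  then have "bij g" "C1_annulus g" unfolding positive_twist_map_def C1_diffeo_def by blast+
  with assms(2) g(2) have "bij F" "is_lift g (inv F)" using inv_lift by blast+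
  then show ?thesis using g(1) unfolding positive_twist_map_def by (metis inv_inv_eq)
qed

text \<open>
  The mean value inequality for \<open>F - F' x\<close> on a small ball, where its derivative is small by continuity.
\<close>

lemma C1_plane_strict_derivative:
  fixes F :: "real \<times> real \<Rightarrow> real \<times> real" and F' :: "real \<times> real \<Rightarrow> (real \<times> real) \<Rightarrow>\<^sub>L (real \<times> real)"
  assumes F': "\<And>x. (F has_derivative blinfun_apply (F' x)) (at x)" and cont: "continuous_on UNIV F'"
    and e: "e > 0"
  shows "\<exists>\<delta>>0. \<forall>y z. norm (y - x) < \<delta> \<longrightarrow> norm (z - x) < \<delta> \<longrightarrow> norm (F y - F z - F' x (y - z)) \<le> e * norm (y - z)"
proof -
  obtain \<delta> where \<delta>: "\<delta> > 0" "\<And>y. dist y x < \<delta> \<Longrightarrow> dist (F' y) (F' x) < e"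
    using cont e unfolding continuous_on_iff by (metis UNIV_I)
  have "norm (F y - F z - F' x (y - z)) \<le> e * norm (y - z)" if yz: "norm (y - x) < \<delta>" "norm (z - x) < \<delta>" for y z
  proof -
    have "norm ((\<lambda>w. F w - F' x w) y - (\<lambda>w. F w - F' x w) z) \<le> e * norm (y - z)"
    proof (rule differentiable_bound[of "ball x \<delta>" _ "\<lambda>w v. F' w v - F' x v"])
      fix w assume w: "w \<in> ball x \<delta>"
      show "((\<lambda>w. F w - F' x w) has_derivative (\<lambda>v. F' w v - F' x v)) (at w within ball x \<delta>)"
        by (intro has_derivative_diff has_derivative_at_withinI[OF F'] bounded_linear_imp_has_derivative blinfun.bounded_linear_right)
      have "onorm (\<lambda>v. F' w v - F' x v) = norm (F' w - F' x)"
        by (simp add: norm_blinfun.rep_eq minus_blinfun.rep_eq)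
      also have "\<dots> \<le> e" using \<delta>(2)[of w] w by (simp add: dist_norm norm_minus_commute)
      finally show "onorm (\<lambda>v. F' w v - F' x v) \<le> e" .
    qed (use yz in \<open>auto simp: dist_norm norm_minus_commute\<close>)
    then show ?thesis by (simp add: blinfun.diff_right algebra_simps)
  qed
  then show ?thesis using \<delta>(1) by blast
qed

text \<open>
  The rotation number can be read off along the multiples of the period.
\<close>

lemma periodic_point_imp_rational_rotation:
  fixes h :: "real \<Rightarrow> real"
  assumes shift: "\<And>t. h (t + 1) = h t + 1" and lim: "\<And>t. (\<lambda>n. ((h ^^ n) t - t) / real n) \<longlonglongrightarrow> \<rho>"
    and mn: "m < n" and per: "(h ^^ n) t = (h ^^ m) t + of_int k"
  shows "\<rho> \<in> \<rat>"
proof -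
  define q y where "q = n - m" and "y = (h ^^ m) t"
  have q: "q > 0" using mn by (simp add: q_def)
  have hq: "(h ^^ q) y = y + of_int k"
  proof -
    have "n = q + m" using mn by (simp add: q_def)
    then show ?thesis using per by (simp add: y_def funpow_add)
  qed
  have it: "(h ^^ (j * q)) y = y + of_int (int j * k)" for j
  proof (induction j)
    case (Suc j)
    have "(h ^^ (Suc j * q)) y = (h ^^ (j * q)) ((h ^^ q) y)"
      by (simp add: add.commute[of q] funpow_add)
    also have "\<dots> = (h ^^ (j * q)) y + of_int k" unfolding hq by (rule iterate_int_shift) (rule shift)
    finally show ?case using Suc by (simp add: algebra_simps)
  qed simp
  have "strict_mono (\<lambda>j. Suc j * q)" using q by (auto simp: strict_mono_def)
  from LIMSEQ_subseq_LIMSEQ[OF lim[of y] this]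
  have "(\<lambda>j. ((h ^^ (Suc j * q)) y - y) / real (Suc j * q)) \<longlonglongrightarrow> \<rho>" by (simp add: comp_def)
  moreover have "((h ^^ (Suc j * q)) y - y) / real (Suc j * q) = of_int k / real q" for j
  proof -
    have "((h ^^ (Suc j * q)) y - y) / real (Suc j * q) = (real (Suc j) * of_int k) / (real (Suc j) * real q)"
      unfolding it of_nat_mult by simp
    then show ?thesis by (simp only: nonzero_mult_divide_mult_cancel_left[OF of_nat_neq_0])
  qed
  ultimately have "(\<lambda>j::nat. of_int k / real q) \<longlonglongrightarrow> \<rho>" by simp
  then have "\<rho> = of_int k / of_int (int q)" by (simp add: LIMSEQ_const_iff)
  then show ?thesis by (metis Rats_divide Rats_of_int)
qed

lemma annulus_diff_proj:
  assumes "\<bar>fst w - fst z\<bar> < 1 / 2"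
  shows "annulus_diff (proj w) (proj z) = w - z"
  unfolding annulus_diff_def
proof (rule the_equality)
  have "proj (z + (w - z)) = proj w" by simp
  moreover have "fst (w - z) \<in> {- 1 / 2..<1 / 2}"
    using assms unfolding atLeastLessThan_iff fst_diff by linarith
  ultimately show "fst (w - z) \<in> {- 1 / 2..<1 / 2} \<and> (\<exists>za. proj za = proj z \<and> proj (za + (w - z)) = proj w)"
    by blast
  fix v assume v: "fst v \<in> {- 1 / 2..<1 / 2} \<and> (\<exists>za. proj za = proj z \<and> proj (za + v) = proj w)"
  then obtain za where za: "proj za = proj z" "proj (za + v) = proj w" by blast
  obtain m k :: int where "za = z + (of_int m, 0)" "za + v = w + (of_int k, 0)"
    using za proj_eq_iff by metis
  then have vv: "fst v = fst w - fst z + of_int (k - m)" "snd v = snd w - snd z" by (auto simp: prod_eq_iff)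
  have "\<bar>real_of_int (k - m)\<bar> < 1"
    using vv(1) v assms unfolding atLeastLessThan_iff by linarith
  then have "k = m" by linarith
  then show "v = w - z" using vv by (simp add: prod_eq_iff)
qed

section \<open>Mather measures as invariant graphs over the line\<close>

lemma mean_value:
  fixes q :: "real \<Rightarrow> real"
  assumes "\<And>x. (q has_real_derivative q' x) (at x)"
  obtains \<xi> where "min x y \<le> \<xi>" "\<xi> \<le> max x y" "q x - q y = q' \<xi> * (x - y)"
proof (cases x y rule: linorder_cases)
  case less
  from MVT2[OF this, of q q'] assms obtain \<xi> where "x < \<xi>" "\<xi> < y" "q y - q x = (y - x) * q' \<xi>" by blast
  then show ?thesis using that[of \<xi>] by (simp add: algebra_simps)
next
  case equal
  then show ?thesis using that[of x] by simp
next
  case greater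
  from MVT2[OF this, of q q'] assms obtain \<xi> where "y < \<xi>" "\<xi> < x" "q x - q y = (x - y) * q' \<xi>" by blast
  then show ?thesis using that[of \<xi>] by (simp add: algebra_simps)
qed

lemma vertical_partial_derivative:
  fixes F :: "real \<times> real \<Rightarrow> real \<times> real" and F' :: "real \<times> real \<Rightarrow> (real \<times> real) \<Rightarrow>\<^sub>L (real \<times> real)"
  assumes F': "\<And>x. (F has_derivative blinfun_apply (F' x)) (at x)"
  shows "((\<lambda>r. fst (F (\<theta>, r))) has_real_derivative fst (F' (\<theta>, r) (0, 1))) (at r)"
proof -
  have "((\<lambda>r. (\<theta>, r)) has_derivative (\<lambda>h. (0, h))) (at r)"
    by (intro has_derivative_Pair has_derivative_ident has_derivative_const)
  from has_derivative_fst[OF has_derivative_compose[OF this F'[of "(\<theta>, r)"]]]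
  have "((\<lambda>r. fst (F (\<theta>, r))) has_derivative (\<lambda>h. fst (F' (\<theta>, r) (0, h)))) (at r)" .
  then show ?thesis
  proof (rule has_derivative_imp_has_field_derivative)
    show "h * fst (F' (\<theta>, r) (0, 1)) = fst (F' (\<theta>, r) (0, h))" for h
      using pair_linear[OF bounded_linear.linear[OF blinfun.bounded_linear_right[of "F' (\<theta>, r)"]], of "(0, h)"] by simp
  qed
qed

lemma horizontal_partial_derivative:
  fixes F :: "real \<times> real \<Rightarrow> real \<times> real" and F' :: "real \<times> real \<Rightarrow> (real \<times> real) \<Rightarrow>\<^sub>L (real \<times> real)"
  assumes F': "\<And>x. (F has_derivative blinfun_apply (F' x)) (at x)"
  shows "((\<lambda>s. fst (F (s, r))) has_real_derivative fst (F' (s, r) (1, 0))) (at s)"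
proof -
  have "((\<lambda>s. (s, r)) has_derivative (\<lambda>h. (h, 0))) (at s)"
    by (intro has_derivative_Pair has_derivative_ident has_derivative_const)
  from has_derivative_fst[OF has_derivative_compose[OF this F'[of "(s, r)"]]]
  have "((\<lambda>s. fst (F (s, r))) has_derivative (\<lambda>h. fst (F' (s, r) (h, 0)))) (at s)" .
  then show ?thesis
  proof (rule has_derivative_imp_has_field_derivative)
    show "h * fst (F' (s, r) (1, 0)) = fst (F' (s, r) (h, 0))" for h
      using pair_linear[OF bounded_linear.linear[OF blinfun.bounded_linear_right[of "F' (s, r)"]], of "(h, 0)"] by simp
  qed
qed

text \<open>
  \<open>\<sigma>\<close> is the sign of the twist. Reflecting the vertical coordinate by \<open>r \<mapsto> \<sigma> r\<close> changes the sign of the off-diagonal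
  entries of the derivative and turns a negative twist into a positive one.
\<close>

locale irrational_mather =
  fixes f :: "annulus \<Rightarrow> annulus" and \<mu> :: "annulus measure" and M :: "annulus set"
    and F :: "real \<times> real \<Rightarrow> real \<times> real" and F' :: "real \<times> real \<Rightarrow> (real \<times> real) \<Rightarrow>\<^sub>L (real \<times> real)"
    and h :: "real \<Rightarrow> real" and \<rho> \<sigma> :: real
  assumes bij_f: "bij f" and C1_inv: "C1_annulus (inv f)"
    and F: "is_lift f F"
    and F': "\<And>x. (F has_derivative blinfun_apply (F' x)) (at x)"
    and F'_cont: "continuous_on UNIV F'"
    and area: "\<And>x. fst (F' x (1, 0)) * snd (F' x (0, 1)) - fst (F' x (0, 1)) * snd (F' x (1, 0)) = 1"
    and \<sigma>: "\<sigma> = 1 \<or> \<sigma> = - 1"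
    and twist: "\<And>x. 0 < \<sigma> * fst (F' x (0, 1))"
    and AM: "Aubry_Mather_set f M" and inv: "invariant_prob_on f M \<mu>"
    and h: "bilipschitz_circle_lift h"
    and h_F: "\<And>z. z \<in> proj -` M \<Longrightarrow> h (fst z) = fst (F z)"
    and rot: "\<And>t. (\<lambda>n. ((h ^^ n) t - t) / real n) \<longlonglongrightarrow> \<rho>" and irr: "\<rho> \<notin> \<rat>"
begin

lemma M_compact: "compact M" and M_image: "f ` M = M" and M_nonempty: "M \<noteq> {}"
  using AM unfolding Aubry_Mather_set_def ordered_set_def by blast+

lemma \<mu>_sets: "sets \<mu> = sets borel" and \<mu>_total: "emeasure \<mu> (space \<mu>) = 1"
  and \<mu>_distr: "distr \<mu> borel f = \<mu>" and \<mu>_M: "AE x in \<mu>. x \<in> M"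
  using inv unfolding invariant_prob_on_def by blast+

lemma \<mu>_space: "space \<mu> = UNIV"
  using sets_eq_imp_space_eq[OF \<mu>_sets] by simp

sublocale finite_measure \<mu>
  by (rule finite_measureI) (simp add: \<mu>_total)

lemma f_continuous: "continuous_on UNIV f"
  by (rule lift_continuous[OF F])

lemma supp_M: "supp \<mu> = M"
proof (rule supp_eq_Aubry_Mather_set[OF AM inv bij_f f_continuous])
  obtain G where "is_lift (inv f) G" using C1_inv by (auto simp: C1_annulus_def)
  then show "continuous_on UNIV (inv f)" by (rule lift_continuous)
qed

lemma f_measurable: "f \<in> measurable \<mu> borel"
  using borel_measurable_continuous_onI[OF f_continuous] measurable_cong_sets[OF \<mu>_sets refl] by blast

lemma h_strict_mono: "strict_mono h" and h_bij: "bij h" and h_unit: "h (t + 1) = h t + 1"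
  using h unfolding bilipschitz_circle_lift_def by blast+

lemma h_int: "h (t + of_int k) = h t + of_int k"
  using iterate_int_shift[of h 1 t k] h_unit by simp

definition K :: "real set" where "K = fst ` (proj -` M)"

definition g :: "real \<Rightarrow> real" where
  "g t = (if t \<in> K then SOME r. proj (t, r) \<in> M else 0)"

lemma graph_point: "t \<in> K \<Longrightarrow> proj (t, g t) \<in> M"
proof -
  assume t: "t \<in> K"
  then obtain z where "proj z \<in> M" "fst z = t" unfolding K_def by blast
  then have "proj (t, snd z) \<in> M" by (metis prod.collapse)
  then have "proj (t, SOME r. proj (t, r) \<in> M) \<in> M" by (rule someI)
  then show ?thesis using t by (simp add: g_def)
qed

lemmas vertical_deriv = vertical_partial_derivative[OF F']
lemmas horizontal_deriv = horizontal_partial_derivative[OF F']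

text \<open>
  By the twist condition a point is determined by its first coordinate and that of its image, and the
  latter is \<open>h t\<close>.
\<close>

lemma graph_unique: "proj (t, r) \<in> M \<Longrightarrow> t \<in> K \<and> r = g t"
proof -
  assume r: "proj (t, r) \<in> M"
  then have t: "t \<in> K" unfolding K_def by force
  have "fst (F (t, r)) = fst (F (t, g t))"
    using h_F[of "(t, r)"] h_F[of "(t, g t)"] r graph_point[OF t] by simp
  moreover obtain \<xi> where "fst (F (t, r)) - fst (F (t, g t)) = fst (F' (t, \<xi>) (0, 1)) * (r - g t)"
    using mean_value[OF vertical_deriv, of r "g t" t] by blast
  ultimately have "fst (F' (t, \<xi>) (0, 1)) * (r - g t) = 0" by simp
  then show ?thesis using twist[of "(t, \<xi>)"] t by auto
qed

lemma proj_int: "proj (t + of_int k, r) = proj (t, r)"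
  using proj_shift[of "(t, r)" k] by simp

lemma K_int: "t + of_int k \<in> K \<longleftrightarrow> t \<in> K"
proof
  assume "t + of_int k \<in> K"
  from graph_point[OF this] show "t \<in> K" unfolding proj_int using graph_unique by blast
next
  assume "t \<in> K"
  from graph_point[OF this] have "proj (t + of_int k, g t) \<in> M" unfolding proj_int .
  then show "t + of_int k \<in> K" using graph_unique by blast
qed

lemma K_shift: "t + 1 \<in> K \<longleftrightarrow> t \<in> K"
  using K_int[of t 1] by simp

lemma g_shift: "t \<in> K \<Longrightarrow> g (t + 1) = g t"
proof -
  assume "t \<in> K"
  from graph_point[OF this] have "proj (t + of_int 1, g t) \<in> M" unfolding proj_int .
  from graph_unique[OF this] show ?thesis by simp
qed

lemma F_graph: "t \<in> K \<Longrightarrow> F (t, g t) = (h t, g (h t)) \<and> h t \<in> K"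
proof -
  assume t: "t \<in> K"
  have "proj (F (t, g t)) \<in> M" using lift_proj[OF F, of "(t, g t)"] graph_point[OF t] M_image by (metis imageI)
  moreover have "fst (F (t, g t)) = h t" using h_F[of "(t, g t)"] graph_point[OF t] by simp
  ultimately have "proj (h t, snd (F (t, g t))) \<in> M" by (metis prod.collapse)
  from graph_unique[OF this] show ?thesis using \<open>fst (F (t, g t)) = h t\<close> by (simp add: prod_eq_iff)
qed

lemma h_K: "h t \<in> K \<longleftrightarrow> t \<in> K"
proof
  assume "h t \<in> K"
  then have "proj (h t, g (h t)) \<in> f ` M" using graph_point M_image by simp
  then obtain z where z: "z \<in> M" "f z = proj (h t, g (h t))" by force
  obtain w where w: "proj w = z" using proj_surj by blast
  have "proj (F w) = proj (h t, g (h t))" using lift_proj[OF F, of w] w z by simp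
  then obtain k :: int where "F w = (h t, g (h t)) + (of_int k, 0)" using proj_eq_iff by blast
  then have "fst (F w) = h t + of_int k" by simp
  moreover have "fst (F w) = h (fst w)" using h_F[of w] w z by simp
  ultimately have "h (fst w) = h (t + of_int k)" by (simp add: h_int)
  then have "fst w = t + of_int k" using h_strict_mono by (simp add: strict_mono_eq)
  moreover have "fst w \<in> K" using graph_unique[of "fst w" "snd w"] w z by simp
  ultimately show "t \<in> K" using K_int by simp
qed (use F_graph in blast)

lemma K_vimage: "K = abs_circle -` (fst ` M)"
proof (intro equalityI subsetI)
  fix t assume "t \<in> K"
  from graph_point[OF this] show "t \<in> abs_circle -` (fst ` M)" by (force simp: proj_def)
next
  fix t assume "t \<in> abs_circle -` (fst ` M)"
  then obtain z where "z \<in> M" "abs_circle t = fst z" by auto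
  then have "proj (t, snd z) \<in> M" by (simp add: proj_def)
  then show "t \<in> K" using graph_unique by blast
qed

lemma K_closed: "closed K"
  unfolding K_vimage
proof (rule closed_vimage[OF _ continuous_abs_circle])
  have "continuous_on M fst" by (intro continuous_on_fst continuous_on_id)
  then show "closed (fst ` M)" by (intro compact_imp_closed compact_continuous_image M_compact)
qed

lemma K_nonempty: "K \<noteq> {}"
proof -
  obtain z where "z \<in> M" using M_nonempty by blast
  moreover obtain w where "proj w = z" using proj_surj by blast
  ultimately show ?thesis using graph_unique[of "fst w" "snd w"] by auto
qed

lemma deriv_periodic: "F' (x + (of_int k, 0)) = F' x"
proof -
  have "annulus_deriv f (proj (x + (of_int k, 0))) = F' (x + (of_int k, 0))"
    by (rule annulus_deriv_proj[OF F F'])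
  moreover have "annulus_deriv f (proj x) = F' x" by (rule annulus_deriv_proj[OF F F'])
  ultimately show ?thesis by (simp add: blinfun_apply_inject)
qed

text \<open>
  The derivative is periodic, so it suffices to bound it on one compact fundamental domain of a strip.
\<close>

lemma strip_bounds:
  obtains R A b0 B where "\<And>t. \<bar>g t\<bar> \<le> R" "b0 > 0"
    "\<And>x. \<bar>snd x\<bar> \<le> R \<Longrightarrow> b0 \<le> \<sigma> * fst (F' x (0, 1))"
    "\<And>x. \<bar>snd x\<bar> \<le> R \<Longrightarrow> \<sigma> * fst (F' x (0, 1)) \<le> B"
    "\<And>x. \<bar>snd x\<bar> \<le> R \<Longrightarrow> \<bar>fst (F' x (1, 0))\<bar> \<le> A"
proof -
  have "continuous_on M snd" by (intro continuous_on_snd continuous_on_id)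
  then have "compact (snd ` M)" by (intro compact_continuous_image M_compact)
  then obtain R where R: "R > 0" "\<And>r. r \<in> snd ` M \<Longrightarrow> \<bar>r\<bar> \<le> R"
    using compact_imp_bounded bounded_pos by (metis real_norm_def)
  have gR: "\<bar>g t\<bar> \<le> R" for t
  proof (cases "t \<in> K")
    case True
    from imageI[OF graph_point[OF this], of snd] show ?thesis using R(2) by simp
  qed (use R in \<open>simp add: g_def\<close>)
  define Z :: "(real \<times> real) set" where "Z = {0..1} \<times> {- R..R}"
  have Z: "compact Z" "Z \<noteq> {}" using R by (auto simp: Z_def intro: compact_Times)
  have contb: "continuous_on Z (\<lambda>x. \<sigma> * fst (F' x (0, 1)))"
    by (intro continuous_intros continuous_on_subset[OF F'_cont]) auto
  have conta: "continuous_on Z (\<lambda>x. \<bar>fst (F' x (1, 0))\<bar>)"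
    by (intro continuous_intros continuous_on_subset[OF F'_cont]) auto
  obtain x1 where x1: "x1 \<in> Z" "\<And>x. x \<in> Z \<Longrightarrow> \<sigma> * fst (F' x1 (0, 1)) \<le> \<sigma> * fst (F' x (0, 1))"
    using continuous_attains_inf[OF Z contb] by blast
  obtain x2 where x2: "x2 \<in> Z" "\<And>x. x \<in> Z \<Longrightarrow> \<sigma> * fst (F' x (0, 1)) \<le> \<sigma> * fst (F' x2 (0, 1))"
    using continuous_attains_sup[OF Z contb] by blast
  obtain x3 where x3: "x3 \<in> Z" "\<And>x. x \<in> Z \<Longrightarrow> \<bar>fst (F' x (1, 0))\<bar> \<le> \<bar>fst (F' x3 (1, 0))\<bar>"
    using continuous_attains_sup[OF Z conta] by blast
  have red: "\<exists>y\<in>Z. F' y = F' x" if "\<bar>snd x\<bar> \<le> R" for x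
  proof (intro bexI)
    have "0 \<le> frac (fst x)" "frac (fst x) \<le> 1" using frac_lt_1[of "fst x"] by (auto intro: less_imp_le)
    moreover have "x + (of_int (- \<lfloor>fst x\<rfloor>), 0) = (frac (fst x), snd x)" by (simp add: prod_eq_iff frac_def)
    ultimately show "x + (of_int (- \<lfloor>fst x\<rfloor>), 0) \<in> Z" using that by (simp only: Z_def) (simp add: abs_le_iff)
  qed (rule deriv_periodic)
  show thesis
  proof (rule that[of R "\<sigma> * fst (F' x1 (0, 1))" "\<sigma> * fst (F' x2 (0, 1))" "\<bar>fst (F' x3 (1, 0))\<bar>"])
    show "\<bar>g t\<bar> \<le> R" for t by (rule gR)
    show "0 < \<sigma> * fst (F' x1 (0, 1))" by (rule twist)
    fix x :: "real \<times> real" assume "\<bar>snd x\<bar> \<le> R"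
    then obtain y where y: "y \<in> Z" "F' y = F' x" using red by blast
    show "\<sigma> * fst (F' x1 (0, 1)) \<le> \<sigma> * fst (F' x (0, 1))" using x1(2)[OF y(1)] y(2) by simp
    show "\<sigma> * fst (F' x (0, 1)) \<le> \<sigma> * fst (F' x2 (0, 1))" using x2(2)[OF y(1)] y(2) by simp
    show "\<bar>fst (F' x (1, 0))\<bar> \<le> \<bar>fst (F' x3 (1, 0))\<bar>" using x3(2)[OF y(1)] y(2) by simp
  qed
qed

text \<open>
  Go from \<open>(v, g v)\<close> to \<open>(u, g u)\<close> horizontally and then vertically. The first coordinate of the image changes by
  \<open>h u - h v\<close> in total, and by at least \<open>b0 \<bar>g u - g v\<bar>\<close> on the vertical part.
\<close>

lemma graph_lipschitz:
  assumes R: "\<And>t. \<bar>g t\<bar> \<le> R" and b0: "b0 > 0" "\<And>x. \<bar>snd x\<bar> \<le> R \<Longrightarrow> b0 \<le> \<sigma> * fst (F' x (0, 1))"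
    and A: "\<And>x. \<bar>snd x\<bar> \<le> R \<Longrightarrow> \<bar>fst (F' x (1, 0))\<bar> \<le> A"
    and L: "\<And>u v. \<bar>h u - h v\<bar> \<le> L * \<bar>u - v\<bar>"
    and uv: "u \<in> K" "v \<in> K"
  shows "\<bar>g u - g v\<bar> \<le> (L + A) / b0 * \<bar>u - v\<bar>"
proof -
  obtain \<xi> where \<xi>: "min (g u) (g v) \<le> \<xi>" "\<xi> \<le> max (g u) (g v)"
    "fst (F (u, g u)) - fst (F (u, g v)) = fst (F' (u, \<xi>) (0, 1)) * (g u - g v)"
    using mean_value[OF vertical_deriv, of "g u" "g v" u] by blast
  have "\<bar>\<xi>\<bar> \<le> R" using \<xi>(1,2) R[of u] R[of v] by (auto simp: min_def max_def abs_le_iff split: if_splits)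
  then have "b0 \<le> \<bar>fst (F' (u, \<xi>) (0, 1))\<bar>" using b0(2)[of "(u, \<xi>)"] \<sigma> by auto
  then have "b0 * \<bar>g u - g v\<bar> \<le> \<bar>fst (F (u, g u)) - fst (F (u, g v))\<bar>"
    unfolding \<xi>(3) abs_mult by (intro mult_right_mono) auto
  moreover obtain \<zeta> where \<zeta>: "fst (F (u, g v)) - fst (F (v, g v)) = fst (F' (\<zeta>, g v) (1, 0)) * (u - v)"
    using mean_value[OF horizontal_deriv, of u v "g v"] by blast
  have "\<bar>fst (F (u, g v)) - fst (F (v, g v))\<bar> \<le> A * \<bar>u - v\<bar>"
    unfolding \<zeta> abs_mult using A[of "(\<zeta>, g v)"] R by (intro mult_right_mono) auto
  moreover have "\<bar>fst (F (u, g u)) - fst (F (v, g v))\<bar> \<le> L * \<bar>u - v\<bar>"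
    using F_graph[OF uv(1)] F_graph[OF uv(2)] L[of u v] by simp
  ultimately have "b0 * \<bar>g u - g v\<bar> \<le> L * \<bar>u - v\<bar> + A * \<bar>u - v\<bar>" by linarith
  then have "b0 * \<bar>g u - g v\<bar> \<le> (L + A) * \<bar>u - v\<bar>" by (simp only: distrib_right)
  then show ?thesis using b0(1) by (simp add: field_simps)
qed

lemma f_iterate_graph: "t \<in> K \<Longrightarrow> (f ^^ n) (proj (t, g t)) = proj ((h ^^ n) t, g ((h ^^ n) t)) \<and> (h ^^ n) t \<in> K"
proof (induction n)
  case (Suc n)
  then have K: "(h ^^ n) t \<in> K" by blast
  then show ?case using Suc F_graph[OF K] lift_proj[OF F, of "((h ^^ n) t, g ((h ^^ n) t))"] by simp
qed simp

text \<open>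
  No point of \<open>M\<close> is periodic, so the orbit of an atom would consist of infinitely many atoms of the same mass.
\<close>

lemma atomless_\<mu>: "measure \<mu> {x} = 0"
proof (cases "x \<in> M")
  case False
  have "AE y in \<mu>. y \<notin> {x}" using \<mu>_M by eventually_elim (use False in auto)
  then have "emeasure \<mu> {x} = 0"
    by (subst (asm) AE_iff_measurable[of "{x}"]) (auto simp: \<mu>_sets \<mu>_space)
  then show ?thesis by (simp add: measure_def)
next
  case True
  show ?thesis
  proof (rule ccontr)
    assume "measure \<mu> {x} \<noteq> 0"
    then have p: "measure \<mu> {x} > 0" by (simp add: zero_less_measure_iff)
    obtain w where w: "proj w = x" using proj_surj by blast
    define t where "t = fst w"
    have t: "t \<in> K" "x = proj (t, g t)"
      using graph_unique[of t "snd w"] w True by (simp_all add: t_def) (metis prod.collapse)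
    define X where "X n = (f ^^ n) x" for n
    have mass: "measure \<mu> {X n} = measure \<mu> {x}" for n
    proof (induction n)
      case (Suc n)
      have "measure \<mu> {X (Suc n)} = measure \<mu> (f -` {f (X n)} \<inter> space \<mu>)"
        using measure_distr[OF f_measurable, of "{f (X n)}"] by (simp add: \<mu>_distr X_def)
      also have "f -` {f (X n)} \<inter> space \<mu> = {X n}"
        using bij_f by (auto simp: \<mu>_space bij_def inj_eq)
      finally show ?case using Suc by simp
    qed (simp add: X_def)
    have inj: "X n \<noteq> X m" if "m < n" for m n
    proof
      assume "X n = X m"
      then have "proj ((h ^^ n) t, g ((h ^^ n) t)) = proj ((h ^^ m) t, g ((h ^^ m) t))"
        using f_iterate_graph[OF t(1)] t(2) by (simp add: X_def)
      then obtain k :: int where "(h ^^ n) t = (h ^^ m) t + of_int k" unfolding proj_eq_iff by auto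
      from periodic_point_imp_rational_rotation[OF h_unit rot that this] show False using irr by simp
    qed
    then have "inj X" by (intro injI) (metis linorder_neqE_nat)
    obtain N :: nat where N: "1 / measure \<mu> {x} < real N" using reals_Archimedean2 by blast
    have "real N * measure \<mu> {x} = (\<Sum>n<N. measure \<mu> {X n})" by (simp add: mass)
    also have "\<dots> = (\<Sum>y\<in>X ` {..<N}. measure \<mu> {y})"
      using \<open>inj X\<close> by (subst sum.reindex) (auto intro: inj_on_subset)
    also have "\<dots> = measure \<mu> (X ` {..<N})"
      by (intro finite_measure_eq_sum_singleton[symmetric]) (auto simp: \<mu>_sets)
    also have "\<dots> \<le> measure \<mu> (space \<mu>)" by (intro finite_measure_mono) (auto simp: \<mu>_sets \<mu>_space)
    also have "\<dots> = 1" by (simp add: measure_def \<mu>_total)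
    finally show False using N p by (simp add: field_simps)
  qed
qed

lemma supp_positive: "t \<in> K \<Longrightarrow> e > 0 \<Longrightarrow> 0 < measure \<mu> (abs_circle ` ball t e \<times> UNIV)"
proof -
  assume t: "t \<in> K" and e: "e > 0"
  have "open (abs_circle ` ball t e \<times> (UNIV :: real set))"
    by (intro open_Times open_abs_circle_image) auto
  moreover have "proj (t, g t) \<in> abs_circle ` ball t e \<times> UNIV"
    unfolding proj_def fst_conv snd_conv by (intro SigmaI imageI) (simp_all add: e)
  moreover have "proj (t, g t) \<in> supp \<mu>" using graph_point[OF t] supp_M by simp
  ultimately have "emeasure \<mu> (abs_circle ` ball t e \<times> UNIV) > 0" unfolding supp_def mem_Collect_eq by (elim allE impE) (rule conjI)
  then show ?thesis unfolding emeasure_eq_measure by (simp only: ennreal_less_zero_iff)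
qed

text \<open>
  Every point of \<open>M\<close> is in the support, so an isolated point would be an atom.
\<close>

lemma K_islimpt: "t \<in> K \<Longrightarrow> t islimpt K"
  unfolding islimpt_approachable
proof (intro allI impI)
  fix e :: real assume t: "t \<in> K" and e: "e > 0"
  show "\<exists>x'\<in>K. x' \<noteq> t \<and> dist x' t < e"
  proof (rule ccontr)
    assume no: "\<not> ?thesis"
    let ?U = "abs_circle ` ball t e \<times> (UNIV :: real set)"
    have sub: "z = proj (t, g t)" if z: "z \<in> M" "z \<in> ?U" for z
    proof -
      have "fst z \<in> abs_circle ` ball t e" using z(2) by (simp only: mem_Times_iff)
      then obtain s where s: "s \<in> ball t e" "abs_circle s = fst z" by (elim imageE) simp
      have pz: "proj (s, snd z) = z" using s(2) by (simp add: proj_def prod_eq_iff)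
      then have "proj (s, snd z) \<in> M" using z(1) by simp
      from graph_unique[OF this] have sK: "s \<in> K" and sz: "snd z = g s" by blast+
      have "dist s t < e" using s(1) by (simp add: dist_commute)
      then have st: "s = t" using no sK by blast
      have "proj (s, g s) = z" using pz unfolding sz .
      then show ?thesis unfolding st by (rule sym)
    qed
    have Us: "?U \<in> sets \<mu>"
      unfolding \<mu>_sets by (rule borel_open) (intro open_Times open_abs_circle_image open_ball open_UNIV)
    have "measure \<mu> ?U \<le> measure \<mu> {proj (t, g t)}"
    proof (rule finite_measure_mono_AE)
      show "AE z in \<mu>. z \<in> ?U \<longrightarrow> z \<in> {proj (t, g t)}"
        using \<mu>_M by eventually_elim (use sub in blast)
      show "{proj (t, g t)} \<in> sets \<mu>" unfolding \<mu>_sets by simp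
    qed
    then show False using supp_positive[OF t e] atomless_\<mu>[of "proj (t, g t)"] by simp
  qed
qed

section \<open>Transfer between the annulus and the line\<close>

definition \<nu> :: "real measure" where
  "\<nu> = distr \<mu> borel (\<lambda>z. circle_coord (fst z))"

lemma coord_measurable: "(\<lambda>z. circle_coord (fst z)) \<in> borel_measurable \<mu>"
proof -
  have "(fst :: annulus \<Rightarrow> circle) \<in> measurable borel borel"
    by (intro borel_measurable_continuous_onI continuous_on_fst continuous_on_id)
  from measurable_compose[OF this circle_coord_measurable]
  show ?thesis using measurable_cong_sets[OF \<mu>_sets refl] by blast
qed

lemma coord_point:
  assumes "z \<in> M"
  shows "circle_coord (fst z) \<in> K" "proj (circle_coord (fst z), g (circle_coord (fst z))) = z"
proof -
  have z: "proj (circle_coord (fst z), snd z) = z" by (simp add: proj_def)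
  then have "proj (circle_coord (fst z), snd z) \<in> M" using assms by simp
  from graph_unique[OF this] have K: "circle_coord (fst z) \<in> K" and g: "snd z = g (circle_coord (fst z))" by blast+
  show "circle_coord (fst z) \<in> K" by (rule K)
  show "proj (circle_coord (fst z), g (circle_coord (fst z))) = z" using z unfolding g .
qed

lemma AE_\<nu>_imp_\<mu>:
  assumes "AE t in \<nu>. P t" shows "AE z in \<mu>. P (circle_coord (fst z))"
  using AE_distrD[OF coord_measurable] assms unfolding \<nu>_def by blast

lemma \<nu>_sets: "sets \<nu> = sets borel"
  by (simp add: \<nu>_def)

text \<open>
  In the coordinate \<^const>\<open>circle_coord\<close> the map \<open>f\<close> becomes \<open>t \<mapsto> frac (h t)\<close> on \<open>M\<close>.
\<close>

lemma \<nu>_invariant: "distr \<nu> borel (\<lambda>t. frac (h t)) = \<nu>"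
proof -
  have m: "(\<lambda>t. frac (h t)) \<in> borel_measurable borel"
  proof -
    have [measurable]: "h \<in> borel_measurable borel" "(frac :: real \<Rightarrow> real) \<in> borel_measurable borel"
      unfolding frac_def[abs_def] by (intro borel_measurable_mono strict_mono_mono h_strict_mono) measurable
    show ?thesis by measurable
  qed
  have c: "(\<lambda>z. circle_coord (fst z)) \<in> borel_measurable (borel :: annulus measure)"
    using coord_measurable measurable_cong_sets[OF \<mu>_sets refl] by blast
  have "distr \<nu> borel (\<lambda>t. frac (h t)) = distr \<mu> borel ((\<lambda>t. frac (h t)) \<circ> (\<lambda>z. circle_coord (fst z)))"
    unfolding \<nu>_def by (rule distr_distr[OF m coord_measurable])
  also have "\<dots> = distr \<mu> borel ((\<lambda>z. circle_coord (fst z)) \<circ> f)"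
  proof (rule distr_cong_AE[OF refl refl])
    show "AE z in \<mu>. ((\<lambda>t. frac (h t)) \<circ> (\<lambda>z. circle_coord (fst z))) z = ((\<lambda>z. circle_coord (fst z)) \<circ> f) z"
      using \<mu>_M
    proof eventually_elim
      case (elim z)
      let ?t = "circle_coord (fst z)"
      have "f z = proj (F (?t, g ?t))" using lift_proj[OF F, of "(?t, g ?t)"] coord_point(2)[OF elim] by simp
      then have "fst (f z) = abs_circle (h ?t)" using F_graph[OF coord_point(1)[OF elim]] by simp
      then show ?case by (simp add: circle_coord_abs)
    qed
    show "(\<lambda>t. frac (h t)) \<circ> (\<lambda>z. circle_coord (fst z)) \<in> borel_measurable \<mu>"
      by (rule measurable_comp[OF coord_measurable m])
    show "(\<lambda>z. circle_coord (fst z)) \<circ> f \<in> borel_measurable \<mu>"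
      by (rule measurable_comp[OF f_measurable c])
  qed
  also have "\<dots> = distr (distr \<mu> borel f) borel (\<lambda>z. circle_coord (fst z))"
    by (rule distr_distr[OF c f_measurable, symmetric])
  finally show ?thesis unfolding \<mu>_distr \<nu>_def .
qed

text \<open>
  The graph function and the entries of the derivative after the reflection \<open>r \<mapsto> \<sigma> r\<close>.
\<close>

definition graph :: "real \<Rightarrow> real" where "graph t = \<sigma> * g t"
definition ca :: "real \<Rightarrow> real" where "ca t = fst (F' (t, g t) (1, 0))"
definition cb :: "real \<Rightarrow> real" where "cb t = \<sigma> * fst (F' (t, g t) (0, 1))"
definition cc :: "real \<Rightarrow> real" where "cc t = \<sigma> * snd (F' (t, g t) (1, 0))"
definition cd :: "real \<Rightarrow> real" where "cd t = snd (F' (t, g t) (0, 1))"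

lemma \<sigma>_square: "\<sigma> * \<sigma> = 1"
  using \<sigma> by auto

lemma deriv_components:
  "fst (F' (t, g t) v) = ca t * fst v + cb t * (\<sigma> * snd v)"
  "\<sigma> * snd (F' (t, g t) v) = cc t * fst v + cd t * (\<sigma> * snd v)"
proof -
  have *: "F' (t, g t) v = fst v *\<^sub>R F' (t, g t) (1, 0) + snd v *\<^sub>R F' (t, g t) (0, 1)"
    by (rule pair_linear[OF bounded_linear.linear[OF blinfun.bounded_linear_right]])
  have "cb t * (\<sigma> * snd v) = (\<sigma> * \<sigma>) * (fst (F' (t, g t) (0, 1)) * snd v)" by (simp add: cb_def)
  then have 1: "cb t * (\<sigma> * snd v) = fst (F' (t, g t) (0, 1)) * snd v" by (simp only: \<sigma>_square mult_1_left)
  show "fst (F' (t, g t) v) = ca t * fst v + cb t * (\<sigma> * snd v)"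
    unfolding * 1 by (simp add: ca_def)
  show "\<sigma> * snd (F' (t, g t) v) = cc t * fst v + cd t * (\<sigma> * snd v)"
    unfolding * by (simp add: cc_def cd_def algebra_simps)
qed

text \<open>
  Strict differentiability of \<open>F\<close> at a point of the graph, restricted to the graph: distances between points of
  the graph are comparable to those of their first coordinates.
\<close>

lemma graph_linear:
  assumes lip: "\<And>u v. u \<in> K \<Longrightarrow> v \<in> K \<Longrightarrow> \<bar>graph u - graph v\<bar> \<le> C * \<bar>u - v\<bar>" and C: "C \<ge> 0"
    and t: "t \<in> K" and e: "e > 0"
  shows "\<exists>\<delta>>0. \<forall>u\<in>K. \<forall>v\<in>K. \<bar>u - t\<bar> < \<delta> \<longrightarrow> \<bar>v - t\<bar> < \<delta> \<longrightarrow>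
      \<bar>h u - h v - (ca t * (u - v) + cb t * (graph u - graph v))\<bar> \<le> e * \<bar>u - v\<bar> \<and>
      \<bar>graph (h u) - graph (h v) - (cc t * (u - v) + cd t * (graph u - graph v))\<bar> \<le> e * \<bar>u - v\<bar>"
proof -
  have lip': "norm ((u, g u) - (v, g v)) \<le> (1 + C) * \<bar>u - v\<bar>" if "u \<in> K" "v \<in> K" for u v
  proof -
    have "graph u - graph v = \<sigma> * (g u - g v)" by (simp add: graph_def algebra_simps)
    then have "\<bar>g u - g v\<bar> = \<bar>graph u - graph v\<bar>" using \<sigma> by (auto simp: abs_mult)
    then show ?thesis using norm_Pair_le[of "u - v" "g u - g v"] lip[OF that] by (simp add: algebra_simps)
  qed
  define e' where "e' = e / (1 + C)"
  have e': "e' > 0" "e' * (1 + C) = e" using e C by (auto simp: e'_def)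
  obtain \<delta> where \<delta>: "\<delta> > 0" "\<And>y z. norm (y - (t, g t)) < \<delta> \<Longrightarrow> norm (z - (t, g t)) < \<delta> \<Longrightarrow>
      norm (F y - F z - F' (t, g t) (y - z)) \<le> e' * norm (y - z)"
    using C1_plane_strict_derivative[OF F' F'_cont e'(1), of "(t, g t)"] by blast
  show ?thesis
  proof (intro exI[of _ "\<delta> / (1 + C)"] conjI ballI impI)
    show "0 < \<delta> / (1 + C)" using \<delta>(1) C by simp
    fix u v assume uv: "u \<in> K" "v \<in> K" "\<bar>u - t\<bar> < \<delta> / (1 + C)" "\<bar>v - t\<bar> < \<delta> / (1 + C)"
    let ?y = "(u, g u)" and ?z = "(v, g v)"
    define W where "W = F ?y - F ?z - F' (t, g t) (?y - ?z)"
    have near: "norm ((s, g s) - (t, g t)) < \<delta>" if "s \<in> K" "\<bar>s - t\<bar> < \<delta> / (1 + C)" for s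
    proof -
      have "norm ((s, g s) - (t, g t)) \<le> (1 + C) * \<bar>s - t\<bar>" by (rule lip'[OF that(1) t])
      also have "\<dots> < \<delta>" using that(2) C by (simp add: field_simps)
      finally show ?thesis .
    qed
    have "norm W \<le> e' * norm (?y - ?z)"
      unfolding W_def by (rule \<delta>(2)[OF near[OF uv(1,3)] near[OF uv(2,4)]])
    also have "\<dots> \<le> e' * ((1 + C) * \<bar>u - v\<bar>)" using lip'[OF uv(1,2)] e'(1) by (intro mult_left_mono) auto
    also have "\<dots> = e * \<bar>u - v\<bar>" using e'(2) by (simp add: mult.assoc[symmetric])
    finally have W: "norm W \<le> e * \<bar>u - v\<bar>" .
    have dif: "\<sigma> * (g u - g v) = graph u - graph v" "\<sigma> * (g (h u) - g (h v)) = graph (h u) - graph (h v)"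
      by (simp_all add: graph_def algebra_simps)
    have Fuv: "F ?y - F ?z = (h u - h v, g (h u) - g (h v))" using F_graph[OF uv(1)] F_graph[OF uv(2)] by simp
    have "fst W = h u - h v - (ca t * (u - v) + cb t * (graph u - graph v))"
      unfolding W_def Fuv fst_diff deriv_components(1) by (simp add: dif)
    then show "\<bar>h u - h v - (ca t * (u - v) + cb t * (graph u - graph v))\<bar> \<le> e * \<bar>u - v\<bar>"
      using abs_component_le_norm(1)[of W] W by simp
    have "\<sigma> * snd W = \<sigma> * (g (h u) - g (h v)) - \<sigma> * snd (F' (t, g t) (?y - ?z))"
      unfolding W_def Fuv by (simp add: algebra_simps)
    also have "\<dots> = graph (h u) - graph (h v) - (cc t * (u - v) + cd t * (graph u - graph v))"
      unfolding deriv_components(2) by (simp add: dif)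
    finally have "\<bar>graph (h u) - graph (h v) - (cc t * (u - v) + cd t * (graph u - graph v))\<bar> = \<bar>\<sigma> * snd W\<bar>" by simp
    also have "\<dots> = \<bar>snd W\<bar>" using \<sigma> by auto
    finally show "\<bar>graph (h u) - graph (h v) - (cc t * (u - v) + cd t * (graph u - graph v))\<bar> \<le> e * \<bar>u - v\<bar>"
      using abs_component_le_norm(2)[of W] W by simp
  qed
qed

lemma h_lipschitz_bounds:
  obtains L where "L > 0" "\<And>u v. \<bar>h u - h v\<bar> \<le> L * \<bar>u - v\<bar>" "\<And>u v. \<bar>u - v\<bar> \<le> L * \<bar>h u - h v\<bar>"
proof -
  obtain C1 C2 where C: "C1-lipschitz_on UNIV h" "C2-lipschitz_on UNIV (inv h)"
    using h unfolding bilipschitz_circle_lift_def by blast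
  define L where "L = max 1 (max C1 C2)"
  have 1: "\<bar>h u - h v\<bar> \<le> L * \<bar>u - v\<bar>" for u v
  proof -
    have "\<bar>h u - h v\<bar> \<le> C1 * \<bar>u - v\<bar>" using lipschitz_onD[OF C(1), of u v] by (simp add: dist_real_def)
    also have "\<dots> \<le> L * \<bar>u - v\<bar>" by (intro mult_right_mono) (auto simp: L_def)
    finally show ?thesis .
  qed
  have 2: "\<bar>u - v\<bar> \<le> L * \<bar>h u - h v\<bar>" for u v
  proof -
    have "inv h (h w) = w" for w using h_bij by (simp add: bij_def inv_f_f)
    then have "\<bar>u - v\<bar> \<le> C2 * \<bar>h u - h v\<bar>" using lipschitz_onD[OF C(2), of "h u" "h v"] by (simp add: dist_real_def)
    also have "\<dots> \<le> L * \<bar>h u - h v\<bar>" by (intro mult_right_mono) (auto simp: L_def)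
    finally show ?thesis .
  qed
  have "L > 0" by (simp add: L_def)
  then show thesis using 1 2 by (rule that)
qed

lemma irrational_graph_exists:
  obtains L C b0 B where "irrational_graph K h graph ca cb cc cd L C b0 B \<nu> \<rho>"
proof -
  obtain L where L: "L > 0" "\<And>u v. \<bar>h u - h v\<bar> \<le> L * \<bar>u - v\<bar>" "\<And>u v. \<bar>u - v\<bar> \<le> L * \<bar>h u - h v\<bar>"
    by (rule h_lipschitz_bounds) blast
  obtain R b0 B A where R: "\<And>t. \<bar>g t\<bar> \<le> R" and b0: "b0 > 0" "\<And>x. \<bar>snd x\<bar> \<le> R \<Longrightarrow> b0 \<le> \<sigma> * fst (F' x (0, 1))"
    and B: "\<And>x. \<bar>snd x\<bar> \<le> R \<Longrightarrow> \<sigma> * fst (F' x (0, 1)) \<le> B"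
    and A: "\<And>x. \<bar>snd x\<bar> \<le> R \<Longrightarrow> \<bar>fst (F' x (1, 0))\<bar> \<le> A"
    by (rule strip_bounds) blast
  define C where "C = (L + A) / b0"
  have "0 \<le> A" using A[of "(0, g 0)"] R[of 0] by (simp add: order_trans[OF abs_ge_zero])
  then have C: "C \<ge> 0" using L(1) b0(1) by (simp add: C_def)
  have lip: "\<bar>graph u - graph v\<bar> \<le> C * \<bar>u - v\<bar>" if "u \<in> K" "v \<in> K" for u v
  proof -
    have "graph u - graph v = \<sigma> * (g u - g v)" by (simp add: graph_def algebra_simps)
    then have "\<bar>graph u - graph v\<bar> = \<bar>g u - g v\<bar>" using \<sigma> by (auto simp: abs_mult)
    then show ?thesis using graph_lipschitz[OF R b0 A L(2) that] by (simp add: C_def)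
  qed
  have lin: "\<exists>\<delta>>0. \<forall>u\<in>K. \<forall>v\<in>K. \<bar>u - t\<bar> < \<delta> \<longrightarrow> \<bar>v - t\<bar> < \<delta> \<longrightarrow>
      \<bar>h u - h v - (ca t * (u - v) + cb t * (graph u - graph v))\<bar> \<le> e * \<bar>u - v\<bar> \<and>
      \<bar>graph (h u) - graph (h v) - (cc t * (u - v) + cd t * (graph u - graph v))\<bar> \<le> e * \<bar>u - v\<bar>"
    if "t \<in> K" "e > 0" for t e
    by (rule graph_linear[OF lip C that])
  have "irrational_graph K h graph ca cb cc cd L C b0 B \<nu> \<rho>"
  proof
    show "u \<le> v \<Longrightarrow> h v - h u \<le> L * (v - u)" for u v using L(2)[of v u] by simp
    show "u \<le> v \<Longrightarrow> v - u \<le> L * (h v - h u)" for u v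
      using L(3)[of v u] strict_mono_less_eq[OF h_strict_mono, of u v] by simp
    show "t \<in> K \<Longrightarrow> graph (t + 1) = graph t" for t by (simp add: graph_def g_shift)
    show "t \<in> K \<Longrightarrow> ca t * cd t - cb t * cc t = 1" for t
    proof -
      have "cb t * cc t = (\<sigma> * \<sigma>) * (fst (F' (t, g t) (0, 1)) * snd (F' (t, g t) (1, 0)))" by (simp add: cb_def cc_def)
      then show ?thesis using area[of "(t, g t)"] by (simp add: \<sigma>_square ca_def cd_def)
    qed
    show "t \<in> K \<Longrightarrow> b0 \<le> cb t" "t \<in> K \<Longrightarrow> cb t \<le> B" for t
      using b0(2)[of "(t, g t)"] B[of "(t, g t)"] R[of t] by (simp_all add: cb_def)
    show "t \<in> K \<Longrightarrow> 0 < e \<Longrightarrow> \<exists>\<delta>>0. \<forall>u\<in>K. \<forall>v\<in>K. \<bar>u - t\<bar> < \<delta> \<longrightarrow> \<bar>v - t\<bar> < \<delta> \<longrightarrow>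
        \<bar>h u - h v - (ca t * (u - v) + cb t * (graph u - graph v))\<bar> \<le> e * \<bar>u - v\<bar>" for t e
      using lin[of t e] by blast
    show "t \<in> K \<Longrightarrow> 0 < e \<Longrightarrow> \<exists>\<delta>>0. \<forall>u\<in>K. \<forall>v\<in>K. \<bar>u - t\<bar> < \<delta> \<longrightarrow> \<bar>v - t\<bar> < \<delta> \<longrightarrow>
        \<bar>graph (h u) - graph (h v) - (cc t * (u - v) + cd t * (graph u - graph v))\<bar> \<le> e * \<bar>u - v\<bar>" for t e
      using lin[of t e] by blast
    show "emeasure \<nu> UNIV = 1"
      unfolding \<nu>_def using \<mu>_total by (subst emeasure_distr[OF coord_measurable]) simp_all
    show "AE t in \<nu>. t \<in> K \<and> 0 \<le> t \<and> t < 1"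
    proof -
      have "{t. t \<in> K \<and> 0 \<le> t \<and> t < 1} = K \<inter> {0..<1}" by auto
      then have m: "{t \<in> space borel. t \<in> K \<and> 0 \<le> t \<and> t < 1} \<in> sets borel" using K_closed by simp
      show ?thesis unfolding \<nu>_def AE_distr_iff[OF coord_measurable m]
        using \<mu>_M by eventually_elim (simp add: coord_point circle_coord_bounds)
    qed
    show "0 < measure \<nu> {s. \<exists>k::int. \<bar>s + of_int k - t\<bar> < e}" if t: "t \<in> K" and e: "e > 0" for t e
    proof -
      let ?A = "{s. \<exists>k::int. \<bar>s + of_int k - t\<bar> < e}"
      have "?A = (\<Union>k::int. ball (t - of_int k) e)" by (auto simp: dist_real_def abs_minus_commute algebra_simps)
      then have A: "?A \<in> sets borel" by (simp add: borel_open open_UN)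
      have "abs_circle ` ball t e \<times> UNIV \<subseteq> (\<lambda>z. circle_coord (fst z)) -` ?A \<inter> space \<mu>"
      proof
        fix z :: annulus assume "z \<in> abs_circle ` ball t e \<times> UNIV"
        then obtain s where s: "s \<in> ball t e" "fst z = abs_circle s" by (auto simp: mem_Times_iff)
        then have "\<bar>circle_coord (fst z) + of_int \<lfloor>s\<rfloor> - t\<bar> < e"
          by (simp add: circle_coord_abs frac_def dist_real_def abs_minus_commute)
        then show "z \<in> (\<lambda>z. circle_coord (fst z)) -` ?A \<inter> space \<mu>" by (auto simp: \<mu>_space)
      qed
      then have "measure \<mu> (abs_circle ` ball t e \<times> UNIV) \<le> measure \<mu> ((\<lambda>z. circle_coord (fst z)) -` ?A \<inter> space \<mu>)"
        using measurable_sets[OF coord_measurable A] by (intro finite_measure_mono) auto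
      also have "\<dots> = measure \<nu> ?A" unfolding \<nu>_def by (rule measure_distr[OF coord_measurable A, symmetric])
      finally show ?thesis using supp_positive[OF t e] by linarith
    qed
    show "measure \<nu> {t} = 0" for t
    proof -
      have "measure \<nu> {t} = measure \<mu> ((\<lambda>z. circle_coord (fst z)) -` {t} \<inter> space \<mu>)"
        unfolding \<nu>_def by (rule measure_distr[OF coord_measurable]) simp
      also have "\<dots> \<le> measure \<mu> {proj (t, g t)}"
      proof (rule finite_measure_mono_AE)
        show "AE z in \<mu>. z \<in> (\<lambda>z. circle_coord (fst z)) -` {t} \<inter> space \<mu> \<longrightarrow> z \<in> {proj (t, g t)}"
          using \<mu>_M by eventually_elim (use coord_point(2) in force)
        show "{proj (t, g t)} \<in> sets \<mu>" unfolding \<mu>_sets by simp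
      qed
      finally show ?thesis using atomless_\<mu>[of "proj (t, g t)"] by (simp add: measure_le_0_iff)
    qed
  qed (use K_closed K_nonempty K_shift K_islimpt h_strict_mono h_bij h_unit h_K lip \<nu>_sets \<nu>_invariant rot irr b0(1) in auto)
  then show thesis by (rule that)
qed

lemma g_measurable: "g \<in> borel_measurable borel"
proof -
  obtain L C b0 B where "irrational_graph K h graph ca cb cc cd L C b0 B \<nu> \<rho>"
    by (rule irrational_graph_exists)
  then interpret G: irrational_graph K h graph ca cb cc cd L C b0 B \<nu> \<rho> .
  have "continuous_on K graph"
    by (rule lipschitz_on_continuous_on[of C], rule lipschitz_onI)
       (use G.g_lipschitz G.C_nonneg in \<open>auto simp: dist_real_def\<close>)
  then have "continuous_on K (\<lambda>t. \<sigma> * graph t)" by (intro continuous_intros)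
  moreover have "\<sigma> * graph t = g t" for t using \<sigma>_square by (simp add: graph_def flip: mult.assoc)
  ultimately have "continuous_on K g" by simp
  then have "(\<lambda>t. if t \<in> K then g t else 0) \<in> borel_measurable borel"
    using K_closed by (intro borel_measurable_continuous_on_if) auto
  moreover have "(\<lambda>t. if t \<in> K then g t else 0) = g" by (auto simp: g_def)
  ultimately show ?thesis by simp
qed

lemma graph_point_measurable: "(\<lambda>t. proj (t, g t)) \<in> measurable borel borel"
proof -
  have "(\<lambda>t. (t, g t)) \<in> measurable borel borel"
    using g_measurable by (intro borel_measurable_Pair) simp_all
  from measurable_compose[OF this borel_measurable_continuous_onI[OF continuous_proj]]
  show ?thesis .
qed

lemma \<mu>_distr_graph: "distr \<nu> borel (\<lambda>t. proj (t, g t)) = \<mu>"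
proof -
  have "distr \<nu> borel (\<lambda>t. proj (t, g t)) = distr \<mu> borel ((\<lambda>t. proj (t, g t)) \<circ> (\<lambda>z. circle_coord (fst z)))"
    unfolding \<nu>_def by (rule distr_distr[OF graph_point_measurable coord_measurable])
  also have "\<dots> = distr \<mu> borel (\<lambda>z. z)"
  proof (rule distr_cong_AE[OF refl refl])
    show "AE z in \<mu>. ((\<lambda>t. proj (t, g t)) \<circ> (\<lambda>z. circle_coord (fst z))) z = z"
      using \<mu>_M by eventually_elim (simp add: coord_point(2))
    show "(\<lambda>t. proj (t, g t)) \<circ> (\<lambda>z. circle_coord (fst z)) \<in> borel_measurable \<mu>"
      by (rule measurable_comp[OF coord_measurable graph_point_measurable])
    show "(\<lambda>z. z) \<in> borel_measurable \<mu>" using measurable_ident_sets[OF \<mu>_sets] by (simp add: id_def)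
  qed
  also have "\<dots> = \<mu>" by (rule distr_id2[OF \<mu>_sets[symmetric]])
  finally show ?thesis .
qed

text \<open>
  Each of the two measures is the distribution of the other, by \<^const>\<open>circle_coord\<close> in one direction and the
  parametrisation of the graph in the other.
\<close>

lemma AE_\<mu>_iff_\<nu>: "(AE z in \<mu>. P z) \<longleftrightarrow> (AE t in \<nu>. P (proj (t, g t)))"
proof
  assume "AE z in \<mu>. P z"
  then have "AE z in distr \<nu> borel (\<lambda>t. proj (t, g t)). P z" unfolding \<mu>_distr_graph .
  moreover have "(\<lambda>t. proj (t, g t)) \<in> borel_measurable \<nu>"
    using graph_point_measurable measurable_cong_sets[OF \<nu>_sets refl] by blast
  ultimately show "AE t in \<nu>. P (proj (t, g t))" by (rule AE_distrD[rotated])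
next
  assume "AE t in \<nu>. P (proj (t, g t))"
  from AE_\<nu>_imp_\<mu>[OF this] \<mu>_M show "AE z in \<mu>. P z"
    by eventually_elim (simp add: coord_point(2))
qed

lemma cocycle_graph:
  assumes inv_graph: "invariant_graph K h graph ca cb cc cd L C b0 B" and t: "t \<in> K"
  shows "norm (cocycle (annulus_deriv f) f n (proj (t, g t)) v)
    = norm (cocycle (invariant_graph.jacobian ca cb cc cd) h n t (fst v, \<sigma> * snd v))"
proof -
  interpret G: invariant_graph K h graph ca cb cc cd L C b0 B by (rule inv_graph)
  let ?w = "\<lambda>n. cocycle (annulus_deriv f) f n (proj (t, g t)) v"
  have "cocycle G.jacobian h n t (fst v, \<sigma> * snd v) = (fst (?w n), \<sigma> * snd (?w n))"
  proof (induction n)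
    case (Suc n)
    let ?s = "(h ^^ n) t"
    have "?w (Suc n) = F' (?s, g ?s) (?w n)"
      using f_iterate_graph[OF t, of n] annulus_deriv_proj[OF F F'] by simp
    then show ?case using Suc by (simp add: G.jacobian_def deriv_components)
  qed simp
  moreover have "norm (x, \<sigma> * y) = norm (x, y)" for x y :: real
    using \<sigma> by (auto simp: norm_Pair)
  ultimately show ?thesis by (metis prod.collapse)
qed

text \<open>
  The directions with the two extreme slopes belong to the paratingent cone, so a line that contains the cone
  contains them both.
\<close>

lemma regular_imp_equal_slopes:
  assumes inv_graph: "invariant_graph K h graph ca cb cc cd L C b0 B" and t: "t \<in> K"
    and reg: "C1_regular_at M (proj (t, g t))"
  shows "invariant_graph.extreme_limit K 1 (invariant_graph.slope graph) t = invariant_graph.extreme_limit K (-1) (invariant_graph.slope graph) t"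
proof -
  interpret G: invariant_graph K h graph ca cb cc cd L C b0 B by (rule inv_graph)
  obtain D where D: "subspace D" "dim D = 1" "paratingent_cone M (proj (t, g t)) \<subseteq> D"
    using reg unfolding C1_regular_at_def by blast
  have graph_back: "\<sigma> * graph s = g s" for s using \<sigma>_square by (simp add: graph_def flip: mult.assoc)
  have cone: "(1, \<sigma> * G.S s t) \<in> paratingent_cone M (proj (t, g t))" if s: "s = 1 \<or> s = - 1" for s
  proof -
    have "\<exists>u\<in>K. \<exists>v\<in>K. v < u \<and> \<bar>u - t\<bar> < e \<and> \<bar>v - t\<bar> < e \<and> \<bar>G.slope graph (u, v) - G.S s t\<bar> < e" if e: "e > 0" for e
    proof -
      have "eventually (\<lambda>p. fst p \<in> K \<and> snd p \<in> K \<and> fst p \<noteq> snd p \<and> \<bar>fst p - t\<bar> < e \<and> \<bar>snd p - t\<bar> < e) (G.pairs t)"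
        unfolding G.eventually_pairs using e by (intro exI[of _ e]) auto
      from G.frequently_eventually_ex[OF G.extreme_limit_frequently[OF t G.bounded_slope_g s e] this] obtain p where p: "\<bar>G.slope graph p - G.S s t\<bar> < e"
        "fst p \<in> K" "snd p \<in> K" "fst p \<noteq> snd p" "\<bar>fst p - t\<bar> < e" "\<bar>snd p - t\<bar> < e" by blast
      have sym: "G.slope graph (snd p, fst p) = G.slope graph p"
        unfolding G.slope_def fst_conv snd_conv by (metis minus_diff_eq minus_divide_divide)
      show ?thesis
      proof (cases "snd p < fst p")
        case True
        then show ?thesis using p by (intro bexI[of _ "fst p"] bexI[of _ "snd p"]) auto
      next
        case False
        then have "fst p < snd p" using p(4) by simp
        then show ?thesis using p sym by (intro bexI[of _ "snd p"] bexI[of _ "fst p"]) auto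
      qed
    qed
    \<comment> \<open>The shift by \<open>4\<close> keeps the points within \<open>1/4\<close> of \<open>t\<close>, where \<open>annulus_diff\<close> is the plain difference.\<close>
    then have "\<forall>n. \<exists>u v. u \<in> K \<and> v \<in> K \<and> v < u \<and> \<bar>u - t\<bar> < 1 / real (n + 4) \<and> \<bar>v - t\<bar> < 1 / real (n + 4) \<and> \<bar>G.slope graph (u, v) - G.S s t\<bar> < 1 / real (n + 4)"
    proof (intro allI)
      fix n :: nat
      assume ex: "\<And>e. 0 < e \<Longrightarrow> \<exists>u\<in>K. \<exists>v\<in>K. v < u \<and> \<bar>u - t\<bar> < e \<and> \<bar>v - t\<bar> < e \<and> \<bar>G.slope graph (u, v) - G.S s t\<bar> < e"
      have "0 < 1 / real (n + 4)" by simp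
      from ex[OF this] show "\<exists>u v. u \<in> K \<and> v \<in> K \<and> v < u \<and> \<bar>u - t\<bar> < 1 / real (n + 4) \<and> \<bar>v - t\<bar> < 1 / real (n + 4) \<and> \<bar>G.slope graph (u, v) - G.S s t\<bar> < 1 / real (n + 4)"
        by blast
    qed
    then obtain U V where UV: "\<And>n. U n \<in> K" "\<And>n. V n \<in> K" "\<And>n. V n < U n"
      "\<And>n. \<bar>U n - t\<bar> < 1 / real (n + 4)" "\<And>n. \<bar>V n - t\<bar> < 1 / real (n + 4)"
      "\<And>n. \<bar>G.slope graph (U n, V n) - G.S s t\<bar> < 1 / real (n + 4)" by metis
    have lim0: "(\<lambda>n. 1 / real (n + 4)) \<longlonglongrightarrow> 0"
      using LIMSEQ_ignore_initial_segment[OF lim_const_over_n[of 1], of 4] by simp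
    have squeeze: "X \<longlonglongrightarrow> l" if "\<And>n. \<bar>X n - l\<bar> < 1 / real (n + 4)" for X and l :: real
    proof (rule LIM_zero_cancel, rule Lim_null_comparison[OF _ lim0])
      show "\<forall>\<^sub>F n in sequentially. norm (X n - l) \<le> 1 / real (n + 4)"
        by (rule always_eventually, rule allI) (use that in \<open>simp add: less_imp_le\<close>)
    qed
    have limU: "U \<longlonglongrightarrow> t" "V \<longlonglongrightarrow> t" and limS: "(\<lambda>n. G.slope graph (U n, V n)) \<longlonglongrightarrow> G.S s t"
      by (rule squeeze, rule UV)+
    have limX: "(\<lambda>n. proj (X n, g (X n))) \<longlonglongrightarrow> proj (t, g t)" if X: "X \<longlonglongrightarrow> t" "\<And>n. X n \<in> K" for X
    proof -
      have "(\<lambda>n. graph (X n)) \<longlonglongrightarrow> graph t"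
      proof (rule LIM_zero_cancel, rule Lim_null_comparison)
        show "\<forall>\<^sub>F n in sequentially. norm (graph (X n) - graph t) \<le> C * \<bar>X n - t\<bar>"
          using G.g_lipschitz[OF X(2) t] by simp
        have "(\<lambda>n. C * \<bar>X n - t\<bar>) \<longlonglongrightarrow> C * \<bar>t - t\<bar>" by (intro tendsto_intros X)
        then show "(\<lambda>n. C * \<bar>X n - t\<bar>) \<longlonglongrightarrow> 0" by simp
      qed
      then have "(\<lambda>n. \<sigma> * graph (X n)) \<longlonglongrightarrow> \<sigma> * graph t" by (intro tendsto_intros)
      then have "(\<lambda>n. (X n, g (X n))) \<longlonglongrightarrow> (t, g t)" unfolding graph_back by (intro tendsto_Pair X)
      then show ?thesis using continuous_on_tendsto_compose[OF continuous_proj] by simp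
    qed
    show ?thesis
      unfolding paratingent_cone_def mem_Collect_eq
    proof (intro exI conjI allI)
      show "(\<lambda>n. proj (U n, g (U n))) \<longlonglongrightarrow> proj (t, g t)" "(\<lambda>n. proj (V n, g (V n))) \<longlonglongrightarrow> proj (t, g t)"
        using limX limU UV by blast+
      show "proj (U n, g (U n)) \<in> M" "proj (V n, g (V n)) \<in> M" for n using graph_point UV by blast+
      show "0 < U n - V n" for n using UV(3) by simp
      have "(\<lambda>n. U n - V n) \<longlonglongrightarrow> t - t" by (intro tendsto_diff limU)
      then show "(\<lambda>n. U n - V n) \<longlonglongrightarrow> 0" by simp
      have "annulus_diff (proj (U n, g (U n))) (proj (V n, g (V n))) /\<^sub>R (U n - V n) = (1, \<sigma> * G.slope graph (U n, V n))" for n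
      proof -
        have "1 / real (n + 4) \<le> 1 / 4" by (simp add: field_simps)
        then have "\<bar>U n - t\<bar> < 1 / 4" "\<bar>V n - t\<bar> < 1 / 4" using UV(4,5)[of n] by linarith+
        then have "\<bar>fst (U n, g (U n)) - fst (V n, g (V n))\<bar> < 1 / 2" unfolding fst_conv by linarith
        then have "annulus_diff (proj (U n, g (U n))) (proj (V n, g (V n))) = (U n - V n, g (U n) - g (V n))"
          by (simp add: annulus_diff_proj)
        also have "g (U n) - g (V n) = \<sigma> * (graph (U n) - graph (V n))" by (simp add: right_diff_distrib graph_back)
        finally have diff: "annulus_diff (proj (U n, g (U n))) (proj (V n, g (V n))) = (U n - V n, \<sigma> * (graph (U n) - graph (V n)))" .
        have scale: "(x, \<sigma> * y) /\<^sub>R x = (1, \<sigma> * (y / x))" if "x \<noteq> 0" for x y :: real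
          using that by (simp add: prod_eq_iff divide_inverse)
        show ?thesis
          unfolding diff G.slope_def fst_conv snd_conv by (rule scale) (use UV(3)[of n] in simp)
      qed
      then show "(\<lambda>n. annulus_diff (proj (U n, g (U n))) (proj (V n, g (V n))) /\<^sub>R (U n - V n)) \<longlonglongrightarrow> (1, \<sigma> * G.S s t)"
        by (simp only:) (intro tendsto_intros limS)
    qed
  qed
  obtain Bs where Bs: "Bs \<subseteq> D" "independent Bs" "D \<subseteq> span Bs" "card Bs = dim D"
    by (rule basis_exists)
  then have "card Bs = 1" using D(2) by simp
  then obtain e where e: "Bs = {e}" by (rule card_1_singletonE)
  have "(1, \<sigma> * G.S 1 t) \<in> span {e}" "(1, \<sigma> * G.S (-1) t) \<in> span {e}"
    using cone[of 1] cone[of "-1"] D(3) Bs(3) e by auto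
  then obtain k k' where k: "(1, \<sigma> * G.S 1 t) = k *\<^sub>R e" "(1, \<sigma> * G.S (-1) t) = k' *\<^sub>R e"
    unfolding span_singleton by blast
  then have "k * fst e = 1" "k' * fst e = 1" by (simp_all add: prod_eq_iff)
  then have "(k - k') * fst e = 0" "fst e \<noteq> 0" by (auto simp: left_diff_distrib)
  then have "k = k'" by simp
  then have "\<sigma> * G.S 1 t = \<sigma> * G.S (-1) t" using k by (simp add: prod_eq_iff)
  then show ?thesis using \<sigma> by auto
qed

text \<open>
  All secants near the point have nearly the same slope. The work is to replace sequences in \<open>M\<close> by lifts that
  converge in the plane.
\<close>

lemma equal_slopes_imp_regular:
  assumes inv_graph: "invariant_graph K h graph ca cb cc cd L C b0 B" and t: "t \<in> K"
    and eq: "invariant_graph.extreme_limit K 1 (invariant_graph.slope graph) t = invariant_graph.extreme_limit K (-1) (invariant_graph.slope graph) t"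
  shows "C1_regular_at M (proj (t, g t))"
proof -
  interpret G: invariant_graph K h graph ca cb cc cd L C b0 B by (rule inv_graph)
  define s where "s = G.S 1 t"
  have graph_back: "\<sigma> * graph s = g s" for s using \<sigma>_square by (simp add: graph_def flip: mult.assoc)
  have lin: "\<exists>\<delta>>0. \<forall>u\<in>K. \<forall>v\<in>K. \<bar>u - t\<bar> < \<delta> \<and> \<bar>v - t\<bar> < \<delta> \<longrightarrow> \<bar>(g u - g v) - \<sigma> * s * (u - v)\<bar> \<le> e * \<bar>u - v\<bar>" if e: "e > 0" for e
  proof -
    have "eventually (\<lambda>p. \<bar>G.slope graph p - s\<bar> \<le> e) (G.pairs t)"
    proof -
      have "eventually (\<lambda>p. 1 * G.slope graph p < 1 * G.S 1 t + e) (G.pairs t)"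
        by (rule G.extreme_limit_eventually[OF t G.bounded_slope_g _ e]) simp
      moreover have "eventually (\<lambda>p. (- 1) * G.slope graph p < (- 1) * G.S (-1) t + e) (G.pairs t)"
        by (rule G.extreme_limit_eventually[OF t G.bounded_slope_g _ e]) simp
      ultimately show ?thesis
      proof eventually_elim
        case (elim p)
        then show ?case unfolding eq[symmetric] s_def by linarith
      qed
    qed
    then obtain \<delta> where \<delta>: "\<delta> > 0"
      "\<And>u v. u \<in> K \<Longrightarrow> v \<in> K \<Longrightarrow> u \<noteq> v \<Longrightarrow> \<bar>u - t\<bar> < \<delta> \<Longrightarrow> \<bar>v - t\<bar> < \<delta> \<Longrightarrow> \<bar>G.slope graph (u, v) - s\<bar> \<le> e"
      unfolding G.eventually_pairs by blast
    show ?thesis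
    proof (intro exI[of _ \<delta>] conjI ballI impI \<delta>(1))
      fix u v assume uv: "u \<in> K" "v \<in> K" "\<bar>u - t\<bar> < \<delta> \<and> \<bar>v - t\<bar> < \<delta>"
      show "\<bar>(g u - g v) - \<sigma> * s * (u - v)\<bar> \<le> e * \<bar>u - v\<bar>"
      proof (cases "u = v")
        case False
        have "(g u - g v) - \<sigma> * s * (u - v) = \<sigma> * ((graph u - graph v) - s * (u - v))"
          by (simp add: right_diff_distrib graph_back mult.assoc)
        then have "\<bar>(g u - g v) - \<sigma> * s * (u - v)\<bar> = \<bar>(graph u - graph v) - s * (u - v)\<bar>" using \<sigma> by (auto simp: abs_mult)
        also have "(graph u - graph v) - s * (u - v) = (G.slope graph (u, v) - s) * (u - v)"
        proof -
          have "G.slope graph (u, v) * (u - v) = graph u - graph v" using False by (simp add: G.slope_def)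
          then show ?thesis by (simp only: left_diff_distrib)
        qed
        also have "\<bar>\<dots>\<bar> \<le> e * \<bar>u - v\<bar>" unfolding abs_mult using \<delta>(2)[OF uv(1,2) False] uv(3) by (intro mult_right_mono) auto
        finally show ?thesis .
      qed simp
    qed
  qed
  \<comment> \<open>The lift in the unit interval centred at \<open>t\<close>, so that convergence in the circle forces convergence
    to \<open>t\<close>.\<close>
  have lift: "\<exists>u. u \<in> K \<and> - 1/2 \<le> u - t \<and> u - t < 1/2 \<and> proj (u, g u) = z" if z: "z \<in> M" for z
  proof -
    let ?c = "circle_coord (fst z)"
    define k where "k = \<lfloor>?c - t + 1/2\<rfloor>"
    define u where "u = ?c + of_int (- k)"
    have cK: "?c \<in> K" "proj (?c, g ?c) = z" using coord_point[OF z] by auto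
    then have "proj (u, g ?c) = z" unfolding u_def proj_int by simp
    then have "proj (u, g ?c) \<in> M" using z by simp
    from graph_unique[OF this] have "u \<in> K" "g ?c = g u" by blast+
    have "of_int k \<le> ?c - t + 1/2" "?c - t + 1/2 < of_int k + 1"
      using floor_correct[of "?c - t + 1/2"] by (simp_all only: k_def of_int_add of_int_1)
    then have "- 1/2 \<le> u - t" "u - t < 1/2" unfolding u_def of_int_minus by linarith+
    moreover have "proj (u, g u) = z" using \<open>proj (u, g ?c) = z\<close> unfolding \<open>g ?c = g u\<close> .
    ultimately show ?thesis using \<open>u \<in> K\<close> by blast
  qed
  have conv: "X \<longlonglongrightarrow> t" if X: "\<And>n. - 1/2 \<le> X n - t \<and> X n - t < 1/2" "(\<lambda>n. proj (X n, g (X n))) \<longlonglongrightarrow> proj (t, g t)" for X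
  proof (rule LIMSEQ_I)
    fix r :: real assume r: "r > 0"
    define e where "e = min r (1/2)"
    have e: "0 < e" "e \<le> 1/2" "e \<le> r" using r by (auto simp: e_def)
    have "open (abs_circle ` ball t e \<times> (UNIV :: real set))"
      by (intro open_Times open_abs_circle_image) auto
    moreover have "proj (t, g t) \<in> abs_circle ` ball t e \<times> UNIV"
      unfolding proj_def fst_conv snd_conv by (intro SigmaI imageI) (simp_all add: e)
    ultimately have "\<forall>\<^sub>F n in sequentially. proj (X n, g (X n)) \<in> abs_circle ` ball t e \<times> UNIV"
      by (rule topological_tendstoD[OF X(2)])
    then obtain N where N: "\<And>n. n \<ge> N \<Longrightarrow> proj (X n, g (X n)) \<in> abs_circle ` ball t e \<times> UNIV"
      unfolding eventually_sequentially by blast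
    have "norm (X n - t) < r" if "n \<ge> N" for n
    proof -
      have "abs_circle (X n) \<in> abs_circle ` ball t e"
        using N[OF that] unfolding proj_def fst_conv snd_conv mem_Times_iff by blast
      then obtain s where s: "s \<in> ball t e" "abs_circle (X n) = abs_circle s" by (elim imageE) simp
      then obtain k :: int where k: "X n = s + of_int k" using abs_circle_eq_iff_ex by blast
      have st: "\<bar>s - t\<bar> < e" using s(1) by (simp add: dist_real_def abs_minus_commute)
      have "real_of_int k < 1" "- 1 < real_of_int k" using X(1)[of n] k st e(2) by linarith+
      then have "k = 0" by simp
      then show ?thesis using k st e(3) by simp
    qed
    then show "\<exists>no. \<forall>n\<ge>no. norm (X n - t) < r" by blast
  qed
  have cone: "snd w = \<sigma> * s * fst w" if w: "w \<in> paratingent_cone M (proj (t, g t))" for w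
  proof -
    obtain X Y \<tau> where XY: "\<And>n. X n \<in> M" "\<And>n. Y n \<in> M" "X \<longlonglongrightarrow> proj (t, g t)" "Y \<longlonglongrightarrow> proj (t, g t)"
      "\<And>n. \<tau> n > (0::real)" "(\<lambda>n. annulus_diff (X n) (Y n) /\<^sub>R \<tau> n) \<longlonglongrightarrow> w"
      using w unfolding paratingent_cone_def by blast
    obtain U where U: "\<And>n. U n \<in> K" "\<And>n. - 1/2 \<le> U n - t \<and> U n - t < 1/2" "\<And>n. proj (U n, g (U n)) = X n"
      using lift[OF XY(1)] by metis
    obtain V where V: "\<And>n. V n \<in> K" "\<And>n. - 1/2 \<le> V n - t \<and> V n - t < 1/2" "\<And>n. proj (V n, g (V n)) = Y n"
      using lift[OF XY(2)] by metis
    have limU: "U \<longlonglongrightarrow> t" using conv[OF U(2)] XY(3) U(3) by simp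
    have limV: "V \<longlonglongrightarrow> t" using conv[OF V(2)] XY(4) V(3) by simp
    have lf: "(\<lambda>n. fst (annulus_diff (X n) (Y n) /\<^sub>R \<tau> n)) \<longlonglongrightarrow> fst w" by (rule tendsto_fst[OF XY(6)])
    have ls: "(\<lambda>n. snd (annulus_diff (X n) (Y n) /\<^sub>R \<tau> n)) \<longlonglongrightarrow> snd w" by (rule tendsto_snd[OF XY(6)])
    have le: "\<bar>snd w - \<sigma> * s * fst w\<bar> \<le> e * \<bar>fst w\<bar>" if e: "e > 0" for e
    proof -
      obtain \<delta> where \<delta>: "\<delta> > 0" "\<And>u v. u \<in> K \<Longrightarrow> v \<in> K \<Longrightarrow> \<bar>u - t\<bar> < \<delta> \<Longrightarrow> \<bar>v - t\<bar> < \<delta> \<Longrightarrow> \<bar>(g u - g v) - \<sigma> * s * (u - v)\<bar> \<le> e * \<bar>u - v\<bar>"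
        using lin[OF e] by blast
      define \<delta>' where "\<delta>' = min \<delta> (1/4)"
      have "\<delta>' > 0" using \<delta>(1) by (simp add: \<delta>'_def)
      have "\<forall>\<^sub>F n in sequentially. \<bar>U n - t\<bar> < \<delta>'" "\<forall>\<^sub>F n in sequentially. \<bar>V n - t\<bar> < \<delta>'"
        using tendstoD[OF limU \<open>\<delta>' > 0\<close>] tendstoD[OF limV \<open>\<delta>' > 0\<close>] by (simp_all add: dist_real_def)
      then have "\<forall>\<^sub>F n in sequentially. \<bar>snd (annulus_diff (X n) (Y n) /\<^sub>R \<tau> n) - \<sigma> * s * fst (annulus_diff (X n) (Y n) /\<^sub>R \<tau> n)\<bar>
          \<le> e * \<bar>fst (annulus_diff (X n) (Y n) /\<^sub>R \<tau> n)\<bar>"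
      proof eventually_elim
        case (elim n)
        have "\<bar>fst (U n, g (U n)) - fst (V n, g (V n))\<bar> < 1 / 2" using elim unfolding \<delta>'_def fst_conv by linarith
        from annulus_diff_proj[OF this] have diff: "annulus_diff (X n) (Y n) = (U n - V n, g (U n) - g (V n))"
          by (simp add: U(3) V(3))
        have "\<bar>(g (U n) - g (V n)) - \<sigma> * s * (U n - V n)\<bar> \<le> e * \<bar>U n - V n\<bar>"
          using elim by (intro \<delta>(2) U V) (auto simp: \<delta>'_def)
        then have "\<bar>(g (U n) - g (V n)) - \<sigma> * s * (U n - V n)\<bar> / \<tau> n \<le> e * \<bar>U n - V n\<bar> / \<tau> n"
          using XY(5)[of n] by (simp add: divide_right_mono)
        moreover have "\<bar>(g (U n) - g (V n)) - \<sigma> * s * (U n - V n)\<bar> / \<tau> n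
            = \<bar>(g (U n) - g (V n)) / \<tau> n - \<sigma> * s * ((U n - V n) / \<tau> n)\<bar>"
        proof -
          have gen: "x / \<tau> n - p * (y / \<tau> n) = (x - p * y) / \<tau> n" for x y p :: real
            by (simp add: diff_divide_distrib)
          have "(g (U n) - g (V n)) / \<tau> n - \<sigma> * s * ((U n - V n) / \<tau> n) = ((g (U n) - g (V n)) - \<sigma> * s * (U n - V n)) / \<tau> n"
            by (rule gen)
          then show ?thesis using XY(5)[of n] by (simp add: abs_divide)
        qed
        moreover have "e * \<bar>U n - V n\<bar> / \<tau> n = e * \<bar>(U n - V n) / \<tau> n\<bar>" using XY(5)[of n] by (simp add: abs_divide)
        moreover have scale: "x /\<^sub>R \<tau> n = x / \<tau> n" for x :: real by (simp add: divide_inverse mult.commute)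
        ultimately show ?case unfolding diff fst_scaleR snd_scaleR fst_conv snd_conv scale by linarith
      qed
      moreover have "(\<lambda>n. \<bar>snd (annulus_diff (X n) (Y n) /\<^sub>R \<tau> n) - \<sigma> * s * fst (annulus_diff (X n) (Y n) /\<^sub>R \<tau> n)\<bar>) \<longlonglongrightarrow> \<bar>snd w - \<sigma> * s * fst w\<bar>"
        by (intro tendsto_intros lf ls)
      moreover have "(\<lambda>n. e * \<bar>fst (annulus_diff (X n) (Y n) /\<^sub>R \<tau> n)\<bar>) \<longlonglongrightarrow> e * \<bar>fst w\<bar>"
        by (intro tendsto_intros lf)
      ultimately show ?thesis using tendsto_le[OF sequentially_bot] by blast
    qed
    have "\<bar>snd w - \<sigma> * s * fst w\<bar> \<le> 0"
    proof (rule field_le_epsilon)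
      fix e :: real assume e: "e > 0"
      have p: "0 < 1 + \<bar>fst w\<bar>" by linarith
      have "\<bar>snd w - \<sigma> * s * fst w\<bar> \<le> e / (1 + \<bar>fst w\<bar>) * \<bar>fst w\<bar>" by (rule le) (use e p in simp)
      also have "\<dots> \<le> e / (1 + \<bar>fst w\<bar>) * (1 + \<bar>fst w\<bar>)" using e p by (intro mult_left_mono) auto
      also have "\<dots> = e" using p by simp
      finally show "\<bar>snd w - \<sigma> * s * fst w\<bar> \<le> 0 + e" by simp
    qed
    then show ?thesis by simp
  qed
  show ?thesis
    unfolding C1_regular_at_def
  proof (intro exI[of _ "span {(1, \<sigma> * s)}"] conjI subsetI)
    have "independent {(1::real, \<sigma> * s)}" by (simp add: prod_eq_iff)
    from dim_eq_card_independent[OF this] show "dim (span {(1::real, \<sigma> * s)}) = 1" by (simp add: dim_span)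
    fix w assume "w \<in> paratingent_cone M (proj (t, g t))"
    then have "w = fst w *\<^sub>R (1::real, \<sigma> * s)" using cone[of w] by (simp add: prod_eq_iff mult.commute)
    then show "w \<in> span {(1::real, \<sigma> * s)}" unfolding span_singleton by blast
  qed (rule subspace_span)
qed

theorem regular_iff_zero_exponents:
  "(AE x in \<mu>. C1_regular_at (supp \<mu>) x) \<longleftrightarrow> lyapunov_exponents (annulus_deriv f) f \<mu> = {0}"
proof -
  obtain L C b0 B where gr: "irrational_graph K h graph ca cb cc cd L C b0 B \<nu> \<rho>"
    by (rule irrational_graph_exists)
  then interpret G: irrational_graph K h graph ca cb cc cd L C b0 B \<nu> \<rho> .
  have inv: "invariant_graph K h graph ca cb cc cd L C b0 B" by (rule G.invariant_graph_axioms)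
  have "(AE x in \<mu>. C1_regular_at (supp \<mu>) x) \<longleftrightarrow> (AE t in \<nu>. C1_regular_at M (proj (t, g t)))"
    unfolding supp_M by (rule AE_\<mu>_iff_\<nu>)
  also have "\<dots> \<longleftrightarrow> (AE t in \<nu>. G.S 1 t = G.S (-1) t)"
  proof (intro iffI)
    assume "AE t in \<nu>. C1_regular_at M (proj (t, g t))"
    then show "AE t in \<nu>. G.S 1 t = G.S (-1) t"
      using G.AE_K by eventually_elim (use regular_imp_equal_slopes[OF inv] in blast)
  next
    assume "AE t in \<nu>. G.S 1 t = G.S (-1) t"
    then show "AE t in \<nu>. C1_regular_at M (proj (t, g t))"
      using G.AE_K by eventually_elim (use equal_slopes_imp_regular[OF inv] in blast)
  qed
  finally have reg: "(AE x in \<mu>. C1_regular_at (supp \<mu>) x) \<longleftrightarrow> (AE t in \<nu>. G.S 1 t = G.S (-1) t)" .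
  show ?thesis
  proof
    assume "AE x in \<mu>. C1_regular_at (supp \<mu>) x"
    then have "AE t in \<nu>. G.S 1 t = G.S (-1) t" using reg by blast
    from G.regular_imp_zero_exponents[OF this] G.AE_K
    have "AE t in \<nu>. \<forall>v. v \<noteq> 0 \<longrightarrow> (\<lambda>n. ln (norm (cocycle (annulus_deriv f) f n (proj (t, g t)) v)) / real n) \<longlonglongrightarrow> 0"
    proof eventually_elim
      case (elim t)
      show ?case
      proof (intro allI impI)
        fix v :: "real \<times> real" assume "v \<noteq> 0"
        then have "(fst v, \<sigma> * snd v) \<noteq> 0" using \<sigma> by (auto simp: prod_eq_iff)
        then show "(\<lambda>n. ln (norm (cocycle (annulus_deriv f) f n (proj (t, g t)) v)) / real n) \<longlonglongrightarrow> 0"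
          using elim cocycle_graph[OF inv] by simp
      qed
    qed
    then have all: "AE x in \<mu>. \<forall>v. v \<noteq> 0 \<longrightarrow> (\<lambda>n. ln (norm (cocycle (annulus_deriv f) f n x v)) / real n) \<longlonglongrightarrow> 0"
      unfolding AE_\<mu>_iff_\<nu> .
    show "lyapunov_exponents (annulus_deriv f) f \<mu> = {0}"
    proof (intro equalityI subsetI)
      fix x assume "x \<in> lyapunov_exponents (annulus_deriv f) f \<mu>"
      then have "AE z in \<mu>. \<exists>v. v \<noteq> 0 \<and> (\<lambda>n. ln (norm (cocycle (annulus_deriv f) f n z v)) / real n) \<longlonglongrightarrow> x"
        by (simp add: lyapunov_exponents_def)
      then have "AE z in \<mu>. x = 0" using all by eventually_elim (use LIMSEQ_unique in blast)
      then have "x = 0"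
      proof (rule contrapos_pp)
        assume "x \<noteq> 0"
        show "\<not> (AE z in \<mu>. x = 0)"
          using \<open>x \<noteq> 0\<close> \<mu>_total by (simp add: AE_iff_null sets.top null_sets_def)
      qed
      then show "x \<in> {0}" by simp
    next
      fix x :: real assume "x \<in> {0}"
      have "AE z in \<mu>. \<exists>v. v \<noteq> 0 \<and> (\<lambda>n. ln (norm (cocycle (annulus_deriv f) f n z v)) / real n) \<longlonglongrightarrow> 0"
        using all
      proof eventually_elim
        case (elim z)
        have "((1::real), (0::real)) \<noteq> 0" by (simp add: prod_eq_iff)
        then show ?case using elim by blast
      qed
      then show "x \<in> lyapunov_exponents (annulus_deriv f) f \<mu>" using \<open>x \<in> {0}\<close> by (simp add: lyapunov_exponents_def)
    qed
  next
    assume "lyapunov_exponents (annulus_deriv f) f \<mu> = {0}"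
    then have "AE z in \<mu>. \<exists>v. v \<noteq> 0 \<and> (\<lambda>n. ln (norm (cocycle (annulus_deriv f) f n z v)) / real n) \<longlonglongrightarrow> 0"
      by (auto simp: lyapunov_exponents_def)
    then have "AE t in \<nu>. \<exists>v. v \<noteq> 0 \<and> (\<lambda>n. ln (norm (cocycle (annulus_deriv f) f n (proj (t, g t)) v)) / real n) \<longlonglongrightarrow> 0"
      unfolding AE_\<mu>_iff_\<nu> .
    then have "AE t in \<nu>. \<exists>w. w \<noteq> 0 \<and> (\<lambda>n. ln (norm (cocycle G.jacobian h n t w)) / real n) \<longlonglongrightarrow> 0"
      using G.AE_K
    proof eventually_elim
      case (elim t)
      then obtain v where v: "v \<noteq> 0" "(\<lambda>n. ln (norm (cocycle (annulus_deriv f) f n (proj (t, g t)) v)) / real n) \<longlonglongrightarrow> 0" by blast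
      have "(fst v, \<sigma> * snd v) \<noteq> 0" using v(1) \<sigma> by (auto simp: prod_eq_iff)
      then show ?case using v(2) cocycle_graph[OF inv] elim by (intro exI[of _ "(fst v, \<sigma> * snd v)"]) simp
    qed
    then have "AE t in \<nu>. G.S 1 t = G.S (-1) t" by (rule G.zero_exponents_imp_regular)
    then show "AE x in \<mu>. C1_regular_at (supp \<mu>) x" using reg by blast
  qed
qed

end

text \<open>
  A continuous function without zeros on a connected space has constant sign.
\<close>

lemma twist_sign:
  fixes F' :: "real \<times> real \<Rightarrow> (real \<times> real) \<Rightarrow>\<^sub>L (real \<times> real)"
  assumes cont: "continuous_on UNIV F'" and nz: "\<And>x. fst (F' x (0, 1)) \<noteq> 0"
  obtains \<sigma> :: real where "\<sigma> = 1 \<or> \<sigma> = - 1" "\<And>x. 0 < \<sigma> * fst (F' x (0, 1))"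
proof -
  let ?b = "\<lambda>x. fst (F' x (0, 1))"
  have "continuous_on UNIV ?b" by (intro continuous_intros cont)
  then have "connected (range ?b)" by (rule connected_continuous_image[OF _ connected_UNIV])
  then have same: "\<not> (?b x < 0 \<and> 0 < ?b y)" for x y
    using connectedD_interval[of "range ?b" "?b x" "?b y" 0] nz by force
  show thesis
  proof (cases "?b 0 < 0")
    case True
    have "?b x < 0" for x using same[of 0 x] True nz[of x] by linarith
    then show thesis by (intro that[of "-1"]) auto
  next
    case False
    have "0 < ?b x" for x using same[of x 0] False nz[of x] nz[of 0] by linarith
    then show thesis by (intro that[of 1]) auto
  qed
qed

theorem theorem1:
  fixes f :: "annulus \<Rightarrow> annulus" and \<mu> :: "annulus measure"
  assumes "twist_map f"
    and "exact_symplectic f"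
    and "irrational_Mather_measure f \<mu>"
  shows "(AE x in \<mu>. C1_regular_at (supp \<mu>) x) \<longleftrightarrow>
         lyapunov_exponents (annulus_deriv f) f \<mu> = {0}"
proof -
  have f: "bij f" "C1_annulus f" "C1_annulus (inv f)"
    using twist_map_C1_diffeo[OF assms(1)] by (auto simp: C1_diffeo_def)
  obtain M where M: "irrational_Aubry_Mather_set f M" "invariant_prob_on f M \<mu>"
    using assms(3) unfolding irrational_Mather_measure_def by blast
  then obtain F \<rho> where AM: "Aubry_Mather_set f M" and F: "is_lift f F" and rot: "has_rotation_number M F \<rho>" "\<rho> \<notin> \<rat>"
    unfolding irrational_Aubry_Mather_set_def by blast
  obtain h where h: "bilipschitz_circle_lift h" "\<And>z. z \<in> proj -` M \<Longrightarrow> h (fst z) = fst (F z)"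
    "\<And>t. (\<lambda>n. ((h ^^ n) t - t) / real n) \<longlonglongrightarrow> \<rho>"
    using rot(1) unfolding has_rotation_number_def by blast
  obtain F' where F': "\<And>x. (F has_derivative blinfun_apply (F' x)) (at x)" "continuous_on UNIV F'"
    using C1_plane_lift[OF f(2) F] unfolding C1_plane_def by blast
  have nz: "fst (F' x (0, 1)) \<noteq> 0" for x
  proof -
    have "C1_diffeo_real (\<lambda>r. fst (F (fst x, r)))" by (rule twist_map_vertical_diffeo[OF assms(1) F])
    moreover have "((\<lambda>r. fst (F (fst x, r))) has_real_derivative fst (F' (fst x, snd x) (0, 1))) (at (snd x))"
      by (rule vertical_partial_derivative[OF F'(1)])
    ultimately show ?thesis using C1_diffeo_real_deriv_nonzero by fastforce
  qed
  obtain \<sigma> :: real where \<sigma>: "\<sigma> = 1 \<or> \<sigma> = - 1" "\<And>x. 0 < \<sigma> * fst (F' x (0, 1))"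
    by (rule twist_sign[OF F'(2) nz]) blast
  have area: "fst (F' x (1, 0)) * snd (F' x (0, 1)) - fst (F' x (0, 1)) * snd (F' x (1, 0)) = 1" for x
  proof -
    obtain T where T: "\<And>x. ((\<lambda>y. T (proj y)) has_derivative
        (\<lambda>v. pullback f liouville_form (proj x) v - liouville_form (proj x) v)) (at x)"
      using assms(2) unfolding exact_symplectic_def exact_form_def by blast
    have "((\<lambda>y. T (proj y)) has_derivative (\<lambda>v. snd (F x) * fst (F' x v) - snd x * fst v)) (at x)" for x
      using T[of x] annulus_deriv_proj[OF F F'(1), of x] lift_proj[OF F, of x]
      by (simp add: pullback_def liouville_form_def)
    then show ?thesis by (rule exact_imp_det_1[OF F'])
  qed
  interpret irrational_mather f \<mu> M F F' h \<rho> \<sigma>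
    by standard (use f F F' area \<sigma> AM M(2) h rot(2) in blast)+
  show ?thesis by (rule regular_iff_zero_exponents)
qed

end
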